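(* Let $R$ be a unital, associative ring with Jacobson radical $J(R)$ such that $R/J(R)$ is commutative. Then $\sigma(R) \neq 13$.
   Context: A subring of a ring $R$ is a subset that is a group under addition and is closed under multiplication; it need not contain a multiplicative identity. A cover of $R$ is a collection of proper subrings of $R$ whose set-theoretic union equals $R$. If a cover exists, $R$ is coverable and $\sigma(R)$ denotes the cardinality of a minimal cover (a cover of least cardinality); if $R$ is not coverable, $\sigma(R) = \infty$. *)

theory Defs
  imports "HOL-Algebra.QuotRing" "HOL-Library.Extended_Nat"
begin

section \<open>Jacobson radical\<close>

definition left_ideal :: "'a set \<Rightarrow> ('a, 'b) ring_scheme \<Rightarrow> bool" where
  "left_ideal I R \<longleftrightarrow>
     additive_subgroup I R \<and> (\<forall>r\<in>carrier R. \<forall>a\<in>I. r \<otimes>\<^bsub>R\<^esub> a \<in> I)"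

definition maximal_left_ideal :: "'a set \<Rightarrow> ('a, 'b) ring_scheme \<Rightarrow> bool" where
  "maximal_left_ideal M R \<longleftrightarrow>
     left_ideal M R \<and> M \<noteq> carrier R \<and>
     (\<forall>I. left_ideal I R \<and> M \<subseteq> I \<longrightarrow> I = M \<or> I = carrier R)"

text \<open>The intersection with the carrier only matters for the zero ring, which has no
  maximal left ideal.\<close>

definition jacobson_radical :: "('a, 'b) ring_scheme \<Rightarrow> 'a set" where
  "jacobson_radical R = carrier R \<inter> \<Inter>{M. maximal_left_ideal M R}"

section \<open>Covers by proper subrings\<close>

text \<open>Unlike \<open>subring\<close> of HOL-Algebra, subrings here need not contain the identity.\<close>

definition nonunital_subring :: "'a set \<Rightarrow> ('a, 'b) ring_scheme \<Rightarrow> bool" where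
  "nonunital_subring S R \<longleftrightarrow>
     additive_subgroup S R \<and> (\<forall>a\<in>S. \<forall>b\<in>S. a \<otimes>\<^bsub>R\<^esub> b \<in> S)"

definition ring_cover :: "'a set set \<Rightarrow> ('a, 'b) ring_scheme \<Rightarrow> bool" where
  "ring_cover C R \<longleftrightarrow>
     (\<forall>S\<in>C. nonunital_subring S R \<and> S \<noteq> carrier R) \<and> \<Union>C = carrier R"

definition coverable :: "('a, 'b) ring_scheme \<Rightarrow> bool" where
  "coverable R \<longleftrightarrow> (\<exists>C. ring_cover C R)"

definition ecard :: "'a set \<Rightarrow> enat" where
  "ecard A = (if finite A then enat (card A) else \<infinity>)"

text \<open>As \<open>enat\<close> is well-ordered, the infimum below is attained. All infinite cardinalities
  are identified with \<open>\<infinity>\<close>, so \<open>\<infinity>\<close> means that there is no finite cover.\<close>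

definition covering_number :: "('a, 'b) ring_scheme \<Rightarrow> enat" where
  "covering_number R =
     (if coverable R then (INF C\<in>{C. ring_cover C R}. ecard C) else \<infinity>)"

end

theory Submission
  imports Defs "HOL-Algebra.Multiplicative_Group" "HOL-Computational_Algebra.Primes"
begin

text \<open>Subrings of quotients of \<open>R\<close> are represented by subrings, containing a fixed ideal, of the free ring on
  the elements of \<open>R\<close>; quotients are then ordered by inclusion of ideals of one type. By the lemmas of
  Neumann and Lewin, a 13-element cover passes to a finite quotient; choose a smallest quotient \<open>A\<close> that still has
  such a cover. It has no cover by 12 subrings, and no proper quotient of it has a cover by 13.

  If \<open>A\<close> has a minimal ideal \<open>I\<close> with \<open>I\<^sup>2 = 0\<close>, let \<open>q = |I|\<close>. The members of the cover that do not contain \<open>I\<close>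
  are complements of \<open>I\<close>, and they must cover a coset of \<open>I\<close> that the other members miss; hence \<open>2 \<le> q \<le> 12\<close>, and
  \<open>q \<noteq> 12\<close> because \<open>q\<close> is a prime power. Two different complements give a nonzero derivation into \<open>I\<close>, from
  which one builds a cover of size \<open>q + 1 \<le> 12\<close>.

  Otherwise \<open>A\<close> is a product of finite fields. A maximal subring either restricts one coordinate to a maximal
  subfield or is the graph of an isomorphism between two coordinates. Counting the residues that the subrings
  involving a fixed coordinate must reach shows that the field size is at most 20. For the sizes 2, 3, 4 and 8 it also
  forces enough coordinates of that size for a cover with 3, 6, at most 11 and 12 members, respectively; the other
  sizes require more than 13 subrings.\<close>

section \<open>Additive subgroups of finite index\<close>

text \<open>What is derived is that a cover with at most 13 members forces one with at most 12, so
  that 13 is never the least size. The number 13 matters twice. A square-zero minimal ideal of order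
  \<open>q\<close> leads to covers of size \<open>q + 1\<close>, and 13 would need
  \<open>q = 12\<close>. Products of fields leave a gap: \<open>p\<close> coordinates of prime size
  \<open>p\<close> are covered by the \<open>p\<close> coordinate ideals and one diagonal for each
  pair, which makes 3, 6, 15 members for \<open>p = 2, 3, 5\<close>.

  Smallness of the quotient is what produces missed cosets: members that all contain a larger ideal
  would, if they covered, cover a smaller quotient.

  Commutativity modulo the radical \<open>J\<close> enters because \<open>J\<close> is nil in every
  finite quotient, and a nil ideal annihilates minimal ideals. So commutators act on a minimal ideal
  as zero, and multiplication by any ring element is a bimodule endomorphism of it.

  The given ring is a record with a carrier, while the arguments use type classes on a whole type;
  the free ring supplies such a type, and statements about quotients become congruences in
  it.\<close>

definition asub :: "'a::ab_group_add set \<Rightarrow> bool" where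
  "asub S \<longleftrightarrow> 0 \<in> S \<and> (\<forall>x\<in>S. \<forall>y\<in>S. x - y \<in> S)"

lemma asubI: "0 \<in> S \<Longrightarrow> (\<And>x y. x \<in> S \<Longrightarrow> y \<in> S \<Longrightarrow> x - y \<in> S) \<Longrightarrow> asub S"
  by (simp add: asub_def)

lemma asub_0: "asub S \<Longrightarrow> 0 \<in> S"
  by (simp add: asub_def)

lemma asub_diff: "asub S \<Longrightarrow> x \<in> S \<Longrightarrow> y \<in> S \<Longrightarrow> x - y \<in> S"
  by (simp add: asub_def)

lemma asub_uminus: "asub S \<Longrightarrow> x \<in> S \<Longrightarrow> - x \<in> S"
  using asub_diff[of S 0 x] by (simp add: asub_0)

lemma asub_add: "asub S \<Longrightarrow> x \<in> S \<Longrightarrow> y \<in> S \<Longrightarrow> x + y \<in> S"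
  using asub_diff[of S x "- y"] by (simp add: asub_uminus)

lemma asub_diff_commute: "asub S \<Longrightarrow> x - y \<in> S \<Longrightarrow> y - x \<in> S"
  using asub_uminus[of S "x - y"] by simp

lemma asub_diff_trans: "asub S \<Longrightarrow> x - y \<in> S \<Longrightarrow> y - z \<in> S \<Longrightarrow> x - z \<in> S"
  using asub_add[of S "x - y" "y - z"] by simp

lemma asub_diff_mem: "asub S \<Longrightarrow> x - y \<in> S \<Longrightarrow> x \<in> S \<longleftrightarrow> y \<in> S"
  using asub_add[of S "x - y" y] asub_diff[of S x "x - y"] by auto

lemma asub_sum: "asub S \<Longrightarrow> (\<And>i. i \<in> F \<Longrightarrow> f i \<in> S) \<Longrightarrow> sum f F \<in> S"
  by (induction F rule: infinite_finite_induct) (auto simp: asub_0 asub_add)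

lemma asub_Int: "asub S \<Longrightarrow> asub T \<Longrightarrow> asub (S \<inter> T)"
  by (simp add: asub_def)

lemma asub_Inter: "(\<And>S. S \<in> C \<Longrightarrow> asub S) \<Longrightarrow> asub (\<Inter>C)"
  by (simp add: asub_def)

lemma asub_UNIV: "asub UNIV"
  by (simp add: asub_def)

lemma asub_plus:
  assumes "asub S" "asub T"
  shows "asub {s + t | s t. s \<in> S \<and> t \<in> T}"
proof (rule asubI)
  show "0 \<in> {s + t | s t. s \<in> S \<and> t \<in> T}"
    using assms[THEN asub_0] by force
  fix x y assume "x \<in> {s + t | s t. s \<in> S \<and> t \<in> T}" "y \<in> {s + t | s t. s \<in> S \<and> t \<in> T}"
  then obtain s t s' t' where "x = s + t" "y = s' + t'" "s \<in> S" "t \<in> T" "s' \<in> S" "t' \<in> T"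
    by auto
  then have "x - y = (s - s') + (t - t')" "s - s' \<in> S" "t - t' \<in> T"
    using assms by (auto simp: asub_diff)
  then show "x - y \<in> {s + t | s t. s \<in> S \<and> t \<in> T}" by blast
qed

section \<open>Cosets and subgroups of finite index\<close>

definition coset :: "'a::ab_group_add set \<Rightarrow> 'a \<Rightarrow> 'a set" where
  "coset K x = {y. y - x \<in> K}"

lemma coset_self: "asub K \<Longrightarrow> x \<in> coset K x"
  by (simp add: coset_def asub_0)

lemma coset_eq:
  assumes "asub K"
  shows "coset K x = coset K y \<longleftrightarrow> x - y \<in> K"
proof
  assume "coset K x = coset K y"
  then show "x - y \<in> K" using coset_self[OF assms, of x] by (simp add: coset_def)
next
  assume xy: "x - y \<in> K"
  have "z - x \<in> K \<longleftrightarrow> z - y \<in> K" for z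
    using asub_diff_trans[OF assms] asub_diff_commute[OF assms] xy by blast
  then show "coset K x = coset K y" by (simp add: coset_def)
qed

lemma coset_subset: "asub S \<Longrightarrow> K \<subseteq> S \<Longrightarrow> x \<in> S \<Longrightarrow> coset K x \<subseteq> S"
  unfolding coset_def using asub_add[of S] by fastforce

lemma coset_image_iff: "asub S \<Longrightarrow> asub K \<Longrightarrow> K \<subseteq> S \<Longrightarrow> coset K x \<in> coset K ` S \<longleftrightarrow> x \<in> S"
  using coset_subset[of S K] coset_self[of K x] by blast

text \<open>\<open>S\<close> may be any set: later this also counts the residues of a set of roots.
  An infinite set of cosets would give 0, hence the finiteness conditions.\<close>

abbreviation idx :: "'a::ab_group_add set \<Rightarrow> 'a set \<Rightarrow> nat" where
  "idx K S \<equiv> card (coset K ` S)"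

definition fin_ix :: "'a::ab_group_add set \<Rightarrow> bool" where
  "fin_ix K \<longleftrightarrow> finite (range (coset K))"

lemma fin_ix_UNIV: "fin_ix UNIV"
  by (simp add: fin_ix_def coset_def)

lemma fin_ix_image: "fin_ix K \<Longrightarrow> finite (coset K ` S)"
  unfolding fin_ix_def by (meson finite_subset image_mono subset_UNIV)

lemma fin_ix_vimage:
  assumes "fin_ix K" "\<And>x y. f (x - y) = f x - f y"
  shows "fin_ix (f -` K)"
proof -
  have "coset (f -` K) x = f -` coset K (f x)" for x
    using assms(2) by (auto simp: coset_def)
  then have "range (coset (f -` K)) \<subseteq> (vimage f) ` range (coset K)" by auto
  then show ?thesis using assms(1) unfolding fin_ix_def by (meson finite_imageI finite_subset)
qed

lemma fin_ix_Int:
  assumes "fin_ix K" "fin_ix L"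
  shows "fin_ix (K \<inter> L)"
proof -
  have "coset (K \<inter> L) x = coset K x \<inter> coset L x" for x
    by (auto simp: coset_def)
  then have "range (coset (K \<inter> L)) \<subseteq> (\<lambda>(A, B). A \<inter> B) ` (range (coset K) \<times> range (coset L))"
    by force
  then show ?thesis using assms unfolding fin_ix_def
    by (meson finite_SigmaI finite_imageI finite_subset)
qed

lemma fin_ix_INT: "finite F \<Longrightarrow> (\<And>i. i \<in> F \<Longrightarrow> fin_ix (f i)) \<Longrightarrow> fin_ix (\<Inter>i\<in>F. f i)"
  by (induction F rule: finite_induct) (auto simp: fin_ix_UNIV intro: fin_ix_Int)

lemma fin_ix_mono:
  assumes "fin_ix K" "asub K" "asub L" "K \<subseteq> L"
  shows "fin_ix L"
proof -
  have "coset L x = (\<Union>y\<in>coset K x. coset L y)" for x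
  proof -
    have c: "y \<in> coset K x \<Longrightarrow> coset L y = coset L x" for y
      using assms(4) by (subst coset_eq[OF assms(3)]) (auto simp: coset_def)
    have "coset K x \<noteq> {}" using coset_self[OF assms(2)] by blast
    then show ?thesis using SUP_eq_const[of "coset K x" "coset L" "coset L x"] c by simp
  qed
  then have "range (coset L) \<subseteq> (\<lambda>B. \<Union>y\<in>B. coset L y) ` range (coset K)" by blast
  then show ?thesis using assms(1) unfolding fin_ix_def by (meson finite_imageI finite_subset)
qed

lemma fin_ix_reps:
  assumes "fin_ix K" "asub K"
  obtains F where "finite F" "\<And>x. \<exists>r\<in>F. x - r \<in> K"
proof
  let ?g = "\<lambda>B. SOME r. coset K r = B"
  show "finite (?g ` range (coset K))" using assms(1) by (simp add: fin_ix_def)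
  fix x
  have "coset K (?g (coset K x)) = coset K x" by (rule someI) simp
  then have "x - ?g (coset K x) \<in> K" using assms(2) coset_eq by metis
  then show "\<exists>r\<in>?g ` range (coset K). x - r \<in> K" by blast
qed

text \<open>Pigeonhole on cosets. It is applied to the multiples of an element, for torsion, and to
  its powers, for idempotents and nilpotency.\<close>

lemma fin_ix_recurrent:
  fixes f :: "nat \<Rightarrow> 'a::ab_group_add"
  assumes "fin_ix K" "asub K"
  obtains m d where "0 < d" "f (m + d) - f m \<in> K"
proof -
  have "\<not> inj (\<lambda>n. coset K (f n))"
  proof
    assume "inj (\<lambda>n. coset K (f n))"
    then have "infinite (range (\<lambda>n. coset K (f n)))" by (simp add: finite_image_iff)
    moreover have "range (\<lambda>n. coset K (f n)) \<subseteq> range (coset K)" by blast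
    ultimately show False using assms(1) finite_subset unfolding fin_ix_def by blast
  qed
  then obtain a b where "a \<noteq> b" "coset K (f a) = coset K (f b)" by (auto simp: inj_def)
  then have "\<exists>m d. 0 < d \<and> coset K (f (m + d)) = coset K (f m)"
    by (metis less_imp_add_positive linorder_neqE_nat)
  then show ?thesis using that by (auto simp: coset_eq[OF assms(2)])
qed

text \<open>Such a subgroup is a union of the finitely many cosets of \<open>K\<close>. This
  replaces Zorn's lemma wherever a maximal or minimal subring or ideal is chosen.\<close>

lemma finite_supergroups:
  assumes "fin_ix K" "asub K"
  shows "finite {S. asub S \<and> K \<subseteq> S}"
proof -
  have "S = \<Union>(coset K ` S)" if "asub S" "K \<subseteq> S" for S
    using coset_subset[OF that] coset_self[OF assms(2)] by blast
  then have "{S. asub S \<and> K \<subseteq> S} \<subseteq> Union ` Pow (range (coset K))" by blast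
  then show ?thesis using assms(1) by (meson finite_Pow_iff finite_imageI finite_subset fin_ix_def)
qed

text \<open>Neumann's lemma: a subgroup of infinite index has a coset missing from the family; that coset is covered by
  the cosets of the other subgroups, hence so are all its translates, and the subgroup can be discarded.\<close>

lemma coset_cover_fin_ix:
  assumes "finite H" "\<And>S. S \<in> H \<Longrightarrow> asub S" "finite F" "\<And>g S. (g, S) \<in> F \<Longrightarrow> S \<in> H"
    "\<And>x. \<exists>(g, S)\<in>F. x \<in> coset S g"
  shows "\<exists>S\<in>H. fin_ix S"
  using assms
proof (induction H arbitrary: F rule: finite_induct)
  case empty
  then show ?case by fast
next
  case (insert T H)
  show ?case
  proof (cases "fin_ix T")
    case False
    have "finite ((\<lambda>(g, S). coset T g) ` F)" using insert.prems by simp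
    then obtain x where x: "coset T x \<notin> (\<lambda>(g, S). coset T g) ` F"
      using False unfolding fin_ix_def by (metis finite_subset image_subsetI)
    have asT: "asub T" using insert.prems by simp
    define F1 where "F1 = {p \<in> F. snd p \<in> H}"
    have fin1: "finite F1" using insert.prems by (simp add: F1_def)
    have tr: "\<exists>(g, S)\<in>F1. y \<in> coset S g" if "y \<in> coset T x" for y
    proof -
      obtain g S where gS: "(g, S) \<in> F" "y \<in> coset S g" using insert.prems(4) by blast
      have "S \<noteq> T"
      proof
        assume "S = T"
        then have "coset T y = coset T g" "coset T y = coset T x"
          using gS that asT by (simp_all add: coset_eq) (simp_all add: coset_def)
        then show False using x gS by force
      qed
      then have "(g, S) \<in> F1" using gS insert.prems(3) by (auto simp: F1_def)
      then show ?thesis using gS by blast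
    qed
    define F' where "F' = F1 \<union> (\<lambda>((g, _), (g', S)). (g' + g - x, S)) ` (F \<times> F1)"
    have "\<exists>S\<in>H. fin_ix S"
    proof (rule insert.IH[of F'])
      show "finite F'" using fin1 insert.prems by (simp add: F'_def)
      show "\<And>S. S \<in> H \<Longrightarrow> asub S" using insert.prems by simp
      show "\<And>g S. (g, S) \<in> F' \<Longrightarrow> S \<in> H" by (auto simp: F'_def F1_def)
      fix y
      obtain g S where gS: "(g, S) \<in> F" "y \<in> coset S g" using insert.prems(4) by blast
      show "\<exists>(g, S)\<in>F'. y \<in> coset S g"
      proof (cases "S = T")
        case True
        then have "y - g + x \<in> coset T x" using gS by (simp add: coset_def)
        then obtain g' S' where g': "(g', S') \<in> F1" "y - g + x \<in> coset S' g'" using tr by blast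
        then have "(g' + g - x, S') \<in> F'" using gS unfolding F'_def by force
        moreover have "y \<in> coset S' (g' + g - x)" using g' by (simp add: coset_def algebra_simps)
        ultimately show ?thesis by blast
      next
        case False
        then have "(g, S) \<in> F'" using gS insert.prems(3) by (auto simp: F'_def F1_def)
        then show ?thesis using gS by blast
      qed
    qed
    then show ?thesis by blast
  qed simp
qed

text \<open>If the members of finite index missed \<open>g\<close>, they would miss
  \<open>g + D\<close>, where \<open>D\<close> is their intersection, so the other members would
  cover \<open>g + D\<close>. Finitely many translates of \<open>g + D\<close> fill the ring,
  against Neumann's lemma.\<close>

lemma cover_fin_ix:
  assumes "finite C" "\<And>M. M \<in> C \<Longrightarrow> asub M" "\<Union>C = UNIV"
  shows "\<Union>{M \<in> C. fin_ix M} = UNIV"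
proof (rule ccontr)
  assume "\<Union>{M \<in> C. fin_ix M} \<noteq> UNIV"
  then obtain g where g: "\<And>M. M \<in> C \<Longrightarrow> fin_ix M \<Longrightarrow> g \<notin> M" by blast
  define D where "D = (\<Inter>M\<in>{M \<in> C. fin_ix M}. M)"
  have D: "asub D" "fin_ix D"
    unfolding D_def using assms(1,2) by (auto intro!: asub_Inter fin_ix_INT[of _ "\<lambda>M. M", simplified])
  obtain F where F: "finite F" "\<And>x. \<exists>r\<in>F. x - r \<in> D" using fin_ix_reps[OF D(2,1)] by blast
  let ?H = "{M \<in> C. \<not> fin_ix M}"
  have "\<exists>S\<in>?H. fin_ix S"
  proof (rule coset_cover_fin_ix[of _ "(\<lambda>(r, M). (r - g, M)) ` (F \<times> ?H)"])
    fix z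
    obtain r where r: "r \<in> F" "z - r \<in> D" using F by blast
    obtain M where M: "M \<in> C" "z - r + g \<in> M" using assms(3) by blast
    have "\<not> fin_ix M"
    proof
      assume "fin_ix M"
      then have "z - r \<in> M" using r M by (auto simp: D_def)
      then show False using g[OF M(1) \<open>fin_ix M\<close>] M(2) asub_diff[OF assms(2)[OF M(1)], of "z - r + g" "z - r"]
        by simp
    qed
    then show "\<exists>(g', S)\<in>(\<lambda>(r, M). (r - g, M)) ` (F \<times> ?H). z \<in> coset S g'"
      using M r by (force simp: coset_def algebra_simps)
  qed (use assms F in auto)
  then show False by blast
qed

section \<open>Subrings, ideals and covers relative to an ideal\<close>

definition srng :: "'a::ring_1 set \<Rightarrow> bool" where
  "srng S \<longleftrightarrow> asub S \<and> (\<forall>x\<in>S. \<forall>y\<in>S. x * y \<in> S)"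

definition idl :: "'a::ring_1 set \<Rightarrow> bool" where
  "idl I \<longleftrightarrow> asub I \<and> (\<forall>x\<in>I. \<forall>r. r * x \<in> I \<and> x * r \<in> I)"

lemma srngI: "asub S \<Longrightarrow> (\<And>x y. x \<in> S \<Longrightarrow> y \<in> S \<Longrightarrow> x * y \<in> S) \<Longrightarrow> srng S"
  by (simp add: srng_def)

lemma idlI: "asub S \<Longrightarrow> (\<And>x r. x \<in> S \<Longrightarrow> r * x \<in> S) \<Longrightarrow> (\<And>x r. x \<in> S \<Longrightarrow> x * r \<in> S) \<Longrightarrow> idl S"
  by (simp add: idl_def)

lemma srng_asub: "srng S \<Longrightarrow> asub S"
  by (simp add: srng_def)

lemma srng_mult: "srng S \<Longrightarrow> x \<in> S \<Longrightarrow> y \<in> S \<Longrightarrow> x * y \<in> S"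
  by (simp add: srng_def)

lemma idl_asub: "idl S \<Longrightarrow> asub S"
  by (simp add: idl_def)

lemma idl_left: "idl S \<Longrightarrow> x \<in> S \<Longrightarrow> r * x \<in> S"
  by (simp add: idl_def)

lemma idl_right: "idl S \<Longrightarrow> x \<in> S \<Longrightarrow> x * r \<in> S"
  by (simp add: idl_def)

lemma idl_srng: "idl S \<Longrightarrow> srng S"
  by (simp add: idl_def srng_def)

lemma idl_UNIV: "idl UNIV"
  by (simp add: idl_def asub_UNIV)

lemma asub_of_int_mult:
  fixes x :: "'a::ring_1"
  assumes "asub S" "x \<in> S"
  shows "of_int c * x \<in> S"
proof -
  have n: "of_nat n * x \<in> S" for n
    by (induction n) (use assms in \<open>auto simp: asub_0 algebra_simps asub_add\<close>)
  show ?thesis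
    by (cases c rule: int_cases2) (use n assms in \<open>simp_all add: asub_uminus\<close>)
qed

lemma idl_eq_UNIV: "idl I \<Longrightarrow> 1 \<in> I \<Longrightarrow> I = UNIV"
  by (metis idl_left mult.right_neutral UNIV_eq_I)

lemma idl_Int: "idl S \<Longrightarrow> idl T \<Longrightarrow> idl (S \<inter> T)"
  by (simp add: idl_def asub_Int)

lemma srng_Int: "srng S \<Longrightarrow> srng T \<Longrightarrow> srng (S \<inter> T)"
  by (simp add: srng_def asub_Int)

lemma idl_Inter: "(\<And>S. S \<in> C \<Longrightarrow> idl S) \<Longrightarrow> idl (\<Inter>C)"
  by (simp add: idl_def asub_Inter)

lemma srng_pow: "srng S \<Longrightarrow> x \<in> S \<Longrightarrow> 0 < n \<Longrightarrow> x ^ n \<in> S"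
proof (induction n)
  case (Suc n)
  then show ?case by (cases n) (auto simp: srng_mult)
qed simp

lemma idl_diff_mult:
  assumes "idl K" "a - b \<in> K" "c - d \<in> K"
  shows "a * c - b * d \<in> K"
proof -
  have "a * c - b * d = a * (c - d) + (a - b) * d" by (simp add: algebra_simps)
  then show ?thesis using assms by (metis asub_add idl_asub idl_left idl_right)
qed

lemma idl_diff_add:
  assumes "asub K" "a - b \<in> K" "c - d \<in> K"
  shows "(a + c) - (b + d) \<in> K"
  using asub_add[OF assms] by (simp add: algebra_simps)

lemma idl_diff_power:
  assumes "idl K" "a - b \<in> K"
  shows "a ^ n - b ^ n \<in> K"
  by (induction n) (use assms in \<open>auto simp: idl_diff_mult asub_0 idl_asub\<close>)

definition splus :: "'a::ring_1 set \<Rightarrow> 'a set \<Rightarrow> 'a set" where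
  "splus S T = {s + t | s t. s \<in> S \<and> t \<in> T}"

lemma splusI: "s \<in> S \<Longrightarrow> t \<in> T \<Longrightarrow> s + t \<in> splus S T"
  by (auto simp: splus_def)

lemma splusE:
  assumes "x \<in> splus S T"
  obtains s t where "x = s + t" "s \<in> S" "t \<in> T"
  using assms by (auto simp: splus_def)

lemma splus_asub: "asub S \<Longrightarrow> asub T \<Longrightarrow> asub (splus S T)"
  unfolding splus_def by (rule asub_plus)

lemma splus_upper1: "asub T \<Longrightarrow> S \<subseteq> splus S T"
  using splusI[of _ S 0 T] by (auto simp: asub_0)

lemma splus_upper2: "asub S \<Longrightarrow> T \<subseteq> splus S T"
  using splusI[of 0 S _ T] by (auto simp: asub_0)

lemma splus_least: "asub U \<Longrightarrow> S \<subseteq> U \<Longrightarrow> T \<subseteq> U \<Longrightarrow> splus S T \<subseteq> U"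
  by (auto simp: splus_def intro: asub_add)

lemma splus_srng:
  assumes "srng S" "idl T"
  shows "srng (splus S T)"
proof (rule srngI)
  show "asub (splus S T)" using assms by (simp add: splus_asub srng_asub idl_asub)
  fix x y assume "x \<in> splus S T" "y \<in> splus S T"
  then obtain s t s' t' where st: "x = s + t" "y = s' + t'" "s \<in> S" "t \<in> T" "s' \<in> S" "t' \<in> T"
    by (auto elim!: splusE)
  have "x * y = s * s' + (s * t' + t * y)" using st by (simp add: algebra_simps)
  moreover have "s * t' + t * y \<in> T" using st assms by (simp add: asub_add idl_asub idl_left idl_right)
  ultimately show "x * y \<in> splus S T" using st assms by (simp add: splusI srng_mult)
qed

lemma splus_idl:
  assumes "idl S" "idl T"
  shows "idl (splus S T)"
proof (rule idlI)
  show "asub (splus S T)" using assms by (simp add: splus_asub idl_asub)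
  fix x r assume "x \<in> splus S T"
  then obtain s t where st: "x = s + t" "s \<in> S" "t \<in> T" by (auto elim!: splusE)
  show "r * x \<in> splus S T" "x * r \<in> splus S T"
    using st assms by (simp_all add: algebra_simps splusI idl_left idl_right)
qed

text \<open>For a subgroup \<open>M\<close> this is the largest two-sided ideal contained in
  \<open>M\<close>.\<close>

definition core :: "'a::ring_1 set \<Rightarrow> 'a set" where
  "core M = {x. \<forall>r s. r * x * s \<in> M}"

lemma core_idl:
  assumes "asub M"
  shows "idl (core M)"
proof (rule idlI)
  show "asub (core M)"
    using assms unfolding core_def
    by (intro asubI) (auto simp: asub_0 asub_diff right_diff_distrib left_diff_distrib)
  fix x r assume x: "x \<in> core M"
  have "a * (r * x) * s = (a * r) * x * s" "a * (x * r) * s = a * x * (r * s)" for a s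
    by (simp_all add: mult.assoc)
  then show "r * x \<in> core M" "x * r \<in> core M" using x by (simp_all add: core_def)
qed

lemma core_subset: "core M \<subseteq> M"
proof
  fix x assume "x \<in> core M"
  then have "1 * x * 1 \<in> M" unfolding core_def by blast
  then show "x \<in> M" by simp
qed

lemma core_greatest: "idl K \<Longrightarrow> K \<subseteq> M \<Longrightarrow> K \<subseteq> core M"
  by (auto simp: core_def idl_left idl_right subsetD)

text \<open>Lewin's lemma. For \<open>x\<close> in \<open>M\<close>, whether \<open>x * r\<close>
  lies in \<open>M\<close> depends only on \<open>r\<close> modulo \<open>M\<close>, as
  \<open>M\<close> is closed under products; so right multiplications impose finitely many
  conditions of finite index. The same argument on the left is then applied to \<open>T\<close>,
  which absorbs multiplication from the right.\<close>

lemma core_fin_ix: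
  assumes "srng M" "fin_ix M"
  shows "fin_ix (core M)"
proof -
  have M: "asub M" using assms by (simp add: srng_asub)
  define T where "T = {x. \<forall>r. x * r \<in> M}"
  have TM: "x \<in> M" if "x \<in> T" for x
    using that unfolding T_def by (metis (mono_tags) mem_Collect_eq mult.right_neutral)
  have Tr: "x * s \<in> T" if "x \<in> T" for x s
    using that by (simp add: T_def mult.assoc)
  have T: "asub T" unfolding T_def
    by (rule asubI) (auto simp: M asub_0 asub_diff left_diff_distrib)
  obtain F where F: "finite F" "\<And>x. \<exists>r\<in>F. x - r \<in> M" using fin_ix_reps[OF assms(2) M] by blast
  have "T = M \<inter> (\<Inter>r\<in>F. (\<lambda>x. x * r) -` M)"
  proof (intro equalityI subsetI)
    fix x assume x: "x \<in> M \<inter> (\<Inter>r\<in>F. (\<lambda>x. x * r) -` M)"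
    have "x * r \<in> M" for r
    proof -
      obtain r' where r': "r' \<in> F" "r - r' \<in> M" using F by blast
      have "x * r = x * r' + x * (r - r')" by (simp add: algebra_simps)
      then show ?thesis using x r' M srng_mult[OF assms(1)] by (auto simp: asub_add)
    qed
    then show "x \<in> T" by (simp add: T_def)
  next
    fix x assume "x \<in> T"
    then show "x \<in> M \<inter> (\<Inter>r\<in>F. (\<lambda>x. x * r) -` M)" using TM unfolding T_def by blast
  qed
  then have fT: "fin_ix T"
    using F(1) assms(2) by (simp only:) (intro fin_ix_Int fin_ix_INT fin_ix_vimage, simp_all add: left_diff_distrib)
  obtain F' where F': "finite F'" "\<And>x. \<exists>r\<in>F'. x - r \<in> T" using fin_ix_reps[OF fT T] by blast
  have "core M = T \<inter> (\<Inter>r\<in>F'. (\<lambda>x. r * x) -` T)"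
  proof (intro equalityI subsetI)
    fix x assume x: "x \<in> T \<inter> (\<Inter>r\<in>F'. (\<lambda>x. r * x) -` T)"
    have "r * x \<in> T" for r
    proof -
      obtain r' where r': "r' \<in> F'" "r - r' \<in> T" using F' by blast
      have "r * x = r' * x + (r - r') * x" by (simp add: algebra_simps)
      then show ?thesis using x r' T Tr by (auto simp: asub_add)
    qed
    then show "x \<in> core M" by (auto simp: core_def T_def)
  next
    fix x assume "x \<in> core M"
    then show "x \<in> T \<inter> (\<Inter>r\<in>F'. (\<lambda>x. r * x) -` T)"
      by (auto simp: core_def T_def) (metis mult.left_neutral)
  qed
  then show ?thesis
    using F'(1) fT by (simp only:) (intro fin_ix_Int fin_ix_INT fin_ix_vimage, simp_all add: right_diff_distrib)
qed

text \<open>\<open>cov K n\<close> says that the quotient by the ideal \<open>K\<close> has a cover with at most \<open>n\<close> members.\<close>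

definition cov :: "'a::ring_1 set \<Rightarrow> nat \<Rightarrow> bool" where
  "cov K n \<longleftrightarrow> (\<exists>C. finite C \<and> card C \<le> n \<and> (\<forall>M\<in>C. srng M \<and> M \<noteq> UNIV \<and> K \<subseteq> M) \<and> \<Union>C = UNIV)"

lemma cov_antimono: "cov L n \<Longrightarrow> K \<subseteq> L \<Longrightarrow> cov K n"
  unfolding cov_def by (meson subset_trans)

lemma cov_mono: "cov K m \<Longrightarrow> m \<le> n \<Longrightarrow> cov K n"
  unfolding cov_def by (meson le_trans)

text \<open>Neumann's lemma discards the members of infinite index; by Lewin's lemma the
  intersection of the cores of the others has finite index.\<close>

lemma cov_fin_ix:
  assumes "cov K0 n" "idl K0"
  obtains K where "idl K" "K0 \<subseteq> K" "fin_ix K" "cov K n"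
proof -
  obtain C where C: "finite C" "card C \<le> n" "\<And>M. M \<in> C \<Longrightarrow> srng M \<and> M \<noteq> UNIV \<and> K0 \<subseteq> M" "\<Union>C = UNIV"
    using assms(1) by (auto simp: cov_def)
  define C' where "C' = {M \<in> C. fin_ix M}"
  have C': "finite C'" "card C' \<le> n" "\<Union>C' = UNIV"
    using C cover_fin_ix[of C] by (auto simp: C'_def srng_asub intro: le_trans[OF card_mono])
  define K where "K = (\<Inter>M\<in>C'. core M)"
  have "idl K" "fin_ix K"
    unfolding K_def using C'(1) C(3)
    by (auto simp: C'_def intro!: idl_Inter fin_ix_INT core_fin_ix core_idl srng_asub)
  moreover have "K0 \<subseteq> K"
    unfolding K_def using C(3) core_greatest[OF assms(2)] by (intro INT_greatest) (simp add: C'_def)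
  moreover have "K \<subseteq> M" if "M \<in> C'" for M using that core_subset by (auto simp: K_def)
  then have "cov K n" unfolding cov_def using C' C(3)
    by (intro exI[of _ C']) (auto simp: C'_def)
  ultimately show ?thesis using that by blast
qed

section \<open>Maximal subrings, minimal and maximal ideals above an ideal of finite index\<close>

lemma exists_maximal_srng:
  assumes "idl K" "fin_ix K" "srng S" "K \<subseteq> S" "S \<noteq> UNIV"
  obtains M where "srng M" "S \<subseteq> M" "M \<noteq> UNIV" "\<And>T. srng T \<Longrightarrow> M \<subseteq> T \<Longrightarrow> T = M \<or> T = UNIV"
proof -
  let ?X = "{T. srng T \<and> S \<subseteq> T \<and> T \<noteq> UNIV}"
  have "?X \<subseteq> {T. asub T \<and> K \<subseteq> T}" using assms by (auto simp: srng_asub)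
  then have "finite ?X" using finite_supergroups[OF assms(2) idl_asub[OF assms(1)]] finite_subset by blast
  then have "\<exists>M\<in>?X. S \<subseteq> M \<and> (\<forall>T\<in>?X. M \<subseteq> T \<longrightarrow> M = T)"
    by (rule finite_has_maximal2) (use assms in simp)
  then obtain M where M: "M \<in> ?X" "S \<subseteq> M" "\<forall>T\<in>?X. M \<subseteq> T \<longrightarrow> M = T"
    by (elim bexE conjE) (rule that)
  show ?thesis
  proof (rule that[of M])
    fix T assume T: "srng T" "M \<subseteq> T"
    then show "T = M \<or> T = UNIV" using M(3) M(1) by auto
  qed (use M(1) in auto)
qed

lemma exists_minimal_idl:
  assumes "idl K" "fin_ix K" "idl L" "K \<subset> L"
  obtains I where "idl I" "K \<subset> I" "I \<subseteq> L" "\<And>T. idl T \<Longrightarrow> K \<subseteq> T \<Longrightarrow> T \<subseteq> I \<Longrightarrow> T = K \<or> T = I"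
proof -
  let ?X = "{T. idl T \<and> K \<subset> T \<and> T \<subseteq> L}"
  have "?X \<subseteq> {T. asub T \<and> K \<subseteq> T}" by (auto simp: idl_asub)
  then have "finite ?X" using finite_supergroups[OF assms(2) idl_asub[OF assms(1)]] finite_subset by blast
  then have "\<exists>I\<in>?X. I \<subseteq> L \<and> (\<forall>T\<in>?X. T \<subseteq> I \<longrightarrow> I = T)"
    by (rule finite_has_minimal2) (use assms in simp)
  then obtain I where I: "I \<in> ?X" "\<forall>T\<in>?X. T \<subseteq> I \<longrightarrow> I = T" by (elim bexE conjE) (rule that)
  show ?thesis
  proof (rule that[of I])
    fix T assume T: "idl T" "K \<subseteq> T" "T \<subseteq> I"
    then have "K \<noteq> T \<Longrightarrow> T \<in> ?X" using I(1) by auto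
    then show "T = K \<or> T = I" using I(2) T(3) by auto
  qed (use I(1) in auto)
qed

lemma exists_maximal_idl:
  assumes "idl K" "fin_ix K" "idl L" "K \<subseteq> L" "P L"
  obtains I where "idl I" "L \<subseteq> I" "P I" "\<And>T. idl T \<Longrightarrow> P T \<Longrightarrow> I \<subseteq> T \<Longrightarrow> T = I"
proof -
  let ?X = "{T. idl T \<and> L \<subseteq> T \<and> P T}"
  have "?X \<subseteq> {T. asub T \<and> K \<subseteq> T}" using assms(4) by (auto simp: idl_asub)
  then have "finite ?X" using finite_supergroups[OF assms(2) idl_asub[OF assms(1)]] finite_subset by blast
  then have "\<exists>I\<in>?X. L \<subseteq> I \<and> (\<forall>T\<in>?X. I \<subseteq> T \<longrightarrow> I = T)"
    by (rule finite_has_maximal2) (use assms in simp)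
  then obtain I where I: "I \<in> ?X" "L \<subseteq> I" "\<forall>T\<in>?X. I \<subseteq> T \<longrightarrow> I = T"
    by (elim bexE conjE) (rule that)
  show ?thesis
  proof (rule that[of I])
    fix T assume T: "idl T" "P T" "I \<subseteq> T"
    then have "T \<in> ?X" using I(1) by auto
    then show "T = I" using I(3) T(3) by blast
  qed (use I(1) in auto)
qed

text \<open>Enlarging members to maximal subrings may merge some of them, so only an upper bound on
  the size survives.\<close>

lemma cov_maximal:
  assumes "cov K n" "idl K" "fin_ix K"
  obtains C where "finite C" "card C \<le> n" "\<Union>C = UNIV"
    "\<And>M. M \<in> C \<Longrightarrow> srng M \<and> M \<noteq> UNIV \<and> K \<subseteq> M \<and> (\<forall>T. srng T \<longrightarrow> M \<subseteq> T \<longrightarrow> T = M \<or> T = UNIV)"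
proof -
  obtain C where C: "finite C" "card C \<le> n" "\<And>M. M \<in> C \<Longrightarrow> srng M \<and> M \<noteq> UNIV \<and> K \<subseteq> M" "\<Union>C = UNIV"
    using assms(1) by (auto simp: cov_def)
  have "\<exists>M. srng M \<and> S \<subseteq> M \<and> M \<noteq> UNIV \<and> (\<forall>T. srng T \<longrightarrow> M \<subseteq> T \<longrightarrow> T = M \<or> T = UNIV)" if "S \<in> C" for S
    using exists_maximal_srng[OF assms(2,3), of S] C(3)[OF that] by metis
  then have "\<exists>f. \<forall>S\<in>C. srng (f S) \<and> S \<subseteq> f S \<and> f S \<noteq> UNIV \<and>
     (\<forall>T. srng T \<longrightarrow> f S \<subseteq> T \<longrightarrow> T = f S \<or> T = UNIV)"
    by (intro bchoice) simp
  then obtain f where f: "\<And>S. S \<in> C \<Longrightarrow> srng (f S) \<and> S \<subseteq> f S \<and> f S \<noteq> UNIV \<and>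
     (\<forall>T. srng T \<longrightarrow> f S \<subseteq> T \<longrightarrow> T = f S \<or> T = UNIV)"
    by blast
  show ?thesis
  proof (rule that[of "f ` C"])
    show "finite (f ` C)" using C(1) by simp
    show "card (f ` C) \<le> n" using card_image_le[OF C(1), of f] C(2) by linarith
    have "S \<subseteq> f S" if "S \<in> C" for S using f that by simp
    then show "\<Union>(f ` C) = UNIV" using C(4) by blast
    fix M assume "M \<in> f ` C"
    then obtain S where "S \<in> C" "M = f S" by blast
    then show "srng M \<and> M \<noteq> UNIV \<and> K \<subseteq> M \<and> (\<forall>T. srng T \<longrightarrow> M \<subseteq> T \<longrightarrow> T = M \<or> T = UNIV)"
      using f[of S] C(3)[of S] by auto
  qed
qed

section \<open>Minimal ideals\<close>

text \<open>The order of an elementary abelian \<open>p\<close>-group, found without a basis: a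
  largest intermediate group whose index over \<open>K\<close> is a power of \<open>p\<close> must
  be \<open>S\<close>, since adjoining the multiples of an outside element multiplies that index by
  \<open>p\<close>.\<close>

lemma idx_elementary:
  fixes K S :: "'a::ring_1 set"
  assumes "asub K" "asub S" "K \<subseteq> S" "finite (coset K ` S)" "prime p"
    and tor: "\<And>x. x \<in> S \<Longrightarrow> of_nat p * x \<in> K"
  shows "\<exists>m. idx K S = p ^ m"
proof -
  let ?P = "\<lambda>H. asub H \<and> K \<subseteq> H \<and> H \<subseteq> S \<and> (\<exists>m. idx K H = p ^ m)"
  have img: "coset K ` K = {K}"
    using assms(1) coset_eq[OF assms(1), of _ 0] by (auto simp: asub_0 coset_def image_iff intro!: bexI[of _ 0])
  have "?P K" using assms by (auto simp: img intro!: exI[of _ 0])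
  moreover have "\<forall>H. ?P H \<longrightarrow> idx K H < idx K S + 1"
    using assms(4) by (auto simp: less_Suc_eq_le intro!: card_mono)
  ultimately have "\<exists>H. ?P H \<and> (\<forall>H'. ?P H' \<longrightarrow> idx K H' \<le> idx K H)"
    by (rule ex_has_greatest_nat)
  then obtain H m where H: "asub H" "K \<subseteq> H" "H \<subseteq> S" "idx K H = p ^ m"
    and mx: "\<And>H'. ?P H' \<Longrightarrow> idx K H' \<le> idx K H"
    by (elim exE conjE) simp
  have "H = S"
  proof (rule ccontr)
    assume "H \<noteq> S"
    then obtain x where x: "x \<in> S" "x \<notin> H" using H by blast
    have px: "of_nat p * x \<in> H" using tor x H by blast
    note mem = asub_of_int_mult
    have dv: "int p dvd k" if "of_int k * x \<in> H" for k
    proof (rule ccontr)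
      assume "\<not> int p dvd k"
      then have "coprime (int p) k" using assms(5) by (simp add: prime_imp_coprime)
      then obtain u v where "u * int p + v * k = 1" using bezout_int[of "int p" k] by auto
      then have "x = of_int (u * int p + v * k) * x" by simp
      also have "\<dots> = of_int u * (of_nat p * x) + of_int v * (of_int k * x)"
        by (simp only: of_int_add of_int_mult of_int_of_nat_eq distrib_right mult.assoc)
      also have "\<dots> \<in> H" using mem[OF H(1)] px that H(1) by (simp add: asub_add)
      finally show False using x by simp
    qed
    define H' where "H' = {h + of_int k * x | h k. h \<in> H}"
    have "asub H'"
    proof (rule asubI)
      show "0 \<in> H'" unfolding H'_def using asub_0[OF H(1)] by (intro CollectI exI[of _ 0]) simp
      fix a b assume "a \<in> H'" "b \<in> H'"
      then obtain h k h' k' where "a = h + of_int k * x" "b = h' + of_int k' * x" "h \<in> H" "h' \<in> H"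
        unfolding H'_def by blast
      then have "a - b = (h - h') + of_int (k - k') * x" "h - h' \<in> H"
        using H(1) by (auto simp: algebra_simps asub_diff)
      then show "a - b \<in> H'" unfolding H'_def by blast
    qed
    moreover have "H \<subseteq> H'"
    proof
      fix h assume "h \<in> H"
      then show "h \<in> H'" unfolding H'_def by (intro CollectI exI[of _ h] exI[of _ 0]) simp
    qed
    moreover have "H' \<subseteq> S"
      unfolding H'_def using H(3) mem[OF assms(2) x(1)] by (auto intro!: asub_add[OF assms(2)])
    moreover
    \<comment> \<open>The cosets in \<open>H'\<close> are the translates of those in
      \<open>H\<close> by \<open>m * x\<close> with \<open>m < p\<close>, without
      repetition.\<close>
    define f where "f = (\<lambda>(m, B). (\<lambda>b. b + of_nat m * x) ` B)"
    have f: "f (m, coset K h) = coset K (h + of_nat m * x)" for m h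
    proof -
      have "y \<in> (\<lambda>b. b + of_nat m * x) ` coset K h \<longleftrightarrow> y \<in> coset K (h + of_nat m * x)" for y
        by (auto simp: image_iff coset_def algebra_simps intro!: exI[of _ "y - of_nat m * x"])
      then show ?thesis unfolding f_def by auto
    qed
    have "bij_betw f ({..<p} \<times> coset K ` H) (coset K ` H')"
    proof (rule bij_betw_imageI)
      show "inj_on f ({..<p} \<times> coset K ` H)"
      proof (rule inj_onI, clarsimp simp: f)
        fix m m' h h' assume a: "m < p" "m' < p" "h \<in> H" "h' \<in> H"
          "coset K (h + of_nat m * x) = coset K (h' + of_nat m' * x)"
        then have k: "(h + of_nat m * x) - (h' + of_nat m' * x) \<in> K" using assms(1) by (simp add: coset_eq)
        have "of_int (int m - int m') * x = ((h + of_nat m * x) - (h' + of_nat m' * x)) - (h - h')"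
          by (simp add: algebra_simps)
        also have "\<dots> \<in> H" 
          by (rule asub_diff[OF H(1) subsetD[OF H(2) k] asub_diff[OF H(1) a(3,4)]])
        finally have "int p dvd int m - int m'" by (rule dv)
        then have m: "m = m'" using a by (metis mod_eq_dvd_iff mod_less of_nat_eq_iff zmod_int)
        then show "m = m' \<and> coset K h = coset K h'" using k assms(1) by (simp add: coset_eq)
      qed
      show "f ` ({..<p} \<times> coset K ` H) = coset K ` H'"
      proof (intro equalityI subsetI)
        fix B assume "B \<in> f ` ({..<p} \<times> coset K ` H)"
        then obtain m h where "h \<in> H" "B = coset K (h + of_int (int m) * x)" by (auto simp: f)
        then show "B \<in> coset K ` H'" unfolding H'_def by blast
      next
        fix B assume "B \<in> coset K ` H'"
        then obtain h k where B: "B = coset K (h + of_int k * x)" "h \<in> H" unfolding H'_def by blast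
        let ?m = "nat (k mod int p)"
        have p0: "p > 0" using assms(5) prime_gt_0_nat by blast
        have "k = (k div int p) * int p + int ?m" using p0 by simp
        then have "of_int k * x = of_int ((k div int p) * int p + int ?m) * x"
          by (rule arg_cong[where f = "\<lambda>k. of_int k * x"])
        then have "of_int k * x = of_int (k div int p) * (of_nat p * x) + of_nat ?m * x"
          by (simp only: of_int_add of_int_mult of_int_of_nat_eq distrib_right mult.assoc)
        moreover have "h + of_int (k div int p) * (of_nat p * x) \<in> H"
          using B(2) mem[OF H(1) px] H(1) by (simp add: asub_add)
        ultimately have "B = f (?m, coset K (h + of_int (k div int p) * (of_nat p * x)))"
          using B(1) by (simp add: f add.assoc)
        moreover have "?m < p" using p0 by (simp add: nat_less_iff)
        ultimately show "B \<in> f ` ({..<p} \<times> coset K ` H)"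
          using \<open>h + of_int (k div int p) * (of_nat p * x) \<in> H\<close> by blast
      qed
    qed
    then have eq: "idx K H' = p * idx K H" by (metis bij_betw_same_card card_cartesian_product card_lessThan)
    then have "\<exists>m. idx K H' = p ^ m" using H(4) by (metis power_Suc)
    ultimately have "idx K H' \<le> idx K H" using mx H(2) by blast
    moreover have "idx K H > 0" using H(4) assms(5) prime_gt_0_nat by simp
    ultimately show False using eq prime_gt_1_nat[OF assms(5)] by simp
  qed
  then show ?thesis using H(4) by blast
qed

text \<open>Let \<open>n\<close> be the least positive integer with \<open>n * x\<close> in
  \<open>K\<close>, and \<open>n = p * k\<close> with \<open>p\<close> prime. Then
  \<open>k * x\<close> lies outside \<open>K\<close> and is killed by \<open>p\<close>. The elements
  of \<open>I\<close> killed by \<open>p\<close> modulo \<open>K\<close> form an ideal, which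
  minimality makes all of \<open>I\<close>.\<close>

lemma minimal_idl_torsion:
  fixes K I :: "'a::ring_1 set"
  assumes "idl K" "fin_ix K" "idl I" "K \<subset> I" "\<And>T. idl T \<Longrightarrow> K \<subseteq> T \<Longrightarrow> T \<subseteq> I \<Longrightarrow> T = K \<or> T = I"
  obtains p where "prime p" "\<And>x. x \<in> I \<Longrightarrow> of_nat p * x \<in> K"
proof -
  have K: "asub K" using assms by (simp add: idl_asub)
  obtain x where x: "x \<in> I" "x \<notin> K" using assms by blast
  obtain m d where d: "0 < d" "of_nat (m + d) * x - of_nat m * x \<in> K"
    using fin_ix_recurrent[OF assms(2) K, of "\<lambda>n. of_nat n * x"] by blast
  then have ex: "\<exists>n. 0 < n \<and> of_nat n * x \<in> K" by (intro exI[of _ d]) (simp add: algebra_simps)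
  define n where "n = (LEAST n. 0 < n \<and> of_nat n * x \<in> K)"
  have n: "0 < n" "of_nat n * x \<in> K" using LeastI_ex[OF ex] by (simp_all add: n_def)
  have least: "\<not> (0 < k \<and> of_nat k * x \<in> K)" if "k < n" for k
    using not_less_Least that unfolding n_def by blast
  have "n \<noteq> 1" using n x by auto
  then obtain p where p: "prime p" "p dvd n" using prime_factor_nat by blast
  then obtain k where k: "n = p * k" by blast
  then have "k < n" "0 < k" using n p prime_gt_1_nat by auto
  then have y: "of_nat k * x \<notin> K" using least by blast
  define T where "T = {z \<in> I. of_nat p * z \<in> K}"
  have com: "of_nat p * (r * z) = r * (of_nat p * z)" for r z :: 'a
    by (metis mult.assoc mult_of_nat_commute)
  have "idl T"
  proof (rule idlI)
    show "asub T" unfolding T_def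
      using assms K by (intro asubI) (auto simp: asub_0 asub_diff idl_asub right_diff_distrib)
  qed (use assms in \<open>auto simp: T_def idl_left idl_right com mult.assoc[symmetric]\<close>,
       metis com idl_left mult.assoc)
  moreover have "K \<subseteq> T" "T \<subseteq> I" using assms by (auto simp: T_def idl_left)
  moreover have "of_nat k * x \<in> T"
    using x n k assms by (auto simp: T_def idl_left mult.assoc)
  ultimately have "T = I" using assms(5) y by blast
  then show ?thesis using that[OF p(1)] by (auto simp: T_def)
qed

text \<open>Pick a point \<open>x\<close> of \<open>X\<close> that reaches the fewest cosets inside
  \<open>X\<close>. An image \<open>f x\<close> in \<open>X\<close> reaches the same ones, in
  particular its own, so it is a fixed point modulo \<open>K\<close> of some map in
  \<open>F\<close>.\<close>

lemma self_map_recurrent: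
  assumes "fin_ix K" "asub K" "x0 \<in> X"
    and comp: "\<And>f g. f \<in> F \<Longrightarrow> g \<in> F \<Longrightarrow> f \<circ> g \<in> F"
    and ex: "\<And>x. x \<in> X \<Longrightarrow> \<exists>f\<in>F. f x \<in> X"
  shows "\<exists>x\<in>X. \<exists>f\<in>F. x - f x \<in> K"
proof -
  define R where "R x = {coset K (f x) | f. f \<in> F \<and> f x \<in> X}" for x
  have fin: "finite (R x)" for x
    by (rule finite_subset[OF _ assms(1)[unfolded fin_ix_def]]) (auto simp: R_def)
  obtain x where x: "x \<in> X" "\<And>y. y \<in> X \<Longrightarrow> card (R x) \<le> card (R y)"
    using ex_has_least_nat[of "\<lambda>x. x \<in> X" x0 "\<lambda>x. card (R x)"] assms(3) by blast
  obtain f where f: "f \<in> F" "f x \<in> X" using ex x by blast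
  have "R (f x) \<subseteq> R x"
  proof
    fix B assume "B \<in> R (f x)"
    then obtain g where g: "g \<in> F" "B = coset K (g (f x))" "g (f x) \<in> X" unfolding R_def by blast
    then show "B \<in> R x" unfolding R_def using comp[OF g(1) f(1)] by (intro CollectI exI[of _ "g \<circ> f"]) simp
  qed
  then have "R (f x) = R x" using x(2)[OF f(2)] fin card_seteq by blast
  moreover have "coset K (f x) \<in> R x" unfolding R_def using f by blast
  ultimately have "coset K (f x) \<in> R (f x)" by simp
  then obtain g where g: "g \<in> F" "coset K (f x) = coset K (g (f x))"
    unfolding R_def mem_Collect_eq by (elim exE conjE) (rule that)
  then have "f x - g (f x) \<in> K" using assms(2) by (simp add: coset_eq)
  then show ?thesis using g f by blast
qed

text \<open>The elements of \<open>I\<close> that all of \<open>F\<close> sends into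
  \<open>K\<close> form an ideal. If it were \<open>K\<close>, every element of \<open>I - K\<close>
  could be moved within \<open>I - K\<close>, and recurrence would give a fixed point there, against
  \<open>fix_mem\<close>. An abstract \<open>F\<close> serves left and right multiplications
  alike.\<close>

lemma operators_annihilate:
  assumes K: "idl K" "fin_ix K"
    and I: "idl I" "K \<subset> I" "\<And>T. idl T \<Longrightarrow> K \<subseteq> T \<Longrightarrow> T \<subseteq> I \<Longrightarrow> T = K \<or> T = I"
    and comp: "\<And>f g. f \<in> F \<Longrightarrow> g \<in> F \<Longrightarrow> f \<circ> g \<in> F"
    and add: "\<And>f x y. f \<in> F \<Longrightarrow> f (x - y) = f x - f y"
    and mem: "\<And>f x. f \<in> F \<Longrightarrow> x \<in> I \<Longrightarrow> f x \<in> I" "\<And>f x. f \<in> F \<Longrightarrow> x \<in> K \<Longrightarrow> f x \<in> K"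
    and mult: "\<And>f x r. f \<in> F \<Longrightarrow> (\<And>g. g \<in> F \<Longrightarrow> g x \<in> K) \<Longrightarrow> f (r * x) \<in> K \<and> f (x * r) \<in> K"
    and fix_mem: "\<And>f x. f \<in> F \<Longrightarrow> x - f x \<in> K \<Longrightarrow> x \<in> K"
    and f: "f \<in> F" and x: "x \<in> I"
  shows "f x \<in> K"
proof -
  have aK: "asub K" and aI: "asub I" using K I by (simp_all add: idl_asub)
  define T where "T = {y \<in> I. \<forall>f\<in>F. f y \<in> K}"
  have "idl T"
  proof (rule idlI)
    show "asub T"
    proof (rule asubI)
      show "0 \<in> T" unfolding T_def using aI aK mem(2) by (simp add: asub_0)
      fix y z assume yz: "y \<in> T" "z \<in> T"
      have "f (y - z) \<in> K" if f: "f \<in> F" for f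
        unfolding add[OF f] using yz f by (intro asub_diff[OF aK]) (simp_all add: T_def)
      then show "y - z \<in> T" using yz aI by (simp add: T_def asub_diff)
    qed
    fix y r assume "y \<in> T"
    then show "r * y \<in> T" "y * r \<in> T" using mult I(1) by (auto simp: T_def idl_left idl_right)
  qed
  moreover have "K \<subseteq> T" "T \<subseteq> I" using I(2) mem(2) by (auto simp: T_def)
  moreover have "T \<noteq> K"
  proof
    assume TK: "T = K"
    obtain x0 where x0: "x0 \<in> I - K" using I(2) by blast
    have "\<exists>y\<in>I - K. \<exists>f\<in>F. y - f y \<in> K"
    proof (rule self_map_recurrent[OF K(2) aK x0 comp])
      fix y assume y: "y \<in> I - K"
      then have "y \<notin> T" using TK by simp
      then obtain f where "f \<in> F" "f y \<notin> K" using y unfolding T_def by blast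
      then show "\<exists>f\<in>F. f y \<in> I - K" using y mem(1) by blast
    qed
    then show False using fix_mem by blast
  qed
  ultimately have "T = I" using I(3) by blast
  then show ?thesis using x f by (auto simp: T_def)
qed

text \<open>If \<open>y\<close> and \<open>j * y\<close> agree modulo \<open>K\<close>, then so do
  \<open>y\<close> and \<open>j ^ n * y\<close> for all \<open>n\<close>, and nilpotency puts
  \<open>y\<close> into \<open>K\<close>: the multiplications by \<open>J\<close> have no fixed
  points outside \<open>K\<close>.\<close>

lemma nil_idl_annihilates:
  assumes K: "idl K" "fin_ix K" and J: "idl J" and nil: "\<And>j. j \<in> J \<Longrightarrow> \<exists>n. j ^ n \<in> K"
    and I: "idl I" "K \<subset> I" "\<And>T. idl T \<Longrightarrow> K \<subseteq> T \<Longrightarrow> T \<subseteq> I \<Longrightarrow> T = K \<or> T = I"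
    and x: "x \<in> I" and j: "j \<in> J"
  shows "j * x \<in> K" "x * j \<in> K"
proof -
  have aK: "asub K" using K by (simp add: idl_asub)
  show "j * x \<in> K"
  proof (rule operators_annihilate[OF K I, where F = "(\<lambda>j x. j * x) ` J" and f = "\<lambda>x. j * x"])
    fix f g assume "f \<in> (\<lambda>j x. j * x) ` J" "g \<in> (\<lambda>j x. j * x) ` J"
    then obtain a b where "f = (\<lambda>x. a * x)" "g = (\<lambda>x. b * x)" "a \<in> J" by blast
    then show "f \<circ> g \<in> (\<lambda>j x. j * x) ` J"
      using idl_right[OF J, of a b] by (intro image_eqI[of _ _ "a * b"]) (auto simp: mult.assoc)
  next
    fix f x r assume "f \<in> (\<lambda>j x. j * x) ` J" and g: "\<And>g. g \<in> (\<lambda>j x. j * x) ` J \<Longrightarrow> g x \<in> K"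
    then obtain j where f: "f = (\<lambda>x. j * x)" "j \<in> J" by blast
    show "f (r * x) \<in> K \<and> f (x * r) \<in> K"
      using g idl_right[OF J f(2), of r] idl_right[OF K(1), of "j * x" r] f
      by (auto simp: mult.assoc[symmetric])
  next
    fix f y assume "f \<in> (\<lambda>j x. j * x) ` J" and y: "y - f y \<in> K"
    then obtain j where f: "f = (\<lambda>x. j * x)" "j \<in> J" by blast
    obtain n where n: "j ^ n \<in> K" using nil f by blast
    have "y - j ^ m * y \<in> K" for m
    proof (induction m)
      case (Suc m)
      have "y - j ^ Suc m * y = (y - j * y) + j * (y - j ^ m * y)" by (simp add: algebra_simps)
      then show ?case using Suc y K(1) unfolding f(1) by (simp only: asub_add[OF aK] idl_left)
    qed (use aK in \<open>simp add: asub_0\<close>)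
    moreover have "j ^ n * y \<in> K" using n K by (simp add: idl_right)
    ultimately show "y \<in> K" using asub_diff_mem[OF aK] by blast
  qed (use I K j x in \<open>auto simp: idl_left right_diff_distrib\<close>)
  show "x * j \<in> K"
  proof (rule operators_annihilate[OF K I, where F = "(\<lambda>j x. x * j) ` J" and f = "\<lambda>x. x * j"])
    fix f g assume "f \<in> (\<lambda>j x. x * j) ` J" "g \<in> (\<lambda>j x. x * j) ` J"
    then obtain a b where "f = (\<lambda>x. x * a)" "g = (\<lambda>x. x * b)" "a \<in> J" by blast
    then show "f \<circ> g \<in> (\<lambda>j x. x * j) ` J"
      using idl_left[OF J, of a b] by (intro image_eqI[of _ _ "b * a"]) (auto simp: mult.assoc)
  next
    fix f x r assume "f \<in> (\<lambda>j x. x * j) ` J" and g: "\<And>g. g \<in> (\<lambda>j x. x * j) ` J \<Longrightarrow> g x \<in> K"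
    then obtain j where f: "f = (\<lambda>x. x * j)" "j \<in> J" by blast
    show "f (r * x) \<in> K \<and> f (x * r) \<in> K"
      using g idl_left[OF J f(2), of r] idl_left[OF K(1), of "x * j" r] f
      by (auto simp: mult.assoc)
  next
    fix f y assume "f \<in> (\<lambda>j x. x * j) ` J" and y: "y - f y \<in> K"
    then obtain j where f: "f = (\<lambda>x. x * j)" "j \<in> J" by blast
    obtain n where n: "j ^ n \<in> K" using nil f by blast
    have "y - y * j ^ m \<in> K" for m
    proof (induction m)
      case (Suc m)
      have "y - y * j ^ Suc m = (y - y * j) + (y - y * j ^ m) * j"
        by (simp add: algebra_simps power_commutes mult.assoc)
      then show ?case using Suc y K(1) unfolding f(1) by (simp only: asub_add[OF aK] idl_right)
    qed (use aK in \<open>simp add: asub_0\<close>)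
    moreover have "y * j ^ n \<in> K" using n K by (simp add: idl_left)
    ultimately show "y \<in> K" using asub_diff_mem[OF aK] by blast
  qed (use I K j x in \<open>auto simp: idl_right left_diff_distrib\<close>)
qed

section \<open>Minimal critical quotients with a square-zero minimal ideal\<close>

text \<open>The projection onto \<open>I\<close> along the subring \<open>M\<close>. It is
  determined only up to \<open>K\<close>, hence the congruences. As products of two elements of
  \<open>I\<close> vanish modulo \<open>K\<close>, closure of \<open>M\<close> under multiplication
  becomes the product rule.\<close>

lemma complement_projection:
  fixes K I M :: "'a::ring_1 set"
  assumes "idl I" "srng M" "K \<subseteq> I" "M \<inter> I = K" "splus M I = UNIV"
    and sq: "\<And>x y. x \<in> I \<Longrightarrow> y \<in> I \<Longrightarrow> x * y \<in> K"
  obtains p where "\<And>a. p a \<in> I" "\<And>a b. p (a - b) - (p a - p b) \<in> K"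
    "\<And>a b. p (a * b) - (a * p b + p a * b) \<in> K" "\<And>x. x \<in> I \<Longrightarrow> p x - x \<in> K"
    "\<And>a. a \<in> M \<longleftrightarrow> p a \<in> K"
proof -
  have aM: "asub M" and aI: "asub I" using assms by (simp_all add: srng_asub idl_asub)
  then have aK: "asub K" using assms(4) asub_Int by blast
  have "\<exists>i. i \<in> I \<and> a - i \<in> M" for a
  proof -
    have "a \<in> splus M I" using assms(5) by simp
    then obtain m i where "a = m + i" "m \<in> M" "i \<in> I" by (rule splusE)
    then show ?thesis by (intro exI[of _ i]) simp
  qed
  then obtain p where p: "\<And>a. p a \<in> I" "\<And>a. a - p a \<in> M" by metis
  have uniq: "p a - i \<in> K" if "i \<in> I" "a - i \<in> M" for a i
  proof -
    have "(a - i) - (a - p a) \<in> M" by (rule asub_diff[OF aM that(2) p(2)])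
    then have "p a - i \<in> M" by simp
    then show ?thesis using p that aI assms(4) asub_diff by blast
  qed
  show ?thesis
  proof (rule that[of p])
    fix a b
    have "a - b - (p a - p b) = (a - p a) - (b - p b)" by simp
    then show "p (a - b) - (p a - p b) \<in> K"
      using asub_diff[OF aM p(2) p(2)] p(1) aI by (intro uniq) (simp_all only: asub_diff)
    have "a * b - (a * p b + p a * b) = (a - p a) * (b - p b) - p a * p b"
      by (simp add: algebra_simps)
    moreover have "(a - p a) * (b - p b) \<in> M" "p a * p b \<in> M"
      using assms p sq by (auto intro: srng_mult)
    ultimately have "a * b - (a * p b + p a * b) \<in> M" using aM by (simp add: asub_diff)
    then show "p (a * b) - (a * p b + p a * b) \<in> K"
      using p(1) assms(1) aI by (intro uniq) (simp_all add: asub_add idl_left idl_right)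
    show "a \<in> M \<longleftrightarrow> p a \<in> K"
      using uniq[of 0 a] asub_diff_mem[OF aM p(2)[of a]] assms(4) asub_0[OF aI] by auto
  next
    fix x assume "x \<in> I"
    then show "p x - x \<in> K" using uniq asub_0[OF aM] by simp
  qed (rule p)
qed

text \<open>Two complements of a minimal ideal \<open>I\<close> differ by a derivation \<open>D\<close> with values in \<open>I/K\<close>. Every \<open>a\<close> lies in
  the kernel of \<open>D\<close> or in the complement obtained by adding to the first projection a multiple of \<open>D\<close>
  by an element of the field of bimodule endomorphisms of \<open>I/K\<close>, which has as many elements as \<open>I/K\<close>.\<close>

lemma two_complements_cov:
  fixes K I :: "'a::ring_1 set"
  assumes K: "idl K" "fin_ix K"
    and I: "idl I" "K \<subset> I" "\<And>T. idl T \<Longrightarrow> K \<subseteq> T \<Longrightarrow> T \<subseteq> I \<Longrightarrow> T = K \<or> T = I"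
    and sq: "\<And>x y. x \<in> I \<Longrightarrow> y \<in> I \<Longrightarrow> x * y \<in> K"
    and com: "\<And>a b x. x \<in> I \<Longrightarrow> (a * b - b * a) * x \<in> K" "\<And>a b x. x \<in> I \<Longrightarrow> x * (a * b - b * a) \<in> K"
    and M1: "srng M1" "M1 \<inter> I = K" "splus M1 I = UNIV"
    and M2: "srng M2" "M2 \<inter> I = K" "splus M2 I = UNIV"
    and ne: "M1 \<noteq> M2"
  shows "cov K (Suc (idx K I))"
proof -
  have aK: "asub K" and aI: "asub I" using K I by (simp_all add: idl_asub)
  have KI: "K \<subseteq> I" using I by blast
  obtain p where p: "\<And>a. p a \<in> I" "\<And>a b. p (a - b) - (p a - p b) \<in> K"
    "\<And>a b. p (a * b) - (a * p b + p a * b) \<in> K" "\<And>x. x \<in> I \<Longrightarrow> p x - x \<in> K"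
    "\<And>a. a \<in> M1 \<longleftrightarrow> p a \<in> K"
    using complement_projection[OF I(1) M1(1) KI M1(2,3) sq] by metis
  obtain p' where p': "\<And>a. p' a \<in> I" "\<And>a b. p' (a - b) - (p' a - p' b) \<in> K"
    "\<And>a b. p' (a * b) - (a * p' b + p' a * b) \<in> K" "\<And>x. x \<in> I \<Longrightarrow> p' x - x \<in> K"
    "\<And>a. a \<in> M2 \<longleftrightarrow> p' a \<in> K"
    using complement_projection[OF I(1) M2(1) KI M2(2,3) sq] by metis
  define D where "D a = p a - p' a" for a
  have D: "D a \<in> I" "D (a - b) - (D a - D b) \<in> K" "D (a * b) - (a * D b + D a * b) \<in> K" for a b
  proof -
    show "D a \<in> I" unfolding D_def using p p' aI by (intro asub_diff)
    have "D (a - b) - (D a - D b) = (p (a - b) - (p a - p b)) - (p' (a - b) - (p' a - p' b))"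
      by (simp add: D_def)
    then show "D (a - b) - (D a - D b) \<in> K" using asub_diff[OF aK p(2) p'(2)] by simp
    have "D (a * b) - (a * D b + D a * b)
      = (p (a * b) - (a * p b + p a * b)) - (p' (a * b) - (a * p' b + p' a * b))"
      by (simp add: D_def algebra_simps)
    then show "D (a * b) - (a * D b + D a * b) \<in> K" using asub_diff[OF aK p(3) p'(3)] by simp
  qed
  \<comment> \<open>Both projections are the identity on \<open>I\<close>. Since \<open>D\<close>
    vanishes there, adding an endomorphism applied to \<open>D\<close> to \<open>p\<close> gives a
    projection again.\<close>
  have DI: "D x \<in> K" if "x \<in> I" for x
    using asub_diff[OF aK p(4)[OF that] p'(4)[OF that]] by (simp add: D_def)
  have pK: "p x \<in> K" if "x \<in> K" for x using p(4)[of x] that KI asub_diff_mem[OF aK] by blast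
  have idD: "srng {a. D a \<in> K}"
  proof (intro srngI asubI)
    show "0 \<in> {a. D a \<in> K}" using DI asub_0[OF aI] by simp
    fix x y assume "x \<in> {a. D a \<in> K}" "y \<in> {a. D a \<in> K}"
    then have xy: "D x \<in> K" "D y \<in> K" by simp_all
    then have "D x - D y \<in> K" "x * D y + D x * y \<in> K" using K aK by (simp_all add: asub_diff asub_add idl_left idl_right)
    then show "x - y \<in> {a. D a \<in> K}" "x * y \<in> {a. D a \<in> K}"
      using asub_diff_mem[OF aK D(2)[of x y]] asub_diff_mem[OF aK D(3)[of x y]] by simp_all
  qed
  have neD: "{a. D a \<in> K} \<noteq> UNIV"
  proof
    assume "{a. D a \<in> K} = UNIV"
    then have "p a - p' a \<in> K" for a by (auto simp: D_def)
    then have "a \<in> M1 \<longleftrightarrow> a \<in> M2" for a using p(5) p'(5) asub_diff_mem[OF aK] by blast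
    then show False using ne by blast
  qed
  \<comment> \<open>Bimodule endomorphisms of \<open>I/K\<close> as functions on representatives.
    Only the values on \<open>I\<close> modulo \<open>K\<close> matter, so many functions stand for
    one endomorphism.\<close>
  define \<Phi> where "\<Phi> = {\<phi>. (\<forall>x\<in>I. \<phi> x \<in> I) \<and> (\<forall>x\<in>K. \<phi> x \<in> K)
    \<and> (\<forall>x\<in>I. \<forall>y\<in>I. \<phi> (x - y) - (\<phi> x - \<phi> y) \<in> K)
    \<and> (\<forall>x\<in>I. \<forall>a. \<phi> (a * x) - a * \<phi> x \<in> K \<and> \<phi> (x * a) - \<phi> x * a \<in> K)}"
  have \<Phi>: "\<phi> x \<in> I" "\<phi> (x - y) - (\<phi> x - \<phi> y) \<in> K" "\<phi> (a * x) - a * \<phi> x \<in> K" "\<phi> (x * a) - \<phi> x * a \<in> K"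
    if "\<phi> \<in> \<Phi>" "x \<in> I" "y \<in> I" for \<phi> x y a using that by (auto simp: \<Phi>_def)
  have \<Phi>K: "\<phi> x \<in> K" if "\<phi> \<in> \<Phi>" "x \<in> K" for \<phi> x using that by (auto simp: \<Phi>_def)
  have \<Phi>id: "(\<lambda>x. x) \<in> \<Phi>" using aK by (simp add: \<Phi>_def asub_0)
  have \<Phi>diff: "(\<lambda>x. \<phi> x - \<psi> x) \<in> \<Phi>" if f: "\<phi> \<in> \<Phi>" "\<psi> \<in> \<Phi>" for \<phi> \<psi>
  proof -
    have "\<phi> (x - y) - \<psi> (x - y) - (\<phi> x - \<psi> x - (\<phi> y - \<psi> y)) \<in> K" if "x \<in> I" "y \<in> I" for x y
      using asub_diff[OF aK \<Phi>(2)[OF f(1) that] \<Phi>(2)[OF f(2) that]] by (simp add: algebra_simps)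
    moreover have "\<phi> (a * x) - \<psi> (a * x) - a * (\<phi> x - \<psi> x) \<in> K" if "x \<in> I" for x a
      using asub_diff[OF aK \<Phi>(3)[OF f(1) that that, of a] \<Phi>(3)[OF f(2) that that, of a]] by (simp add: algebra_simps)
    moreover have "\<phi> (x * a) - \<psi> (x * a) - (\<phi> x - \<psi> x) * a \<in> K" if "x \<in> I" for x a
      using asub_diff[OF aK \<Phi>(4)[OF f(1) that that, of a] \<Phi>(4)[OF f(2) that that, of a]] by (simp add: algebra_simps)
    ultimately show ?thesis using f aI aK unfolding \<Phi>_def by (simp add: asub_diff)
  qed
  \<comment> \<open>Moving \<open>c\<close> past \<open>a\<close> costs a commutator, which
    annihilates \<open>I\<close> modulo \<open>K\<close>.\<close>
  have \<Phi>left: "(\<lambda>x. c * \<phi> x) \<in> \<Phi>" if f: "\<phi> \<in> \<Phi>" for \<phi> c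
  proof -
    have "c * \<phi> (x - y) - (c * \<phi> x - c * \<phi> y) \<in> K" if "x \<in> I" "y \<in> I" for x y
      using idl_left[OF K(1) \<Phi>(2)[OF f that], of c] by (simp add: algebra_simps)
    moreover have "c * \<phi> (a * x) - a * (c * \<phi> x) \<in> K" if "x \<in> I" for x a
    proof -
      have "c * \<phi> (a * x) - a * (c * \<phi> x) = c * (\<phi> (a * x) - a * \<phi> x) + (c * a - a * c) * \<phi> x"
        by (simp add: algebra_simps)
      then show ?thesis using \<Phi>[OF f that that] K com(1) aK by (simp add: asub_add idl_left)
    qed
    moreover have "c * \<phi> (x * a) - c * \<phi> x * a \<in> K" if "x \<in> I" for x a
      using idl_left[OF K(1) \<Phi>(4)[OF f that that, of a], of c] by (simp add: algebra_simps)
    ultimately show ?thesis using f I(1) K(1) unfolding \<Phi>_def by (simp add: idl_left)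
  qed
  have \<Phi>right: "(\<lambda>x. \<phi> x * c) \<in> \<Phi>" if f: "\<phi> \<in> \<Phi>" for \<phi> c
  proof -
    have "\<phi> (x - y) * c - (\<phi> x * c - \<phi> y * c) \<in> K" if "x \<in> I" "y \<in> I" for x y
      using idl_right[OF K(1) \<Phi>(2)[OF f that], of c] by (simp add: algebra_simps)
    moreover have "\<phi> (x * a) * c - \<phi> x * c * a \<in> K" if "x \<in> I" for x a
    proof -
      have "\<phi> (x * a) * c - \<phi> x * c * a = (\<phi> (x * a) - \<phi> x * a) * c + \<phi> x * (a * c - c * a)"
        by (simp add: algebra_simps)
      then show ?thesis using \<Phi>[OF f that that] K com(2) aK by (simp add: asub_add idl_right)
    qed
    moreover have "\<phi> (a * x) * c - a * (\<phi> x * c) \<in> K" if "x \<in> I" for x a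
      using idl_right[OF K(1) \<Phi>(3)[OF f that that, of a], of c] by (simp add: algebra_simps)
    ultimately show ?thesis using f I(1) K(1) unfolding \<Phi>_def by (simp add: idl_right)
  qed
  \<comment> \<open>The values at \<open>u\<close> form, together with \<open>K\<close>, an ideal
    that contains \<open>u\<close>, hence all of \<open>I\<close>.\<close>
  have trans: "\<exists>\<phi>\<in>\<Phi>. \<phi> u - w \<in> K" if u: "u \<in> I" "u \<notin> K" and w: "w \<in> I" for u w
  proof -
    define T where "T = {w \<in> I. \<exists>\<phi>\<in>\<Phi>. \<phi> u - w \<in> K}"
    have z: "\<exists>\<phi>\<in>\<Phi>. \<phi> u - w \<in> K" if "w \<in> K" for w
      using \<Phi>diff[OF \<Phi>id \<Phi>id] asub_uminus[OF aK that] by (intro bexI[of _ "\<lambda>x. x - x"]) simp_all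
    have "idl T"
    proof (intro idlI asubI)
      show "0 \<in> T" unfolding T_def using z[OF asub_0[OF aK]] asub_0[OF aI] by simp
      fix x y assume "x \<in> T" "y \<in> T"
      then obtain \<phi> \<psi> where f: "\<phi> \<in> \<Phi>" "\<psi> \<in> \<Phi>" "\<phi> u - x \<in> K" "\<psi> u - y \<in> K" "x \<in> I" "y \<in> I"
        unfolding T_def by blast
      have "\<phi> u - \<psi> u - (x - y) \<in> K" using asub_diff[OF aK f(3,4)] by (simp add: algebra_simps)
      then show "x - y \<in> T" unfolding T_def using f \<Phi>diff[OF f(1,2)] aI
        by (auto simp: asub_diff intro!: bexI[of _ "\<lambda>x. \<phi> x - \<psi> x"])
    next
      fix x r assume "x \<in> T"
      then obtain \<phi> where f: "\<phi> \<in> \<Phi>" "\<phi> u - x \<in> K" "x \<in> I" unfolding T_def by blast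
      have "r * \<phi> u - r * x \<in> K" "\<phi> u * r - x * r \<in> K"
        using idl_left[OF K(1) f(2), of r] idl_right[OF K(1) f(2), of r] by (simp_all add: algebra_simps)
      then show "r * x \<in> T" "x * r \<in> T" unfolding T_def
        using bexI[OF _ \<Phi>left[OF f(1), of r]] bexI[OF _ \<Phi>right[OF f(1), of r]] f(3) I(1)
        by (simp_all add: idl_left idl_right)
    qed
    moreover have "K \<subseteq> T" "T \<subseteq> I" unfolding T_def using z KI by blast+
    moreover have "u \<in> T" unfolding T_def using u \<Phi>id asub_0[OF aK] by (auto intro!: bexI[of _ "\<lambda>x. x"])
    ultimately have "T = I" using I(3) u by blast
    then show ?thesis using w unfolding T_def by blast
  qed
  obtain v where v: "v \<in> I" "v \<notin> K" using I by blast
  \<comment> \<open>The kernel of the difference is an ideal containing \<open>v\<close>, hence all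
    of \<open>I\<close>. So there are at most as many endomorphisms as classes of \<open>I\<close>
    modulo \<open>K\<close>.\<close>
  have determined: "\<phi> x - \<psi> x \<in> K" if f: "\<phi> \<in> \<Phi>" "\<psi> \<in> \<Phi>" "\<phi> v - \<psi> v \<in> K" and x: "x \<in> I" for \<phi> \<psi> x
  proof -
    define \<chi> where "\<chi> = (\<lambda>x. \<phi> x - \<psi> x)"
    have c: "\<chi> \<in> \<Phi>" unfolding \<chi>_def by (rule \<Phi>diff[OF f(1,2)])
    define T where "T = {x \<in> I. \<chi> x \<in> K}"
    have "idl T"
    proof (intro idlI asubI)
      show "0 \<in> T" unfolding T_def using \<Phi>K[OF c] asub_0[OF aK] asub_0[OF aI] by simp
      fix x y assume xy: "x \<in> T" "y \<in> T"
      then have "\<chi> x - \<chi> y \<in> K" "x \<in> I" "y \<in> I" unfolding T_def using aK by (simp_all add: asub_diff)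
      then show "x - y \<in> T" unfolding T_def using asub_diff_mem[OF aK \<Phi>(2)[OF c, of x y]] aI
        by (simp add: asub_diff)
    next
      fix x r assume x: "x \<in> T"
      then have "r * \<chi> x \<in> K" "\<chi> x * r \<in> K" "x \<in> I" unfolding T_def using K by (simp_all add: idl_left idl_right)
      then show "r * x \<in> T" "x * r \<in> T" unfolding T_def
        using asub_diff_mem[OF aK \<Phi>(3)[OF c, of x x r]] asub_diff_mem[OF aK \<Phi>(4)[OF c, of x x r]] I(1)
        by (simp_all add: idl_left idl_right)
    qed
    moreover have "K \<subseteq> T" "T \<subseteq> I" unfolding T_def using \<Phi>K[OF c] KI by blast+
    moreover have "v \<in> T" unfolding T_def using v f by (simp add: \<chi>_def)
    ultimately have "T = I" using I(3) v by blast
    then show ?thesis using x unfolding T_def \<chi>_def by blast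
  qed
  define S where "S \<phi> = {a. p a + \<phi> (D a) \<in> K}" for \<phi>
  have S: "srng (S \<phi>)" "S \<phi> \<noteq> UNIV" "K \<subseteq> S \<phi>" if f: "\<phi> \<in> \<Phi>" for \<phi>
  proof -
    have fD1: "p (a - b) + \<phi> (D (a - b)) - ((p a + \<phi> (D a)) - (p b + \<phi> (D b))) \<in> K" for a b
    proof -
      have "\<phi> (D (a - b) - (D a - D b)) - (\<phi> (D (a - b)) - \<phi> (D a - D b)) \<in> K"
        using \<Phi>(2)[OF f] D(1) aI asub_diff by blast
      then have "\<phi> (D (a - b)) - \<phi> (D a - D b) \<in> K"
        using \<Phi>K[OF f D(2)] asub_diff_mem[OF aK] by blast
      moreover have "\<phi> (D a - D b) - (\<phi> (D a) - \<phi> (D b)) \<in> K" using \<Phi>(2)[OF f] D(1) by blast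
      ultimately have "\<phi> (D (a - b)) - (\<phi> (D a) - \<phi> (D b)) \<in> K" by (rule asub_diff_trans[OF aK])
      from asub_add[OF aK p(2)[of a b] this] show ?thesis by (simp add: algebra_simps)
    qed
    have fD2: "p (a * b) + \<phi> (D (a * b)) - (a * (p b + \<phi> (D b)) + (p a + \<phi> (D a)) * b) \<in> K" for a b
    proof -
      let ?x = "a * D b" and ?y = "D a * b"
      have xy: "?x \<in> I" "?y \<in> I" "- ?y \<in> I" "?x + ?y \<in> I" using D(1) I(1) aI by (simp_all add: idl_left idl_right asub_uminus asub_add)
      have "\<phi> (D (a * b) - (?x + ?y)) - (\<phi> (D (a * b)) - \<phi> (?x + ?y)) \<in> K"
        using \<Phi>(2)[OF f D(1) xy(4)] by blast
      then have 1: "\<phi> (D (a * b)) - \<phi> (?x + ?y) \<in> K"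
        using \<Phi>K[OF f D(3)] asub_diff_mem[OF aK] by blast
      have "\<phi> ((?x + ?y) - ?y) - (\<phi> (?x + ?y) - \<phi> ?y) \<in> K" using \<Phi>(2)[OF f xy(4,2)] .
      then have 2: "\<phi> (?x + ?y) - (\<phi> ?x + \<phi> ?y) \<in> K"
        using asub_diff_commute[OF aK] by (simp add: algebra_simps)
      have 3: "(\<phi> ?x + \<phi> ?y) - (a * \<phi> (D b) + \<phi> (D a) * b) \<in> K"
        using asub_add[OF aK \<Phi>(3)[OF f D(1) D(1), of a b] \<Phi>(4)[OF f D(1) D(1), of a b]]
        by (simp add: algebra_simps)
      have "\<phi> (D (a * b)) - (a * \<phi> (D b) + \<phi> (D a) * b) \<in> K"
        by (rule asub_diff_trans[OF aK 1 asub_diff_trans[OF aK 2 3]])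
      from asub_add[OF aK p(3)[of a b] this] show ?thesis by (simp add: algebra_simps)
    qed
    show "K \<subseteq> S \<phi>" unfolding S_def using pK \<Phi>K[OF f] DI KI aK by (auto intro!: asub_add)
    show "srng (S \<phi>)"
    proof (intro srngI asubI)
      show "0 \<in> S \<phi>" using \<open>K \<subseteq> S \<phi>\<close> asub_0[OF aK] by blast
      fix x y assume "x \<in> S \<phi>" "y \<in> S \<phi>"
      then have "p x + \<phi> (D x) \<in> K" "p y + \<phi> (D y) \<in> K" by (simp_all add: S_def)
      then have "(p x + \<phi> (D x)) - (p y + \<phi> (D y)) \<in> K" "x * (p y + \<phi> (D y)) + (p x + \<phi> (D x)) * y \<in> K"
        using K(1) aK by (simp_all only: asub_diff asub_add idl_left idl_right)
      then show "x - y \<in> S \<phi>" "x * y \<in> S \<phi>"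
        using asub_diff_mem[OF aK fD1[of x y]] asub_diff_mem[OF aK fD2[of x y]] by (simp_all add: S_def)
    qed
    show "S \<phi> \<noteq> UNIV"
    proof
      assume "S \<phi> = UNIV"
      then have "p v + \<phi> (D v) \<in> K" by (auto simp: S_def)
      then have "p v \<in> K" using \<Phi>K[OF f DI[OF v(1)]] asub_diff[OF aK, of "p v + \<phi> (D v)" "\<phi> (D v)"] by simp
      then show False using p(4)[OF v(1)] v(2) asub_diff_mem[OF aK] by blast
    qed
  qed
  \<comment> \<open>\<open>h\<close> recovers a subring from the class of \<open>\<phi> v\<close>,
    which bounds the number of subrings by the index.\<close>
  define h where "h B = S (SOME \<phi>. \<phi> \<in> \<Phi> \<and> coset K (\<phi> v) = B)" for B
  have sub: "S ` \<Phi> \<subseteq> h ` coset K ` I"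
  proof (rule image_subsetI)
    fix \<phi> assume f: "\<phi> \<in> \<Phi>"
    define \<psi> where "\<psi> = (SOME \<psi>. \<psi> \<in> \<Phi> \<and> coset K (\<psi> v) = coset K (\<phi> v))"
    have g: "\<psi> \<in> \<Phi> \<and> coset K (\<psi> v) = coset K (\<phi> v)" unfolding \<psi>_def by (rule someI[of _ \<phi>]) (simp add: f)
    then have d: "\<psi> (D a) - \<phi> (D a) \<in> K" for a using determined f D(1) aK by (simp add: coset_eq)
    have "p a + \<psi> (D a) \<in> K \<longleftrightarrow> p a + \<phi> (D a) \<in> K" for a
      by (rule asub_diff_mem[OF aK]) (use d[of a] in simp)
    then have "S \<phi> = h (coset K (\<phi> v))" unfolding h_def \<psi>_def[symmetric] by (simp add: S_def)
    moreover have "\<phi> v \<in> I" using \<Phi>(1)[OF f v(1) v(1)] .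
    ultimately show "S \<phi> \<in> h ` coset K ` I" by blast
  qed
  have fin: "finite (coset K ` I)" using fin_ix_image[OF K(2)] .
  let ?C = "insert {a. D a \<in> K} (S ` \<Phi>)"
  have finS: "finite (S ` \<Phi>)" by (rule finite_subset[OF sub]) (simp add: fin)
  have "card (S ` \<Phi>) \<le> idx K I"
    using card_mono[OF _ sub] card_image_le[OF fin, of h] fin by (meson finite_imageI le_trans)
  then have "card ?C \<le> Suc (idx K I)" using card_insert_le_m1[of _ "S ` \<Phi>"] by (metis card_insert_if finS le_SucI not_less_eq_eq)
  moreover have "\<Union>?C = UNIV"
  proof (intro UNIV_eq_I[symmetric])
    fix a
    show "a \<in> \<Union>?C"
    proof (cases "D a \<in> K")
      case False
      \<comment> \<open>An endomorphism that sends \<open>D a\<close> to \<open>- p a\<close> puts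
        \<open>a\<close> into \<open>S \<phi>\<close>.\<close>
      obtain \<phi> where f: "\<phi> \<in> \<Phi>" "\<phi> (D a) - (- p a) \<in> K"
        using trans[OF D(1) False asub_uminus[OF aI p(1)]] by blast
      then have "a \<in> S \<phi>" by (simp add: S_def add.commute)
      then show ?thesis using f by blast
    qed simp
  qed
  moreover have "K \<subseteq> {a. D a \<in> K}" using DI KI by blast
  ultimately show ?thesis unfolding cov_def using finS S idD neD
    by (intro exI[of _ ?C]) (simp add: Ball_def image_iff, blast)
qed

text \<open>The quotient by \<open>K\<close> is a smallest quotient that has a 13-element cover. The ideal \<open>J\<close> plays the role
  of the preimage of the Jacobson radical.\<close>

locale critical =
  fixes K J :: "'a::ring_1 set"
  assumes K: "idl K" "fin_ix K"
    and J: "idl J" "\<And>a b. a * b - b * a \<in> J" "\<And>j. j \<in> J \<Longrightarrow> \<exists>n. j ^ n \<in> K"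
    and cov_13: "cov K 13" and not_cov_12: "\<not> cov K 12"
    and not_cov_larger: "\<And>I. idl I \<Longrightarrow> K \<subset> I \<Longrightarrow> \<not> cov I 13"
begin

lemma no_square_zero_minimal_idl:
  assumes I: "idl I" "K \<subset> I" "\<And>T. idl T \<Longrightarrow> K \<subseteq> T \<Longrightarrow> T \<subseteq> I \<Longrightarrow> T = K \<or> T = I"
    and sq: "\<And>x y. x \<in> I \<Longrightarrow> y \<in> I \<Longrightarrow> x * y \<in> K"
  shows False
proof -
  have aK: "asub K" and aI: "asub I" using K I by (simp_all add: idl_asub)
  obtain C where C: "finite C" "card C \<le> 13" "\<Union>C = UNIV"
    "\<And>M. M \<in> C \<Longrightarrow> srng M \<and> M \<noteq> UNIV \<and> K \<subseteq> M \<and> (\<forall>T. srng T \<longrightarrow> M \<subseteq> T \<longrightarrow> T = M \<or> T = UNIV)"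
    using cov_maximal[OF cov_13 K] by metis
  define C1 where "C1 = {M \<in> C. I \<subseteq> M}"
  define C2 where "C2 = {M \<in> C. \<not> I \<subseteq> M}"
  have cc: "finite C1" "finite C2" "card C1 + card C2 = card C" "C = C1 \<union> C2"
  proof -
    show un: "C = C1 \<union> C2" and fin: "finite C1" "finite C2" using C(1) by (auto simp: C1_def C2_def)
    have "C1 \<inter> C2 = {}" by (auto simp: C1_def C2_def)
    then show "card C1 + card C2 = card C" unfolding un using card_Un_disjoint[OF fin] by simp
  qed
  have C2: "srng M" "M \<inter> I = K" "splus M I = UNIV" if "M \<in> C2" for M
  proof -
    have M: "M \<in> C" "\<not> I \<subseteq> M" using that by (simp_all add: C2_def)
    show sM: "srng M" using C(4)[OF M(1)] by blast
    have "srng (splus M I)" "M \<subseteq> splus M I" "I \<subseteq> splus M I"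
      using sM I aI by (auto simp: splus_srng splus_upper1 splus_upper2 srng_asub)
    then show U: "splus M I = UNIV" using C(4)[OF M(1)] M(2) by blast
    have KM: "K \<subseteq> M" using C(4)[OF M(1)] by blast
    \<comment> \<open>\<open>M\<close> maps \<open>M \<inter> I\<close> into itself,
      \<open>I\<close> maps it into \<open>K\<close>, and the two together make up the ring.\<close>
    have "idl (M \<inter> I)"
    proof (rule idlI)
      show "asub (M \<inter> I)" using sM aI by (simp add: asub_Int srng_asub)
      fix x r assume x: "x \<in> M \<inter> I"
      have "r \<in> splus M I" using U by simp
      then obtain m i where r: "r = m + i" "m \<in> M" "i \<in> I" by (rule splusE)
      have "i * x \<in> M" "x * i \<in> M" using sq r x KM by auto
      then have "r * x \<in> M" "x * r \<in> M"
        using r x sM by (simp_all add: distrib_left distrib_right asub_add srng_asub srng_mult)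
      then show "r * x \<in> M \<inter> I" "x * r \<in> M \<inter> I" using x I(1) by (simp_all add: idl_left idl_right)
    qed
    then show "M \<inter> I = K" using I(2) I(3)[of "M \<inter> I"] KM M(2) by blast
  qed
  obtain i0 where i0: "i0 \<in> I" "i0 \<notin> K" using I by blast
  have "\<Union>C1 \<noteq> UNIV"
  proof
    assume "\<Union>C1 = UNIV"
    moreover have "card C1 \<le> 13" using cc C by linarith
    ultimately have "cov I 13" unfolding cov_def using cc(1) C(4)
      by (intro exI[of _ C1]) (auto simp: C1_def)
    then show False using not_cov_larger I by blast
  qed
  then obtain x where x: "\<And>M. M \<in> C1 \<Longrightarrow> x \<notin> M" by blast
  \<comment> \<open>A complement meets \<open>I\<close> only in \<open>K\<close>, so covering
    \<open>i0\<close> costs a member that contains \<open>I\<close>. This leaves at most 12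
    complements.\<close>
  have C1_ne: "C1 \<noteq> {}"
  proof
    assume "C1 = {}"
    obtain M where "M \<in> C" "i0 \<in> M" using C(3) by blast
    then have "M \<in> C2" using cc(4) \<open>C1 = {}\<close> by simp
    then show False using C2(2) i0 \<open>i0 \<in> M\<close> by blast
  qed
  let ?q = "idx K I"
  have q_le: "?q \<le> card C2"
  proof -
    \<comment> \<open>A complement meets the coset \<open>x + I\<close> in at most one class modulo
      \<open>K\<close>, since two of its elements there differ by an element of
      \<open>M \<inter> I = K\<close>.\<close>
    define g where "g M = coset K (SOME i. i \<in> I \<and> x + i \<in> M)" for M
    have "coset K ` I \<subseteq> g ` C2"
    proof (rule image_subsetI)
      fix i assume i: "i \<in> I"
      obtain M where M: "M \<in> C" "x + i \<in> M" using C(3) by blast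
      have "M \<notin> C1"
      proof
        assume "M \<in> C1"
        then have "i \<in> M" "asub M" using i C(4)[OF M(1)] by (auto simp: C1_def srng_asub)
        then have "x \<in> M" using asub_diff[of M "x + i" i] M(2) by simp
        then show False using x \<open>M \<in> C1\<close> by blast
      qed
      then have M2: "M \<in> C2" using M cc(4) by blast
      define i' where "i' = (SOME i. i \<in> I \<and> x + i \<in> M)"
      have i': "i' \<in> I \<and> x + i' \<in> M" unfolding i'_def by (rule someI[of _ i]) (simp add: i M)
      have "(x + i) - (x + i') \<in> M" using C2(1)[OF M2] M i' by (intro asub_diff srng_asub) simp_all
      then have "i - i' \<in> M \<inter> I" using i i' aI by (simp add: asub_diff)
      then have "coset K i = g M" unfolding g_def i'_def[symmetric] using C2(2)[OF M2] aK by (simp add: coset_eq)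
      then show "coset K i \<in> g ` C2" using M2 by blast
    qed
    then show ?thesis using surj_card_le[OF cc(2)] by blast
  qed
  have "card C2 \<le> 12" using C1_ne cc(1,3) C(2) card_gt_0_iff[of C1] by auto
  obtain p where p: "prime p" "\<And>x. x \<in> I \<Longrightarrow> of_nat p * x \<in> K"
    using minimal_idl_torsion[OF K I] by blast
  obtain m where m: "?q = p ^ m"
    using idx_elementary[OF aK aI _ fin_ix_image[OF K(2)] p] I(2) by blast
  have "?q \<noteq> 12"
  proof
    assume "?q = 12"
    then have "2 dvd p ^ m" "3 dvd p ^ m" using m by simp_all
    moreover have "prime (2::nat)" "prime (3::nat)" by simp_all
    ultimately have "2 dvd p" "3 dvd p" using prime_dvd_power by blast+
    then have "p = 2" "p = 3" using p(1) by (auto dest: primes_dvd_imp_eq[rotated 2])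
    then show False by simp
  qed
  then have "?q \<le> 11" using q_le \<open>card C2 \<le> 12\<close> by linarith
  have "2 \<le> ?q"
  proof -
    have "coset K 0 \<noteq> coset K i0" using i0 aK asub_diff_commute[of K 0 i0] by (auto simp: coset_eq)
    moreover have "{coset K 0, coset K i0} \<subseteq> coset K ` I" using i0 asub_0[OF aI] by blast
    ultimately show ?thesis using card_mono[OF fin_ix_image[OF K(2)], of "{coset K 0, coset K i0}" I] by simp
  qed
  then have "2 \<le> card C2" using q_le by linarith
  then have "\<not> card C2 \<le> Suc 0" by simp
  then have "\<exists>M1\<in>C2. \<exists>M2\<in>C2. M1 \<noteq> M2" unfolding card_le_Suc0_iff_eq[OF cc(2)] by simp
  then obtain M1 M2 where M12: "M1 \<in> C2" "M2 \<in> C2" "M1 \<noteq> M2" by blast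
  have "cov K (Suc ?q)"
  proof (rule two_complements_cov[OF K I sq])
    fix a b x assume "x \<in> I"
    then show "(a * b - b * a) * x \<in> K" "x * (a * b - b * a) \<in> K"
      using nil_idl_annihilates[OF K J(1,3) I] J(2) by blast+
  qed (use M12 C2[OF M12(1)] C2[OF M12(2)] in simp_all)
  then have "cov K 12" by (rule cov_mono) (use \<open>?q \<le> 11\<close> in simp)
  then show False using not_cov_12 by blast
qed

end

section \<open>Finite residue fields\<close>

locale residue_field =
  fixes P :: "'a::ring_1 set"
  assumes idl: "idl P" and fin: "fin_ix P" and one_notin: "1 \<notin> P"
    and comm: "\<And>a b. a * b - b * a \<in> P"
    and inv: "\<And>x. x \<notin> P \<Longrightarrow> \<exists>y. y * x - 1 \<in> P"
begin

lemma asub: "asub P"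
  using idl by (rule idl_asub)

lemma prime: "x * y \<in> P \<Longrightarrow> x \<in> P \<or> y \<in> P"
proof (rule ccontr)
  assume a: "x * y \<in> P" "\<not> (x \<in> P \<or> y \<in> P)"
  then obtain u where u: "u * x - 1 \<in> P" using inv by blast
  have "(u * x - 1) * y \<in> P" "u * (x * y) \<in> P" using idl_right[OF idl u] idl_left[OF idl a(1)] .
  then have "u * (x * y) - (u * x - 1) * y \<in> P" by (intro asub_diff asub)
  then show False using a by (simp add: algebra_simps)
qed

lemma power_mem: "x ^ n \<in> P \<Longrightarrow> x \<in> P"
  by (induction n) (use one_notin prime in auto)

lemma maximal: "idl T \<Longrightarrow> P \<subseteq> T \<Longrightarrow> T = P \<or> T = UNIV"
proof (rule disjCI)
  assume T: "idl T" "P \<subseteq> T" "T \<noteq> UNIV"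
  show "T = P"
  proof (rule ccontr)
    assume "T \<noteq> P"
    then obtain x where x: "x \<in> T" "x \<notin> P" using T by blast
    then obtain y where "y * x - 1 \<in> P" using inv by blast
    then have "y * x - 1 \<in> T" using T by blast
    moreover have "y * x \<in> T" using T x by (simp add: idl_left)
    ultimately have "y * x - (y * x - 1) \<in> T" using asub_diff[OF idl_asub[OF T(1)]] by blast
    then have "1 \<in> T" by (simp add: algebra_simps)
    then show False using T idl_eq_UNIV by blast
  qed
qed

lemma coset_eq_0: "coset P x = coset P 0 \<longleftrightarrow> x \<in> P"
  by (simp add: coset_eq[OF asub])

lemma image_minus: "coset P ` (S - P) = coset P ` S - {coset P 0}"
  using coset_eq_0 by blast

lemma fin_image: "finite (coset P ` S)"
  by (rule fin_ix_image[OF fin])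

lemma one_less_idx: "1 < idx P UNIV"
proof -
  have "coset P 0 \<noteq> coset P 1" using one_notin asub asub_uminus[of P "- 1"] by (auto simp: coset_eq)
  then have "card {coset P 0, coset P 1} = 2" by simp
  moreover have "card {coset P 0, coset P 1} \<le> idx P UNIV" by (intro card_mono fin_image) blast
  ultimately show ?thesis by simp
qed

text \<open>\<open>UNIV\<close> is a minimal ideal above \<open>P\<close>, so the torsion lemma
  applies to the whole quotient.\<close>

lemma char_exists:
  obtains p where "prime p" "of_nat p \<in> P" "\<And>S. asub S \<Longrightarrow> P \<subseteq> S \<Longrightarrow> \<exists>m. idx P S = p ^ m"
proof -
  have "P \<subset> UNIV" using one_notin by blast
  then obtain p where p: "prime p" "\<And>x. of_nat p * x \<in> P"
    using minimal_idl_torsion[OF idl fin idl_UNIV] maximal by (metis UNIV_I)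
  show ?thesis
  proof (rule that[OF p(1)])
    show "of_nat p \<in> P" using p(2)[of 1] by simp
    fix S assume "asub S" "P \<subseteq> S"
    then show "\<exists>m. idx P S = p ^ m" using p by (intro idx_elementary asub fin_image) simp_all
  qed
qed

text \<open>The quotient is rebuilt as a HOL-Algebra structure to obtain two facts:
  \<open>X ^ d = 1\<close> has at most \<open>d\<close> solutions in a field, and raising an element
  of a finite group to the group order gives 1.\<close>

definition RA :: "'a ring" where
  "RA = \<lparr>carrier = UNIV, monoid.mult = (*), one = 1, zero = 0, add = (+)\<rparr>"

lemma RA_simps [simp]: "carrier RA = UNIV" "x \<otimes>\<^bsub>RA\<^esub> y = x * y" "\<one>\<^bsub>RA\<^esub> = 1" "\<zero>\<^bsub>RA\<^esub> = 0"
  "x \<oplus>\<^bsub>RA\<^esub> y = x + y"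
  by (simp_all add: RA_def)

lemma RA_ring: "Ring.ring RA"
proof (rule ringI)
  show "abelian_group RA"
    by (rule abelian_groupI) (auto simp: algebra_simps intro: exI[of _ "- _"] left_minus)
  show "Group.monoid RA" by (rule monoidI) (simp_all add: mult.assoc)
qed (simp_all add: algebra_simps)

lemma RA_ideal: "ideal P RA"
proof (rule idealI[OF RA_ring])
  interpret R: Ring.ring RA by (rule RA_ring)
  have minus: "inv\<^bsub>add_monoid RA\<^esub> x = - x" for x
    by (rule group.inv_equality[OF R.a_group]) simp_all
  show "subgroup P (add_monoid RA)"
  proof (rule group.subgroupI)
    show "group (add_monoid RA)" by (rule R.a_group)
    show "P \<noteq> {}" using asub_0[OF asub] by blast
    fix a assume "a \<in> P"
    then show "inv\<^bsub>add_monoid RA\<^esub> a \<in> P" using asub by (subst minus) (rule asub_uminus)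
  qed (use asub in \<open>auto simp: asub_add\<close>)
qed (simp_all add: idl_left[OF idl] idl_right[OF idl])

lemma RA_coset: "P +>\<^bsub>RA\<^esub> x = coset P x"
proof -
  have "y \<in> (\<Union>h\<in>P. {h + x}) \<longleftrightarrow> y \<in> coset P x" for y
    by (auto simp: coset_def intro!: bexI[of _ "y - x"])
  then show ?thesis unfolding a_r_coset_def r_coset_def by auto
qed

definition Q :: "'a set ring" where
  "Q = RA Quot P"

lemma Q_simps: "carrier Q = range (coset P)" "\<one>\<^bsub>Q\<^esub> = coset P 1" "\<zero>\<^bsub>Q\<^esub> = coset P 0"
proof -
  have "coset P 0 = P" by (simp add: coset_def)
  then show "carrier Q = range (coset P)" "\<one>\<^bsub>Q\<^esub> = coset P 1" "\<zero>\<^bsub>Q\<^esub> = coset P 0"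
    unfolding Q_def FactRing_simps by (auto simp: RA_coset)
qed

lemma coset_carrier: "coset P x \<in> carrier Q"
  unfolding Q_simps by (rule rangeI)

lemma Q_mult: "coset P x \<otimes>\<^bsub>Q\<^esub> coset P y = coset P (x * y)"
  using ideal.rcoset_mult_add[OF RA_ideal, of x y] by (simp add: Q_def FactRing_def RA_coset)

lemma Q_field: "Ring.field Q"
proof (rule cring.cring_fieldI2)
  have "Ring.ring Q" unfolding Q_def by (rule ideal.quotient_is_ring[OF RA_ideal])
  then show "Ring.cring Q"
  proof (intro cring.intro comm_monoid.intro comm_monoid_axioms.intro)
    show "Group.monoid Q" using \<open>Ring.ring Q\<close> by (simp add: Ring.ring_def)
    fix A B assume "A \<in> carrier Q" "B \<in> carrier Q"
    then obtain x y where "A = coset P x" "B = coset P y" unfolding Q_simps by blast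
    then show "A \<otimes>\<^bsub>Q\<^esub> B = B \<otimes>\<^bsub>Q\<^esub> A" by (simp add: Q_mult coset_eq[OF asub] comm)
  qed
  show "\<zero>\<^bsub>Q\<^esub> \<noteq> \<one>\<^bsub>Q\<^esub>"
    using one_notin asub_uminus[OF asub, of "- 1"] by (auto simp: Q_simps coset_eq[OF asub])
  fix A assume "A \<in> carrier Q" "A \<noteq> \<zero>\<^bsub>Q\<^esub>"
  then obtain x where x: "A = coset P x" "x \<notin> P" unfolding Q_simps using coset_eq_0 by blast
  then obtain y where "y * x - 1 \<in> P" using inv by blast
  then have "x * y - 1 \<in> P" using asub_diff_trans[OF asub comm] by blast
  then show "\<exists>B\<in>carrier Q. A \<otimes>\<^bsub>Q\<^esub> B = \<one>\<^bsub>Q\<^esub>"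
    using x by (intro bexI[of _ "coset P y"]) (simp_all add: coset_carrier Q_simps(2) Q_mult coset_eq[OF asub])
qed

lemma Q_pow: "coset P x [^]\<^bsub>Q\<^esub> (n::nat) = coset P (x ^ n)"
proof -
  interpret Q: Ring.field Q by (rule Q_field)
  show ?thesis
    by (induction n) (simp_all add: Q_simps(2) Q_mult power_commutes)
qed

lemma card_roots_of_unity:
  assumes "0 < d"
  shows "card (coset P ` {x. x ^ d - 1 \<in> P}) \<le> d"
proof -
  interpret Q: Ring.field Q by (rule Q_field)
  have "coset P ` {x. x ^ d - 1 \<in> P} \<subseteq> {A \<in> carrier Q. A [^]\<^bsub>Q\<^esub> d = \<one>\<^bsub>Q\<^esub>}"
    by (rule image_subsetI) (simp add: coset_carrier Q_simps(2) Q_pow coset_eq[OF asub])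
  moreover have finQ: "finite (carrier Q)" using fin_image by (simp add: Q_simps)
  ultimately have "card (coset P ` {x. x ^ d - 1 \<in> P}) \<le> card {A \<in> carrier Q. A [^]\<^bsub>Q\<^esub> d = \<one>\<^bsub>Q\<^esub>}"
    by (intro card_mono) simp_all
  also have "\<dots> \<le> d" using Q.num_roots_le_deg[OF finQ] assms by simp
  finally show ?thesis .
qed

lemma pow_idx_UNIV: "x \<notin> P \<Longrightarrow> x ^ (idx P UNIV - 1) - 1 \<in> P"
proof -
  assume x: "x \<notin> P"
  interpret Q: Ring.field Q by (rule Q_field)
  interpret G: group "mult_of Q" by (rule Q.field_mult_group)
  have "order (mult_of Q) = idx P UNIV - 1"
    by (simp add: order_def Q_simps card_Diff_singleton)
  moreover have "coset P x \<in> carrier (mult_of Q)"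
    using x by (simp add: coset_carrier Q_simps(3) coset_eq[OF asub])
  ultimately have "coset P x [^]\<^bsub>Q\<^esub> (idx P UNIV - 1) = \<one>\<^bsub>Q\<^esub>"
    using G.pow_order_eq_1[of "coset P x"] by (simp add: nat_pow_mult_of)
  then show ?thesis by (simp add: Q_pow Q_simps coset_eq[OF asub])
qed

lemma exists_inverse_in_srng:
  assumes "srng M" "P \<subseteq> M" "x \<in> M" "x \<notin> P"
  obtains y where "y \<in> M" "y * x - 1 \<in> P" "x * y - 1 \<in> P"
proof -
  let ?n = "idx P UNIV - 1"
  have n: "0 < ?n" using one_less_idx by simp
  \<comment> \<open>The inverse is the power with exponent \<open>2 * ?n - 1\<close>. The exponent
    \<open>?n - 1\<close> would be 0 for the field with two elements, and \<open>srng_pow\<close>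
    needs a positive one.\<close>
  have "(x ^ ?n) ^ 2 - 1 ^ 2 \<in> P" by (rule idl_diff_power[OF idl pow_idx_UNIV[OF assms(4)]])
  moreover have "(x ^ ?n) ^ 2 = x ^ (2 * ?n - 1) * x" "(x ^ ?n) ^ 2 = x * x ^ (2 * ?n - 1)"
    using n by (simp_all flip: power_mult power_Suc power_Suc2 add: mult.commute)
  moreover have "x ^ (2 * ?n - 1) \<in> M" using n assms by (intro srng_pow) simp_all
  ultimately show ?thesis using that[of "x ^ (2 * ?n - 1)"] by simp
qed

text \<open>The nonzero residues of \<open>M\<close> are closed under inverses, which are powers, so
  they form a subgroup of the multiplicative group.\<close>

lemma pow_idx_srng:
  assumes "srng M" "P \<subseteq> M" "x \<in> M" "x \<notin> P"
  shows "x ^ (idx P M - 1) - 1 \<in> P"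
proof -
  interpret Q: Ring.field Q by (rule Q_field)
  interpret G: group "mult_of Q" by (rule Q.field_mult_group)
  have M: "asub M" using assms by (simp add: srng_asub)
  let ?H = "coset P ` (M - P)"
  have "subgroup ?H (mult_of Q)"
  proof (rule G.subgroupI)
    show "?H \<subseteq> carrier (mult_of Q)" by (auto simp: Q_simps coset_eq[OF asub])
    show "?H \<noteq> {}" using assms by blast
    fix A assume "A \<in> ?H"
    then obtain x where x: "A = coset P x" "x \<in> M" "x \<notin> P" by blast
    then obtain y where y: "y \<in> M" "y * x - 1 \<in> P" using exists_inverse_in_srng[OF assms(1,2)] by blast
    have "y \<notin> P" using y one_notin idl_right[OF idl, of y x] asub_diff_mem[OF asub y(2)] by blast
    then have "inv\<^bsub>mult_of Q\<^esub> A = coset P y" using x y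
      by (intro G.inv_equality) (simp_all add: coset_carrier Q_simps(2,3) Q_mult coset_eq[OF asub])
    then show "inv\<^bsub>mult_of Q\<^esub> A \<in> ?H" using y \<open>y \<notin> P\<close> by blast
  next
    fix A B assume "A \<in> ?H" "B \<in> ?H"
    then obtain x y where "A = coset P x" "B = coset P y" "x \<in> M" "y \<in> M" "x \<notin> P" "y \<notin> P" by blast
    then show "A \<otimes>\<^bsub>mult_of Q\<^esub> B \<in> ?H"
      using prime assms(1) by (auto simp: Q_mult srng_mult intro!: imageI)
  qed
  then interpret H: group "(mult_of Q)\<lparr>carrier := ?H\<rparr>" by (rule subgroup.subgroup_is_group) (rule G.is_group)
  have "?H = coset P ` M - {coset P 0}" by (rule image_minus)
  moreover have "coset P 0 \<in> coset P ` M" using asub_0[OF M] by blast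
  ultimately have "order ((mult_of Q)\<lparr>carrier := ?H\<rparr>) = idx P M - 1"
    by (simp add: order_def card_Diff_singleton)
  moreover have "coset P x \<in> ?H" using assms by blast
  ultimately have "coset P x [^]\<^bsub>Q\<^esub> (idx P M - 1) = \<one>\<^bsub>Q\<^esub>"
    using H.pow_order_eq_1[of "coset P x"] G.nat_pow_consistent[of "coset P x" "idx P M - 1" ?H]
    by (simp add: nat_pow_mult_of)
  then show ?thesis by (simp add: Q_pow Q_simps coset_eq[OF asub])
qed

text \<open>Both subrings consist of 0 and all \<open>d\<close>-th roots of unity.\<close>

lemma srng_eqI_idx:
  assumes "srng M" "P \<subseteq> M" "srng M'" "P \<subseteq> M'" "idx P M = idx P M'"
  shows "M = M'"
proof -
  have M: "asub M" "asub M'" using assms by (simp_all add: srng_asub)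
  let ?d = "idx P M - 1"
  have H: "coset P ` (S - P) = coset P ` {x. x ^ ?d - 1 \<in> P}" if "srng S" "P \<subseteq> S" "idx P S = idx P M" "0 < ?d" for S
  proof (rule card_seteq)
    have aS: "asub S" using that by (simp add: srng_asub)
    show "coset P ` (S - P) \<subseteq> coset P ` {x. x ^ ?d - 1 \<in> P}" using pow_idx_srng[OF that(1,2)] that(3) by auto
    have "coset P ` (S - P) = coset P ` S - {coset P 0}" by (rule image_minus)
    moreover have "coset P 0 \<in> coset P ` S" using asub_0[OF aS] by blast
    ultimately have "card (coset P ` (S - P)) = ?d" by (simp add: card_Diff_singleton that)
    then show "card (coset P ` {x. x ^ ?d - 1 \<in> P}) \<le> card (coset P ` (S - P))"
      using card_roots_of_unity[OF that(4)] by simp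
  qed (rule fin_image)
  have mem: "x \<in> S \<longleftrightarrow> coset P x \<in> coset P ` (S - P) \<or> x \<in> P" if "asub S" "P \<subseteq> S" for x S
  proof -
    have "coset P x \<in> coset P ` (S - P) \<Longrightarrow> x \<in> S" using coset_image_iff[OF that(1) asub that(2)] by blast
    then show ?thesis using that by blast
  qed
  show ?thesis
  proof (cases "0 < ?d")
    case True
    then have "coset P ` (M - P) = coset P ` (M' - P)" using H[of M] H[of M'] assms by simp
    then have "x \<in> M \<longleftrightarrow> x \<in> M'" for x
      by (subst mem[OF M(1) assms(2)], subst mem[OF M(2) assms(4)]) simp
    then show ?thesis by blast
  next
    case False
    have "S = P" if "asub S" "P \<subseteq> S" "idx P S = idx P M" for S
    proof -
      have "card (coset P ` S) \<le> Suc 0" using False that by simp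
      then have "\<forall>A\<in>coset P ` S. \<forall>B\<in>coset P ` S. A = B" using card_le_Suc0_iff_eq[OF fin_image] by blast
      then have "coset P x = coset P 0" if "x \<in> S" for x using that asub_0[OF \<open>asub S\<close>] by blast
      then have "S \<subseteq> P" using coset_eq_0 by blast
      then show ?thesis using that(2) by blast
    qed
    from this[OF M(1) assms(2)] this[OF M(2) assms(4)] show ?thesis using assms(5) by simp
  qed
qed

text \<open>For \<open>z\<close> outside \<open>M\<close>, elements \<open>m + n * z\<close> with
  different pairs of residues of \<open>m\<close> and \<open>n\<close> are incongruent, since
  otherwise \<open>z\<close> could be solved for inside \<open>M\<close>: the field has dimension at
  least 2 over the subring.\<close>

lemma idx_proper_srng:
  assumes "srng M" "P \<subseteq> M" "M \<noteq> UNIV"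
  shows "idx P M ^ 2 \<le> idx P UNIV"
proof -
  have M: "asub M" using assms by (simp add: srng_asub)
  obtain z where z: "z \<notin> M" using assms by blast
  obtain R where R: "R \<subseteq> M" "inj_on (coset P) R" "coset P ` M = coset P ` R"
    using subset_image_inj[of "coset P ` M" "coset P" M] by auto
  have card: "card R = idx P M" using R card_image by metis
  have "inj_on (\<lambda>(m, n). coset P (m + n * z)) (R \<times> R)"
  proof (rule inj_onI, clarify)
    fix m n m' n' assume R': "m \<in> R" "n \<in> R" "m' \<in> R" "n' \<in> R"
      and "coset P (m + n * z) = coset P (m' + n' * z)"
    then have "(m + n * z) - (m' + n' * z) \<in> P" by (simp add: coset_eq[OF asub])
    then have d: "(m - m') + (n - n') * z \<in> P" by (simp add: algebra_simps)
    have mM: "m - m' \<in> M" "n - n' \<in> M" using R R' M by (auto intro: asub_diff)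
    have "n - n' \<in> P"
    proof (rule ccontr)
      assume "n - n' \<notin> P"
      then obtain y where y: "y \<in> M" "y * (n - n') - 1 \<in> P"
        using exists_inverse_in_srng[OF assms(1,2) mM(2)] by blast
      have "y * ((m - m') + (n - n') * z) - (y * (n - n') - 1) * z \<in> M"
        using idl_left[OF idl d] idl_right[OF idl y(2)] assms(2) M by (blast intro: asub_diff)
      moreover have "y * ((m - m') + (n - n') * z) - (y * (n - n') - 1) * z = y * (m - m') + z"
        by (simp add: algebra_simps)
      moreover have "y * (m - m') \<in> M" using y mM assms(1) by (intro srng_mult)
      ultimately show False using z asub_diff[OF M, of "y * (m - m') + z" "y * (m - m')"] by simp
    qed
    then have "(n - n') * z \<in> P" by (rule idl_right[OF idl])
    then have "m - m' \<in> P" using asub_diff[OF asub d, of "(n - n') * z"] by simp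
    then show "m = m' \<and> n = n'" using \<open>n - n' \<in> P\<close> R(2) R' by (auto simp: inj_on_def coset_eq[OF asub])
  qed
  then have "card (R \<times> R) \<le> card (range (coset P))"
    by (rule card_inj_on_le) (auto intro: fin_image)
  then show ?thesis by (simp add: card card_cartesian_product power2_eq_square)
qed

end

section \<open>Maximal subrings of a reduced commutative quotient\<close>

lemma card_image_cong_kernel:
  assumes "\<And>x y. x \<in> S \<Longrightarrow> y \<in> S \<Longrightarrow> f x = f y \<longleftrightarrow> g x = g y"
  shows "card (f ` S) = card (g ` S)"
proof -
  have "bij_betw (\<lambda>b. g (inv_into S f b)) (f ` S) (g ` S)"
  proof (rule bij_betw_imageI)
    have i: "inv_into S f (f x) \<in> S" "f (inv_into S f (f x)) = f x" if "x \<in> S" for x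
      using that by (auto simp: inv_into_into f_inv_into_f)
    then have e: "g (inv_into S f (f x)) = g x" if "x \<in> S" for x using assms that by blast
    show "inj_on (\<lambda>b. g (inv_into S f b)) (f ` S)" by (rule inj_onI) (use assms e in force)
    show "(\<lambda>b. g (inv_into S f b)) ` f ` S = g ` S" using e by (simp add: image_image)
  qed
  then show ?thesis by (rule bij_betw_same_card)
qed

definition surj_mod :: "'a::ring_1 set \<Rightarrow> 'a set \<Rightarrow> bool" where
  "surj_mod M P \<longleftrightarrow> (\<forall>a. \<exists>m\<in>M. a - m \<in> P)"

lemma surj_mod_splus: "surj_mod M P \<longleftrightarrow> splus M P = UNIV"
proof
  assume s: "surj_mod M P"
  have "a \<in> splus M P" for a
  proof -
    obtain m where "m \<in> M" "a - m \<in> P" using s by (auto simp: surj_mod_def)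
    then show ?thesis using splusI[of m M "a - m" P] by simp
  qed
  then show "splus M P = UNIV" by blast
next
  assume s: "splus M P = UNIV"
  show "surj_mod M P" unfolding surj_mod_def
  proof
    fix a
    have "a \<in> splus M P" using s by simp
    then obtain m t where "a = m + t" "m \<in> M" "t \<in> P" by (rule splusE)
    then show "\<exists>m\<in>M. a - m \<in> P" by (intro bexI[of _ m]) simp_all
  qed
qed

text \<open>\<open>M\<close> induces the graph of an isomorphism between the residue fields of \<open>P\<close> and \<open>Q\<close>.\<close>

definition graph_type :: "'a::ring_1 set \<Rightarrow> 'a set \<Rightarrow> 'a set \<Rightarrow> bool" where
  "graph_type M P Q \<longleftrightarrow> M \<inter> P = M \<inter> Q \<and> P \<inter> Q \<subseteq> M \<and> surj_mod M P \<and> surj_mod M Q"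

lemma graph_type_sym: "graph_type M P Q \<Longrightarrow> graph_type M Q P"
  by (auto simp: graph_type_def)

text \<open>\<open>M\<close> maps onto both residue fields with the same kernel.\<close>

lemma graph_type_idx:
  assumes "srng M" "residue_field P" "residue_field Q" "graph_type M P Q"
  shows "idx P UNIV = idx Q UNIV"
proof -
  have aM: "asub M" using assms(1) by (rule srng_asub)
  have r: "coset P ` M = range (coset P)" if s: "residue_field P" "surj_mod M P" for P
  proof -
    have "coset P a \<in> coset P ` M" for a
    proof -
      obtain m where "m \<in> M" "a - m \<in> P" using s(2) unfolding surj_mod_def by blast
      then have "coset P a = coset P m" using coset_eq[OF residue_field.asub[OF s(1)]] by blast
      then show ?thesis using \<open>m \<in> M\<close> by blast
    qed
    then show ?thesis by blast
  qed
  have "coset P x = coset P y \<longleftrightarrow> coset Q x = coset Q y" if "x \<in> M" "y \<in> M" for x y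
    using asub_diff[OF aM that] assms(4) coset_eq[OF residue_field.asub[OF assms(2)], of x y]
      coset_eq[OF residue_field.asub[OF assms(3)], of x y] unfolding graph_type_def by blast
  then have "card (coset P ` M) = card (coset Q ` M)" by (rule card_image_cong_kernel)
  then show ?thesis using r[OF assms(2)] r[OF assms(3)] assms(4) by (simp add: graph_type_def)
qed

lemma principal_idl:
  fixes P :: "'a::ring_1 set"
  assumes P: "idl P" and comm: "\<And>a b. a * b - b * a \<in> P"
  defines "L \<equiv> \<lambda>x. {y. \<exists>a. y - a * x \<in> P}"
  shows "idl (L x)" "P \<subseteq> L x" "x \<in> L x"
proof -
  have aP: "asub P" using P by (rule idl_asub)
  show "x \<in> L x" "P \<subseteq> L x" unfolding L_def
    using asub_0[OF aP] by (auto intro: exI[of _ 1] exI[of _ 0])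
  then show "idl (L x)"
  proof (intro idlI asubI)
    show "0 \<in> L x" using asub_0[OF aP] \<open>P \<subseteq> L x\<close> by blast
    fix y z assume "y \<in> L x" "z \<in> L x"
    then obtain a b where "y - a * x \<in> P" "z - b * x \<in> P" unfolding L_def by blast
    from asub_diff[OF aP this] have "(y - z) - (a - b) * x \<in> P" by (simp add: algebra_simps)
    then show "y - z \<in> L x" unfolding L_def by blast
  next
    fix y r assume "y \<in> L x"
    then obtain a where a: "y - a * x \<in> P" unfolding L_def by blast
    have "r * y - r * a * x \<in> P" using idl_left[OF P a, of r] by (simp add: algebra_simps)
    then show "r * y \<in> L x" unfolding L_def by blast
    have "(y - a * x) * r + a * (x * r - r * x) \<in> P"
      using idl_right[OF P a] idl_left[OF P comm] by (intro asub_add aP)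
    then have "y * r - a * r * x \<in> P" by (simp add: algebra_simps)
    then show "y * r \<in> L x" unfolding L_def by blast
  qed
qed

section \<open>The critical quotient as a product of finite fields, and its maximal subrings\<close>

context critical
begin

lemma asubK: "asub K"
  using K by (simp add: idl_asub)

lemma no_square_zero_idl:
  assumes "idl L" "K \<subset> L" "\<And>x y. x \<in> L \<Longrightarrow> y \<in> L \<Longrightarrow> x * y \<in> K"
  shows False
proof -
  obtain I where I: "idl I" "K \<subset> I" "I \<subseteq> L" "\<And>T. idl T \<Longrightarrow> K \<subseteq> T \<Longrightarrow> T \<subseteq> I \<Longrightarrow> T = K \<or> T = I"
    using exists_minimal_idl[OF K assms(1,2)] by blast
  show False by (rule no_square_zero_minimal_idl[OF I(1,2,4)]) (use assms(3) I(3) in auto)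
qed

text \<open>A minimal ideal inside \<open>J + K\<close> is annihilated by \<open>J\<close>, hence
  has square zero modulo \<open>K\<close>. It follows that the critical quotient is
  commutative.\<close>

lemma J_subset: "J \<subseteq> K"
proof (rule ccontr)
  assume "\<not> J \<subseteq> K"
  then have "idl (splus J K)" "K \<subset> splus J K"
    using J(1) K(1) splus_upper1[OF asubK, of J] splus_upper2[OF idl_asub[OF J(1)], of K]
    by (auto simp: splus_idl)
  then obtain I where I: "idl I" "K \<subset> I" "I \<subseteq> splus J K" "\<And>T. idl T \<Longrightarrow> K \<subseteq> T \<Longrightarrow> T \<subseteq> I \<Longrightarrow> T = K \<or> T = I"
    using exists_minimal_idl[OF K] by blast
  have sq: "x * y \<in> K" if xy: "x \<in> I" "y \<in> I" for x y
  proof -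
    have "x \<in> splus J K" using xy I by blast
    then obtain j k where jk: "x = j + k" "j \<in> J" "k \<in> K" by (rule splusE)
    have "j * y \<in> K" using nil_idl_annihilates(1)[OF K J(1,3) I(1,2,4) xy(2) jk(2)] by blast
    then show ?thesis using jk K by (simp add: distrib_right asub_add asubK idl_right)
  qed
  show False by (rule no_square_zero_minimal_idl[OF I(1,2,4) sq])
qed

lemma commK: "a * b - b * a \<in> K"
  using J(2) J_subset by blast

lemma reduced: "x * x \<in> K \<Longrightarrow> x \<in> K"
proof (rule ccontr)
  assume x: "x * x \<in> K" "x \<notin> K"
  define L where "L = {y. \<exists>a. y - a * x \<in> K}"
  have "idl L" "K \<subseteq> L" "x \<in> L" unfolding L_def by (rule principal_idl[OF K(1) commK])+
  moreover have "y * z \<in> K" if yz: "y \<in> L" "z \<in> L" for y z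
  proof -
    obtain a b where ab: "y - a * x \<in> K" "z - b * x \<in> K" using yz unfolding L_def by blast
    have "y * z - (a * x) * (b * x) \<in> K" by (rule idl_diff_mult[OF K(1) ab])
    moreover have "a * (x * b - b * x) * x + a * b * (x * x) \<in> K"
      using idl_right[OF K(1) idl_left[OF K(1) commK]] idl_left[OF K(1) x(1)] by (intro asub_add asubK)
    then have "(a * x) * (b * x) \<in> K" by (simp add: algebra_simps)
    ultimately show ?thesis using asub_diff_mem[OF asubK] by blast
  qed
  ultimately show False using no_square_zero_idl[of L] x by blast
qed

lemma reduced_power: "0 < n \<Longrightarrow> x ^ n \<in> K \<Longrightarrow> x \<in> K"
proof (induction n rule: less_induct)
  case (less n)
  show ?case
  proof (cases "n = 1")
    case False
    define m where "m = (n + 1) div 2"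
    have m: "m < n" "0 < m" "n \<le> m + m" using less.prems False by (auto simp: m_def)
    have "x ^ (m + m - n) * x ^ n \<in> K" using less.prems K by (simp add: idl_left)
    then have "x ^ m * x ^ m \<in> K" using m by (simp flip: power_add)
    then show ?thesis using less.IH m reduced by blast
  qed (use less.prems in simp)
qed

text \<open>The coordinates: modulo \<open>K\<close> the ring turns out to be the product of the
  fields \<open>R/P\<close>.\<close>

definition PP :: "'a set set" where
  "PP = {P. residue_field P \<and> K \<subseteq> P}"

lemma PP_rf: "P \<in> PP \<Longrightarrow> residue_field P"
  by (simp add: PP_def)

lemma PP_K: "P \<in> PP \<Longrightarrow> K \<subseteq> P"
  by (simp add: PP_def)

lemma PP_idl: "P \<in> PP \<Longrightarrow> idl P"
  by (simp add: PP_def residue_field.idl)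

lemma PP_asub: "P \<in> PP \<Longrightarrow> asub P"
  by (simp add: PP_idl idl_asub)

lemma finite_PP: "finite PP"
proof (rule finite_subset)
  show "PP \<subseteq> {S. asub S \<and> K \<subseteq> S}" using PP_asub PP_K by blast
qed (rule finite_supergroups[OF K(2) asubK])

lemma exists_PP:
  assumes "idl L" "K \<subseteq> L" "1 \<notin> L"
  obtains P where "P \<in> PP" "L \<subseteq> P"
proof -
  obtain P where P: "idl P" "L \<subseteq> P" "1 \<notin> P" "\<And>T. idl T \<Longrightarrow> 1 \<notin> T \<Longrightarrow> P \<subseteq> T \<Longrightarrow> T = P"
    using exists_maximal_idl[OF K assms(1,2), of "\<lambda>T. 1 \<notin> T"] assms(3) by metis
  have KP: "K \<subseteq> P" using P assms by blast
  have aP: "asub P" using P(1) by (rule idl_asub)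
  have cP: "a * b - b * a \<in> P" for a b using commK KP by blast
  have "residue_field P"
  proof
    show "fin_ix P" by (rule fin_ix_mono[OF K(2) asubK aP KP])
    fix x assume x: "x \<notin> P"
    define L where "L = {y. \<exists>a. y - a * x \<in> P}"
    have "idl L" "P \<subseteq> L" "x \<in> L" unfolding L_def by (rule principal_idl[OF P(1) cP])+
    then have "1 \<in> L" using P(4)[of L] x by blast
    then obtain a where "1 - a * x \<in> P" unfolding L_def by blast
    then show "\<exists>y. y * x - 1 \<in> P" using asub_diff_commute[OF aP] by blast
  qed (use P cP in simp_all)
  then show ?thesis using that P KP by (simp add: PP_def)
qed

text \<open>A power \<open>e\<close> of \<open>x\<close> is idempotent modulo \<open>K\<close> and,
  by reducedness, not in \<open>K\<close>. Its annihilator is a proper ideal containing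
  \<open>1 - e\<close>; a coordinate above that ideal contains \<open>1 - e\<close>, and it cannot
  also contain \<open>e\<close>.\<close>

lemma Inter_PP: "(\<And>P. P \<in> PP \<Longrightarrow> x \<in> P) \<Longrightarrow> x \<in> K"
proof (rule ccontr)
  assume all: "\<And>P. P \<in> PP \<Longrightarrow> x \<in> P" and x: "x \<notin> K"
  obtain m d :: nat where md: "0 < d" "x ^ (m + d) - x ^ m \<in> K"
    using fin_ix_recurrent[OF K(2) asubK, of "\<lambda>n. x ^ n"] by blast
  have step: "x ^ (k + d * j) - x ^ k \<in> K" if "m \<le> k" for k j
  proof (induction j)
    case (Suc j)
    have "x ^ (k + d * j - m) * (x ^ (m + d) - x ^ m) \<in> K" using md K by (simp add: idl_left)
    then have "x ^ (k + d * Suc j) - x ^ (k + d * j) \<in> K"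
      using that by (simp add: right_diff_distrib algebra_simps flip: power_add)
    then show ?case using Suc asub_diff_trans[OF asubK] by blast
  qed (simp add: asub_0 asubK)
  \<comment> \<open>A multiple of the period \<open>d\<close> that is at least \<open>m\<close>, so
    that \<open>x ^ (2 * N)\<close> and \<open>x ^ N\<close> agree modulo \<open>K\<close>.\<close>
  define N where "N = d * (m + 1)"
  have N: "0 < N" "m \<le> N" using md(1) by (simp_all add: N_def trans_le_add2)
  define e where "e = x ^ N"
  have e: "e * e - e \<in> K" using step[OF N(2), of "m + 1"] by (simp add: e_def N_def flip: power_add)
  have eK: "e \<notin> K" unfolding e_def using reduced_power[OF N(1)] x by blast
  define L where "L = {y. y * e \<in> K}"
  have "idl L"
  proof (intro idlI asubI)
    fix y r assume "y \<in> L"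
    then have y: "y * e \<in> K" by (simp add: L_def)
    then show "r * y \<in> L" using idl_left[OF K(1)] by (simp add: L_def mult.assoc)
    have "y * (r * e - e * r) + y * e * r \<in> K"
      using y idl_left[OF K(1) commK] idl_right[OF K(1)] by (intro asub_add asubK)
    then show "y * r \<in> L" by (simp add: L_def algebra_simps)
  qed (auto simp: L_def asub_0 asubK asub_diff left_diff_distrib)
  moreover have "K \<subseteq> L" using K by (auto simp: L_def idl_right)
  moreover have "1 \<notin> L" using eK by (simp add: L_def)
  ultimately obtain P where P: "P \<in> PP" "L \<subseteq> P" using exists_PP by blast
  have "1 - e \<in> L" using asub_diff_commute[OF asubK e] by (simp add: L_def left_diff_distrib)
  then have "1 - e \<in> P" using P by blast
  moreover have "e \<in> P" unfolding e_def using all[OF P(1)] N(1) srng_pow[OF idl_srng[OF PP_idl[OF P(1)]]] by blast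
  ultimately have "1 \<in> P" using asub_add[OF PP_asub[OF P(1)], of "1 - e" e] by simp
  then show False using residue_field.one_notin[OF PP_rf[OF P(1)]] by simp
qed

lemma PP_subset_eq: "P \<in> PP \<Longrightarrow> Q \<in> PP \<Longrightarrow> P \<subseteq> Q \<Longrightarrow> P = Q"
  using residue_field.maximal[of P Q] residue_field.one_notin[of Q] PP_rf PP_idl by blast

lemma PP_Int_subset:
  assumes "P \<in> PP" "Q \<in> PP" "R \<in> PP" "P \<inter> Q \<subseteq> R"
  shows "R = P \<or> R = Q"
proof (rule ccontr)
  assume "\<not> (R = P \<or> R = Q)"
  then have "\<not> P \<subseteq> R" "\<not> Q \<subseteq> R"
    using PP_subset_eq[OF assms(1,3)] PP_subset_eq[OF assms(2,3)] by auto
  then obtain x y where xy: "x \<in> P" "x \<notin> R" "y \<in> Q" "y \<notin> R" by auto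
  have "x * y \<in> P \<inter> Q" using xy assms(1,2) PP_idl by (simp add: idl_left idl_right)
  then have "x * y \<in> R" using assms(4) by blast
  then show False using residue_field.prime[OF PP_rf[OF assms(3)]] xy by blast
qed

text \<open>For each \<open>Q\<close> a scaled element of \<open>M\<close> is 1 at \<open>P\<close>
  and 0 at \<open>Q\<close>; their product imitates, inside \<open>M\<close>, an idempotent of the
  product ring.\<close>

lemma separate:
  assumes "finite F" "F \<subseteq> PP" "P \<in> PP" "srng M" "surj_mod M P" "\<And>Q. Q \<in> F \<Longrightarrow> \<not> M \<inter> Q \<subseteq> P"
  shows "\<exists>e\<in>M. e - 1 \<in> P \<and> (\<forall>Q\<in>F. e \<in> Q)"
  using assms(1,2,6)
proof (induction F rule: finite_induct)
  case empty
  obtain m where "m \<in> M" "1 - m \<in> P" using assms(5) unfolding surj_mod_def by blast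
  then show ?case using asub_diff_commute[OF PP_asub[OF assms(3)]] by blast
next
  case (insert Q F)
  then obtain e where e: "e \<in> M" "e - 1 \<in> P" "\<And>Q. Q \<in> F \<Longrightarrow> e \<in> Q" by auto
  obtain m where m: "m \<in> M" "m \<in> Q" "m \<notin> P" using insert.prems(2)[of Q] by blast
  obtain y where y: "y * m - 1 \<in> P" using residue_field.inv[OF PP_rf[OF assms(3)] m(3)] by blast
  obtain n where n: "n \<in> M" "y - n \<in> P" using assms(5) unfolding surj_mod_def by blast
  have P: "idl P" using assms(3) by (rule PP_idl)
  have "n * m - y * m \<in> P"
    using idl_right[OF P asub_diff_commute[OF idl_asub[OF P] n(2)], of m] by (simp add: left_diff_distrib)
  then have "n * m - 1 \<in> P" using y asub_diff_trans[OF idl_asub[OF P]] by blast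
  then have "e * (n * m) - 1 * 1 \<in> P" using e(2) by (intro idl_diff_mult[OF P])
  moreover have "e * (n * m) \<in> M" using e n m assms(4) by (intro srng_mult)
  moreover have "e * (n * m) \<in> Q" using m(2) PP_idl[of Q] insert.prems(1) by (simp add: idl_left)
  moreover have "e * (n * m) \<in> Q'" if "Q' \<in> F" for Q'
    using e(3)[OF that] PP_idl[of Q'] insert.prems(1) that by (intro idl_right) auto
  ultimately show ?case by auto
qed

text \<open>The Chinese remainder theorem carried out inside \<open>M\<close>. For a proper subring
  its failure names the one or two coordinates that obstruct it.\<close>

lemma srng_eq_UNIV_crt:
  assumes "srng M" "K \<subseteq> M" "\<And>P. P \<in> PP \<Longrightarrow> surj_mod M P"
    "\<And>P Q. P \<in> PP \<Longrightarrow> Q \<in> PP \<Longrightarrow> P \<noteq> Q \<Longrightarrow> \<not> M \<inter> Q \<subseteq> P"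
  shows "M = UNIV"
proof (rule UNIV_eq_I[symmetric])
  fix a
  have "\<forall>P\<in>PP. \<exists>e\<in>M. e - 1 \<in> P \<and> (\<forall>Q\<in>PP - {P}. e \<in> Q)"
    using assms finite_PP by (intro ballI separate) auto
  then obtain e where e: "\<And>P. P \<in> PP \<Longrightarrow> e P \<in> M \<and> e P - 1 \<in> P \<and> (\<forall>Q\<in>PP - {P}. e P \<in> Q)"
    by metis
  have "\<forall>P\<in>PP. \<exists>m\<in>M. a - m \<in> P" using assms(3) by (simp add: surj_mod_def)
  then obtain m where m: "\<And>P. P \<in> PP \<Longrightarrow> m P \<in> M \<and> a - m P \<in> P" by metis
  define s where "s = (\<Sum>P\<in>PP. m P * e P)"
  have sM: "s \<in> M" unfolding s_def using e m assms(1) by (intro asub_sum) (auto simp: srng_asub srng_mult)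
  have "a - s \<in> P" if P: "P \<in> PP" for P
  proof -
    have iP: "idl P" and aP: "asub P" using P by (simp_all add: PP_idl PP_asub)
    have "s = m P * e P + (\<Sum>Q\<in>PP - {P}. m Q * e Q)"
      unfolding s_def using finite_PP P by (rule sum.remove)
    moreover have "(\<Sum>Q\<in>PP - {P}. m Q * e Q) \<in> P"
      using e P by (intro asub_sum[OF aP] idl_left[OF iP]) auto
    moreover have "a * 1 - m P * e P \<in> P"
      using e[OF P] m[OF P] asub_diff_commute[OF aP] by (intro idl_diff_mult[OF iP]) auto
    ultimately show ?thesis using asub_diff[OF aP] by (metis diff_diff_add mult.right_neutral)
  qed
  then have "a - s \<in> K" by (rule Inter_PP)
  then have "a - s + s \<in> M" using assms sM by (intro asub_add srng_asub) auto
  then show "a \<in> M" by simp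
qed

lemma maximal_srng_cases:
  assumes "srng M" "M \<noteq> UNIV" "K \<subseteq> M" "\<And>T. srng T \<Longrightarrow> M \<subseteq> T \<Longrightarrow> T = M \<or> T = UNIV"
  obtains P where "P \<in> PP" "P \<subseteq> M"
  | P Q where "P \<in> PP" "Q \<in> PP" "P \<noteq> Q" "graph_type M P Q"
proof (cases "\<forall>P\<in>PP. surj_mod M P")
  case False
  then obtain P where P: "P \<in> PP" "splus M P \<noteq> UNIV" by (auto simp: surj_mod_splus)
  then have "splus M P = M" using assms(1,4) PP_idl PP_asub splus_srng splus_upper1 by metis
  then show ?thesis using that(1)[OF P(1)] splus_upper2[OF srng_asub[OF assms(1)], of P] by simp
next
  case True
  obtain P Q where PQ: "P \<in> PP" "Q \<in> PP" "P \<noteq> Q" "M \<inter> Q \<subseteq> P"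
    using srng_eq_UNIV_crt[OF assms(1,3)] True assms(2) by blast
  have aM: "asub M" and aP: "asub P" and aQ: "asub Q" and iP: "idl P" and iQ: "idl Q"
    using assms(1) PQ by (simp_all add: srng_asub PP_asub PP_idl)
  \<comment> \<open>Otherwise some \<open>n * m\<close> in \<open>M\<close> is 0 at \<open>P\<close>
    and 1 at \<open>Q\<close>. For every \<open>m'\<close> in \<open>M\<close> the element
    \<open>m' * (n * m) - m'\<close> then lies in \<open>M \<inter> Q\<close>, hence in
    \<open>P\<close>; so all of \<open>M\<close> would lie in \<open>P\<close>, although it maps
    onto \<open>R/P\<close>.\<close>
  have "M \<inter> P \<subseteq> Q"
  proof (rule ccontr)
    assume "\<not> M \<inter> P \<subseteq> Q"
    then obtain m where m: "m \<in> M" "m \<in> P" "m \<notin> Q" by blast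
    obtain y where y: "y * m - 1 \<in> Q" using residue_field.inv[OF PP_rf[OF PQ(2)] m(3)] by blast
    obtain n where n: "n \<in> M" "y - n \<in> Q" using True PQ(2) unfolding surj_mod_def by blast
    have "n * m - y * m \<in> Q"
      using idl_right[OF iQ asub_diff_commute[OF aQ n(2)], of m] by (simp add: left_diff_distrib)
    then have nm: "n * m - 1 \<in> Q" using y asub_diff_trans[OF aQ] by blast
    have "m' \<in> P" if "m' \<in> M" for m'
    proof -
      have "m' * (n * m) - m' \<in> Q" using idl_left[OF iQ nm, of m'] by (simp add: right_diff_distrib)
      moreover have "m' * (n * m) - m' \<in> M" using that n m assms(1) aM by (intro asub_diff srng_mult)
      ultimately have "m' * (n * m) - m' \<in> P" using PQ(4) by blast
      moreover have "m' * (n * m) \<in> P" using m iP by (simp add: idl_left)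
      ultimately show ?thesis using asub_diff_mem[OF aP] by blast
    qed
    moreover obtain u where "u \<in> M" "1 - u \<in> P" using True PQ(1) unfolding surj_mod_def by blast
    ultimately have "1 \<in> P" using asub_diff_mem[OF aP] by blast
    then show False using residue_field.one_notin[OF PP_rf[OF PQ(1)]] by blast
  qed
  then have eq: "M \<inter> P = M \<inter> Q" using PQ(4) by blast
  have "P \<inter> Q \<subseteq> M"
  proof -
    \<comment> \<open>An element of \<open>P\<close> outside \<open>Q\<close> is not reached: its
      component in \<open>M\<close> would lie in \<open>M \<inter> P = M \<inter> Q\<close>.\<close>
    have "splus M (P \<inter> Q) \<noteq> UNIV"
    proof
      assume "splus M (P \<inter> Q) = UNIV"
      moreover obtain z where z: "z \<in> P" "z \<notin> Q" using PP_subset_eq[OF PQ(1,2)] PQ(3) by blast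
      ultimately have "z \<in> splus M (P \<inter> Q)" by simp
      then obtain m t where "z = m + t" "m \<in> M" "t \<in> P \<inter> Q" by (rule splusE)
      then have "m \<in> P" using z asub_diff[OF aP, of z t] by simp
      then have "m \<in> Q" using eq \<open>m \<in> M\<close> by blast
      then show False using z \<open>z = m + t\<close> \<open>t \<in> P \<inter> Q\<close> asub_add[OF aQ] by simp
    qed
    moreover have "srng (splus M (P \<inter> Q))" using assms(1) iP iQ by (simp add: splus_srng idl_Int)
    moreover have "M \<subseteq> splus M (P \<inter> Q)" using aP aQ by (simp add: splus_upper1 asub_Int)
    ultimately have "splus M (P \<inter> Q) = M" using assms(4) by blast
    then show ?thesis using splus_upper2[OF aM, of "P \<inter> Q"] by simp
  qed
  then have "graph_type M P Q" using eq True PQ by (simp add: graph_type_def)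
  then show ?thesis using that(2) PQ by blast
qed

text \<open>Modulo \<open>K\<close> this ideal is the factor of the product that belongs to
  \<open>P\<close>. If \<open>P\<close> is the only coordinate, it is \<open>UNIV\<close>.\<close>

definition compl :: "'a set \<Rightarrow> 'a set" where
  "compl P = \<Inter>(PP - {P})"

lemma compl_idl: "idl (compl P)"
  unfolding compl_def by (rule idl_Inter) (simp add: PP_idl)

lemma compl_surj: "P \<in> PP \<Longrightarrow> surj_mod (compl P) P"
proof -
  assume P: "P \<in> PP"
  have "\<exists>e\<in>UNIV. e - 1 \<in> P \<and> (\<forall>Q\<in>PP - {P}. e \<in> Q)"
  proof (rule separate)
    show "surj_mod UNIV P" unfolding surj_mod_def
      using asub_0[OF PP_asub[OF P]] by (metis UNIV_I diff_self)
    show "\<And>Q. Q \<in> PP - {P} \<Longrightarrow> \<not> UNIV \<inter> Q \<subseteq> P" using PP_subset_eq P by blast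
  qed (use P finite_PP idl_srng[OF idl_UNIV] in auto)
  then obtain e where e: "e - 1 \<in> P" "e \<in> compl P" unfolding compl_def by blast
  have "a - a * e \<in> P" for a
    using idl_left[OF PP_idl[OF P] asub_diff_commute[OF PP_asub[OF P] e(1)], of a] by (simp add: right_diff_distrib)
  then show ?thesis using e(2) idl_left[OF compl_idl] unfolding surj_mod_def by blast
qed

lemma compl_larger: "P \<in> PP \<Longrightarrow> K \<subset> compl P"
proof -
  assume P: "P \<in> PP"
  obtain e where e: "e \<in> compl P" "1 - e \<in> P" using compl_surj[OF P] unfolding surj_mod_def by blast
  have "e \<notin> K" using e asub_diff_mem[OF PP_asub[OF P] e(2)] PP_K[OF P] residue_field.one_notin[OF PP_rf[OF P]] by blast
  moreover have "K \<subseteq> compl P" unfolding compl_def using PP_K by blast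
  ultimately show ?thesis using e by blast
qed

end

section \<open>Counting residues\<close>

text \<open>\<open>M \<inter> M'\<close> has an element congruent to the generator \<open>u\<close>,
  so it maps onto \<open>R/P\<close>. Hence \<open>m\<close> differs from an element of
  \<open>M \<inter> M'\<close> by some \<open>t\<close> in \<open>M \<inter> P\<close>, and such a
  \<open>t\<close> lies in \<open>P \<inter> Q\<close>, which is part of \<open>M'\<close>.\<close>

lemma graph_type_subset:
  assumes "srng M" "srng M'" "idl P" "graph_type M P Q" "graph_type M' P Q"
    and u: "\<And>S. srng S \<Longrightarrow> P \<subseteq> S \<Longrightarrow> u \<in> S \<Longrightarrow> S = UNIV"
    and y: "y \<in> M" "y \<in> M'" "y - u \<in> P"
  shows "M \<subseteq> M'"
proof
  fix m assume m: "m \<in> M"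
  have aP: "asub P" using assms(3) by (rule idl_asub)
  have aMM: "asub (M \<inter> M')" using assms(1,2) by (simp add: asub_Int srng_asub)
  have "y + (u - y) \<in> splus (M \<inter> M') P" using y asub_diff_commute[OF aP y(3)] by (intro splusI) auto
  then have "splus (M \<inter> M') P = UNIV"
    using u[of "splus (M \<inter> M') P"] assms(1-3) splus_upper2[OF aMM] by (simp add: splus_srng srng_Int)
  then have "m \<in> splus (M \<inter> M') P" by simp
  then obtain s t where st: "m = s + t" "s \<in> M \<inter> M'" "t \<in> P" by (rule splusE)
  have "t \<in> M" using asub_diff[OF srng_asub[OF assms(1)] m, of s] st by simp
  then have "t \<in> M'" using st(3) assms(4,5) unfolding graph_type_def by blast
  then show "m \<in> M'" using st srng_asub[OF assms(2)] by (simp add: asub_add)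
qed

locale critical_cover = critical K J for K J :: "'a::ring_1 set" +
  fixes C :: "'a set set"
  assumes finite_C: "finite C" and card_C: "card C \<le> 13" and cover: "\<Union>C = UNIV"
    and C_srng: "\<And>M. M \<in> C \<Longrightarrow> srng M" and C_proper: "\<And>M. M \<in> C \<Longrightarrow> M \<noteq> UNIV"
    and C_K: "\<And>M. M \<in> C \<Longrightarrow> K \<subseteq> M"
    and C_max: "\<And>M T. M \<in> C \<Longrightarrow> srng T \<Longrightarrow> M \<subseteq> T \<Longrightarrow> T = M \<or> T = UNIV"
begin

text \<open>The members of the cover that involve the coordinate \<open>P\<close> are those in \<open>KT P\<close>, which restrict it to a
  proper subring, and those in \<open>GT P\<close>, which link it to another coordinate.\<close>

definition KT :: "'a set \<Rightarrow> 'a set set" where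
  "KT P = {M \<in> C. P \<subseteq> M}"

definition GT :: "'a set \<Rightarrow> 'a set set" where
  "GT P = {M \<in> C. \<not> P \<subseteq> M \<and> \<not> compl P \<subseteq> M}"

definition graphs :: "'a set \<Rightarrow> 'a set \<Rightarrow> 'a set set" where
  "graphs P Q = {M \<in> C. graph_type M P Q}"

lemma finite_KT: "finite (KT P)" and finite_GT: "finite (GT P)" and finite_graphs: "finite (graphs P Q)"
  using finite_C by (simp_all add: KT_def GT_def graphs_def)

lemma card_GT_KT: "card (GT P) + card (KT P) \<le> 13"
proof -
  have "card (GT P \<union> KT P) \<le> card C" using finite_C by (intro card_mono) (auto simp: GT_def KT_def)
  moreover have "GT P \<inter> KT P = {}" by (auto simp: GT_def KT_def)
  ultimately show ?thesis using card_Un_disjoint[OF finite_GT finite_KT] card_C by simp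
qed

lemma KT_unique: "P \<in> PP \<Longrightarrow> Q \<in> PP \<Longrightarrow> M \<in> C \<Longrightarrow> P \<subseteq> M \<Longrightarrow> Q \<subseteq> M \<Longrightarrow> P = Q"
proof (rule ccontr)
  assume a: "P \<in> PP" "Q \<in> PP" "M \<in> C" "P \<subseteq> M" "Q \<subseteq> M" "P \<noteq> Q"
  have "splus P Q = P \<or> splus P Q = UNIV"
    using a PP_idl PP_asub PP_rf by (intro residue_field.maximal) (simp_all add: splus_idl splus_upper1)
  moreover have "splus P Q \<noteq> P"
    using splus_upper2[OF PP_asub[OF a(1)], of Q] PP_subset_eq[OF a(2,1)] a(6) by auto
  ultimately show False
    using splus_least[OF srng_asub[OF C_srng[OF a(3)]] a(4,5)] C_proper[OF a(3)] by auto
qed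

lemma compl_subset: "P \<noteq> Q \<Longrightarrow> Q \<in> PP \<Longrightarrow> compl P \<subseteq> Q"
  unfolding compl_def by blast

lemma graph_type_not_subset: "graph_type M P Q \<Longrightarrow> M \<in> C \<Longrightarrow> \<not> P \<subseteq> M"
proof
  assume a: "graph_type M P Q" "M \<in> C" "P \<subseteq> M"
  then have "splus M P \<subseteq> M" using splus_least[OF srng_asub[OF C_srng[OF a(2)]] subset_refl] by blast
  then show False using a C_proper[OF a(2)] by (auto simp: graph_type_def surj_mod_splus)
qed

lemma GT_cases:
  assumes "P \<in> PP" "M \<in> GT P"
  obtains Q where "Q \<in> PP" "Q \<noteq> P" "graph_type M P Q"
proof -
  have M: "M \<in> C" "\<not> P \<subseteq> M" "\<not> compl P \<subseteq> M" using assms by (simp_all add: GT_def)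
  show ?thesis
  proof (rule maximal_srng_cases[OF C_srng[OF M(1)] C_proper[OF M(1)] C_K[OF M(1)] C_max[OF M(1)]])
    fix Q assume "Q \<in> PP" "Q \<subseteq> M"
    then have "P = Q \<or> compl P \<subseteq> M" using compl_subset[of P Q] by blast
    then show ?thesis using M \<open>Q \<subseteq> M\<close> by blast
  next
    fix Q R assume QR: "Q \<in> PP" "R \<in> PP" "Q \<noteq> R" "graph_type M Q R"
    have "P = Q \<or> P = R"
    proof (rule ccontr)
      assume "\<not> (P = Q \<or> P = R)"
      then have "compl P \<subseteq> Q \<inter> R" using compl_subset QR by simp
      then show False using M(3) QR(4) by (auto simp: graph_type_def)
    qed
    then show ?thesis using that QR graph_type_sym by blast
  qed
qed

text \<open>By smallness of the quotient some \<open>x\<close> is missed by all members that contain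
  \<open>compl P\<close>. The coset of \<open>x\<close> modulo \<open>compl P\<close> meets every
  residue class modulo \<open>P\<close>, and a graph meets it in one class only: two of its elements
  there differ by an element of \<open>M \<inter> Q\<close>, which lies in \<open>P\<close>.\<close>

lemma residue_count:
  assumes P: "P \<in> PP"
  shows "idx P UNIV \<le> card (coset P ` \<Union>(KT P)) + card (GT P)"
proof -
  have aP: "asub P" using P by (rule PP_asub)
  have fin: "finite (coset P ` S)" for S using residue_field.fin_image[OF PP_rf[OF P]] .
  let ?C' = "{M \<in> C. compl P \<subseteq> M}"
  have "\<Union>?C' \<noteq> UNIV"
  proof
    assume "\<Union>?C' = UNIV"
    moreover have "card ?C' \<le> 13" using card_mono[OF finite_C, of ?C'] card_C by auto
    ultimately have "cov (compl P) 13" unfolding cov_def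
      using finite_C C_srng C_proper by (intro exI[of _ ?C']) simp
    then show False using not_cov_larger[OF compl_idl compl_larger[OF P]] by blast
  qed
  then obtain x where x: "\<And>M. M \<in> C \<Longrightarrow> compl P \<subseteq> M \<Longrightarrow> x \<notin> M" by auto
  define g where "g M = coset P (SOME y. y \<in> M \<and> y - x \<in> compl P)" for M
  have "coset P a \<in> coset P ` \<Union>(KT P) \<union> g ` GT P" for a
  proof -
    obtain i where i: "i \<in> compl P" "(a - x) - i \<in> P" using compl_surj[OF P] unfolding surj_mod_def by blast
    then have ca: "coset P a = coset P (x + i)" using aP by (simp add: coset_eq algebra_simps)
    obtain M where M: "M \<in> C" "x + i \<in> M" using cover by blast
    have "\<not> compl P \<subseteq> M"
    proof
      assume "compl P \<subseteq> M"
      then have "x + i - i \<in> M" using M i by (intro asub_diff srng_asub C_srng) auto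
      then show False using x[OF M(1) \<open>compl P \<subseteq> M\<close>] by simp
    qed
    show ?thesis
    proof (cases "P \<subseteq> M")
      case True
      then have "x + i \<in> \<Union>(KT P)" using M by (auto simp: KT_def)
      then show ?thesis unfolding ca by blast
    next
      case False
      then have MG: "M \<in> GT P" using M \<open>\<not> compl P \<subseteq> M\<close> by (simp add: GT_def)
      define y where "y = (SOME y. y \<in> M \<and> y - x \<in> compl P)"
      have y: "y \<in> M \<and> y - x \<in> compl P" unfolding y_def by (rule someI[of _ "x + i"]) (simp add: M i)
      obtain Q where Q: "Q \<in> PP" "Q \<noteq> P" "graph_type M P Q" using GT_cases[OF P MG] by blast
      have "i - (y - x) \<in> compl P" using asub_diff[OF idl_asub[OF compl_idl] i(1)] y by blast
      then have "(x + i) - y \<in> Q" using compl_subset[of P Q] Q by (auto simp: algebra_simps)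
      moreover have "(x + i) - y \<in> M" using M y by (intro asub_diff srng_asub C_srng) auto
      ultimately have "(x + i) - y \<in> P" using Q(3) by (auto simp: graph_type_def)
      then have "coset P a = g M" unfolding ca g_def y_def[symmetric] using aP by (simp add: coset_eq)
      then show ?thesis using MG by blast
    qed
  qed
  then have "range (coset P) \<subseteq> coset P ` \<Union>(KT P) \<union> g ` GT P" by blast
  then have "idx P UNIV \<le> card (coset P ` \<Union>(KT P) \<union> g ` GT P)"
    using finite_GT fin by (intro card_mono) simp_all
  also have "\<dots> \<le> card (coset P ` \<Union>(KT P)) + card (g ` GT P)" by (rule card_Un_le)
  also have "card (g ` GT P) \<le> card (GT P)" by (rule card_image_le[OF finite_GT])
  finally show ?thesis by simp
qed

text \<open>Each member of the cover links at most two coordinates or restricts at most one.\<close>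

lemma incidence_count:
  assumes V: "V \<subseteq> PP"
  shows "(\<Sum>P\<in>V. card (GT P) + 2 * card (KT P)) \<le> 26"
proof -
  have fV: "finite V" using V finite_PP finite_subset by blast
  have swap: "(\<Sum>P\<in>V. card (X P)) = (\<Sum>M\<in>C. card {P \<in> V. M \<in> X P})" if X: "\<And>P. X P \<subseteq> C" for X
  proof -
    have "C \<inter> {M. M \<in> X P} = X P" for P using X by blast
    then have "(\<Sum>P\<in>V. card (X P)) = (\<Sum>P\<in>V. \<Sum>M\<in>C. if M \<in> X P then 1 else 0)"
      using finite_C by (simp add: sum.If_cases)
    also have "\<dots> = (\<Sum>M\<in>C. \<Sum>P\<in>V. if M \<in> X P then 1 else 0)" by (rule sum.swap)
    also have "\<dots> = (\<Sum>M\<in>C. card {P \<in> V. M \<in> X P})"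
      using fV by (simp add: sum.If_cases Int_def)
    finally show ?thesis .
  qed
  have "(\<Sum>P\<in>V. card (GT P)) = (\<Sum>M\<in>C. card {P \<in> V. M \<in> GT P})"
    "(\<Sum>P\<in>V. card (KT P)) = (\<Sum>M\<in>C. card {P \<in> V. M \<in> KT P})"
    by (rule swap; auto simp: GT_def KT_def)+
  then have "(\<Sum>P\<in>V. card (GT P) + 2 * card (KT P))
    = (\<Sum>M\<in>C. card {P \<in> V. M \<in> GT P} + 2 * card {P \<in> V. M \<in> KT P})"
    by (simp add: sum.distrib flip: sum_distrib_left)
  also have "\<dots> \<le> (\<Sum>M\<in>C. 2)"
  proof (rule sum_mono)
    fix M assume M: "M \<in> C"
    show "card {P \<in> V. M \<in> GT P} + 2 * card {P \<in> V. M \<in> KT P} \<le> 2"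
    proof (rule maximal_srng_cases[OF C_srng[OF M] C_proper[OF M] C_K[OF M] C_max[OF M]])
      fix Q assume Q: "Q \<in> PP" "Q \<subseteq> M"
      have "{P \<in> V. M \<in> GT P} = {}" using Q compl_subset[of _ Q] by (auto simp: GT_def)
      then have c0: "card {P \<in> V. M \<in> GT P} = 0" by (simp only: card.empty)
      have "P = Q" if "P \<in> V" "M \<in> KT P" for P
        using that KT_unique[OF subsetD[OF V that(1)] Q(1) M _ Q(2)] by (simp add: KT_def)
      then have "{P \<in> V. M \<in> KT P} \<subseteq> {Q}" by auto
      then have "card {P \<in> V. M \<in> KT P} \<le> card {Q}" by (rule card_mono[rotated]) simp
      then show ?thesis unfolding c0 by simp
    next
      fix Q R assume QR: "Q \<in> PP" "R \<in> PP" "Q \<noteq> R" "graph_type M Q R"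
      have out: "compl P \<subseteq> M" if "P \<noteq> Q" "P \<noteq> R" for P
        using compl_subset[OF that(1) QR(1)] compl_subset[OF that(2) QR(2)] QR(4) by (auto simp: graph_type_def)
      then have "{P \<in> V. M \<in> GT P} \<subseteq> {Q, R}" by (auto simp: GT_def)
      then have "card {P \<in> V. M \<in> GT P} \<le> card {Q, R}" by (rule card_mono[rotated]) simp
      then have 2: "card {P \<in> V. M \<in> GT P} \<le> 2" using card_insert_le_m1[of 2 "{R}" Q] by simp
      have "\<not> P \<subseteq> M" if "P \<in> PP" for P
      proof
        assume PM: "P \<subseteq> M"
        have "P \<noteq> Q" "P \<noteq> R" using graph_type_not_subset[OF QR(4) M] PM
            graph_type_not_subset[OF graph_type_sym[OF QR(4)] M] by auto
        have "P \<inter> Q \<subseteq> R" using PM QR(4) by (auto simp: graph_type_def)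
        then show False using PP_Int_subset[OF that QR(1,2)] \<open>P \<noteq> R\<close> QR(3) by blast
      qed
      then have "M \<notin> KT P" if "P \<in> V" for P using subsetD[OF V that] by (simp add: KT_def)
      then have "{P \<in> V. M \<in> KT P} = {}" by simp
      then have "card {P \<in> V. M \<in> KT P} = 0" by (simp only: card.empty)
      then show ?thesis using 2 by linarith
    qed
  qed
  also have "\<dots> \<le> 26" using card_C by simp
  finally show ?thesis .
qed

text \<open>An isomorphism of residue fields is determined by the image of a generator \<open>u\<close>.\<close>

lemma card_graphs_le:
  assumes P: "P \<in> PP" and Q: "Q \<in> PP"
    and u: "\<And>S. srng S \<Longrightarrow> P \<subseteq> S \<Longrightarrow> u \<in> S \<Longrightarrow> S = UNIV"
    and Z: "\<And>M y. M \<in> C \<Longrightarrow> graph_type M P Q \<Longrightarrow> y \<in> M \<Longrightarrow> y - u \<in> P \<Longrightarrow> y \<in> Z"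
  shows "card (graphs P Q) \<le> idx Q Z"
proof -
  have aP: "asub P" and aQ: "asub Q" using P Q by (simp_all add: PP_asub)
  define y where "y M = (SOME y. y \<in> M \<and> y - u \<in> P)" for M
  have y: "y M \<in> M \<and> y M - u \<in> P" if "graph_type M P Q" for M
  proof -
    have "\<exists>m\<in>M. u - m \<in> P" using that unfolding graph_type_def surj_mod_def by simp
    then obtain m where "m \<in> M" "u - m \<in> P" by blast
    then have "m \<in> M \<and> m - u \<in> P" using asub_diff_commute[OF aP] by blast
    then show ?thesis unfolding y_def by (rule someI)
  qed
  show ?thesis
  proof (rule card_inj_on_le)
    show "inj_on (\<lambda>M. coset Q (y M)) (graphs P Q)"
    proof (rule inj_onI)
      fix M M' assume M: "M \<in> graphs P Q" "M' \<in> graphs P Q" and "coset Q (y M) = coset Q (y M')"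
      then have d: "y M - y M' \<in> Q" using aQ by (simp add: coset_eq)
      have g: "M \<in> C" "M' \<in> C" "graph_type M P Q" "graph_type M' P Q" using M by (simp_all add: graphs_def)
      have "y M - y M' \<in> P" using asub_diff[OF aP, of "y M - u" "y M' - u"] y g by simp
      then have "y M - y M' \<in> M" "y M - y M' \<in> M'" using d g(3,4) by (auto simp: graph_type_def)
      then have m: "y M' \<in> M" using asub_diff_mem[OF srng_asub[OF C_srng[OF g(1)]]] y[OF g(3)] by blast
      note s = C_srng[OF g(1)] C_srng[OF g(2)]
      show "M = M'"
        using graph_type_subset[OF s PP_idl[OF P] g(3,4) u m] graph_type_subset[OF s(2,1) PP_idl[OF P] g(4,3) u _ m]
          y[OF g(4)] by blast
    qed
    show "(\<lambda>M. coset Q (y M)) ` graphs P Q \<subseteq> coset Q ` Z"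
      using y Z by (auto simp: graphs_def)
    show "finite (coset Q ` Z)" by (rule residue_field.fin_image[OF PP_rf[OF Q]])
  qed
qed

definition V :: "nat \<Rightarrow> 'a set set" where
  "V q = {P \<in> PP. idx P UNIV = q}"

lemma finite_V: "finite (V q)"
  using finite_PP by (simp add: V_def)

lemma V_PP: "V q \<subseteq> PP"
  by (auto simp: V_def)

text \<open>A graph links fields of equal size, so only the other elements of \<open>V q\<close> can
  be partners of \<open>P\<close>.\<close>

lemma card_GT_le:
  assumes P: "P \<in> V q" and m: "\<And>Q. Q \<in> V q \<Longrightarrow> Q \<noteq> P \<Longrightarrow> card (graphs P Q) \<le> m"
  shows "card (GT P) \<le> m * (card (V q) - 1)"
proof -
  have PP: "P \<in> PP" using P by (simp add: V_def)
  have "GT P \<subseteq> (\<Union>Q\<in>V q - {P}. graphs P Q)"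
  proof
    fix M assume M: "M \<in> GT P"
    then obtain Q where Q: "Q \<in> PP" "Q \<noteq> P" "graph_type M P Q" using GT_cases[OF PP] by blast
    have MC: "M \<in> C" using M by (simp add: GT_def)
    have "Q \<in> V q" using graph_type_idx[OF C_srng[OF MC] PP_rf[OF PP] PP_rf[OF Q(1)] Q(3)] Q(1) P by (simp add: V_def)
    then show "M \<in> (\<Union>Q\<in>V q - {P}. graphs P Q)" using Q MC by (auto simp: graphs_def)
  qed
  then have "card (GT P) \<le> card (\<Union>Q\<in>V q - {P}. graphs P Q)"
    using finite_V finite_graphs by (intro card_mono) auto
  also have "\<dots> \<le> (\<Sum>Q\<in>V q - {P}. card (graphs P Q))" using finite_V by (intro card_UN_le) simp
  also have "\<dots> \<le> (\<Sum>Q\<in>V q - {P}. m)" using m by (intro sum_mono) simp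
  also have "\<dots> = m * (card (V q) - 1)" using finite_V P by simp
  finally show ?thesis .
qed

text \<open>A finite field has at most one subring of each cardinality, so the cardinalities of the subrings involved
  are distinct powers of \<open>p\<close>, with squares at most \<open>p ^ n\<close>.\<close>

lemma KT_residues:
  assumes P: "P \<in> PP" and p: "prime p" "\<And>S. asub S \<Longrightarrow> P \<subseteq> S \<Longrightarrow> \<exists>m. idx P S = p ^ m"
    and n: "idx P UNIV = p ^ n"
  shows "card (coset P ` \<Union>(KT P)) \<le> 1 + (\<Sum>m\<le>n div 2. p ^ m - 1)"
proof -
  interpret residue_field P using P by (rule PP_rf)
  have mem: "srng M" "P \<subseteq> M" "M \<noteq> UNIV" if "M \<in> KT P" for M
    using that C_srng C_proper by (auto simp: KT_def)
  have sub: "coset P ` \<Union>(KT P) \<subseteq> insert (coset P 0) (\<Union>M\<in>KT P. coset P ` (M - P))"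
    using coset_eq_0 by blast
  have c: "card (coset P ` (M - P)) = idx P M - 1" if "M \<in> KT P" for M
  proof -
    have "coset P 0 \<in> coset P ` M" using asub_0[OF srng_asub[OF mem(1)[OF that]]] by blast
    then show ?thesis by (simp add: image_minus card_Diff_singleton)
  qed
  have inj: "inj_on (idx P) (KT P)"
    using srng_eqI_idx mem by (meson inj_onI)
  have img: "idx P ` KT P \<subseteq> (\<lambda>m. p ^ m) ` {..n div 2}"
  proof (rule image_subsetI)
    fix M assume M: "M \<in> KT P"
    obtain m where m: "idx P M = p ^ m" using p(2) mem[OF M] srng_asub by blast
    have "(p ^ m) ^ 2 \<le> p ^ n" using idx_proper_srng[OF mem[OF M]] m n by simp
    then have "p ^ (m * 2) \<le> p ^ n" by (simp add: power_mult)
    then have "m * 2 \<le> n" using prime_gt_1_nat[OF p(1)] power_le_imp_le_exp by blast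
    then show "idx P M \<in> (\<lambda>m. p ^ m) ` {..n div 2}" using m by auto
  qed
  have injp: "inj_on (\<lambda>m. p ^ m) {..n div 2}"
    using prime_gt_1_nat[OF p(1)] by (auto intro!: inj_onI dest: power_inject_exp[THEN iffD1, rotated])
  have "card (coset P ` \<Union>(KT P)) \<le> card (insert (coset P 0) (\<Union>M\<in>KT P. coset P ` (M - P)))"
    using fin_image finite_KT by (intro card_mono[OF _ sub]) simp
  also have "\<dots> \<le> 1 + card (\<Union>M\<in>KT P. coset P ` (M - P))"
    by (simp add: card_insert_le_m1)
  also have "card (\<Union>M\<in>KT P. coset P ` (M - P)) \<le> (\<Sum>M\<in>KT P. card (coset P ` (M - P)))"
    by (rule card_UN_le[OF finite_KT])
  also have "\<dots> = (\<Sum>l\<in>idx P ` KT P. l - 1)"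
    by (simp add: sum.reindex[OF inj] c)
  also have "\<dots> \<le> (\<Sum>l\<in>(\<lambda>m. p ^ m) ` {..n div 2}. l - 1)"
    by (intro sum_mono2 img) simp_all
  also have "\<dots> = (\<Sum>m\<le>n div 2. p ^ m - 1)" by (simp add: sum.reindex[OF injp])
  finally show ?thesis by simp
qed

end

section \<open>Small covers\<close>

lemma idx_le_card_reps:
  assumes "asub L" "finite W" "\<And>z. z \<in> S \<Longrightarrow> \<exists>v\<in>W. z - v \<in> L"
  shows "idx L S \<le> card W"
proof -
  have "coset L ` S \<subseteq> coset L ` W"
    using assms(3) coset_eq[OF assms(1)] by blast
  then show ?thesis using surj_card_le[OF assms(2)] by blast
qed

lemma idx_Int_le:
  assumes "finite (coset P ` S)" "finite (coset Q ` S)"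
  shows "idx (P \<inter> Q) S \<le> idx P S * idx Q S"
proof -
  have "coset (P \<inter> Q) x = coset P x \<inter> coset Q x" for x by (auto simp: coset_def)
  then have "coset (P \<inter> Q) ` S \<subseteq> (\<lambda>(A, B). A \<inter> B) ` (coset P ` S \<times> coset Q ` S)" by force
  then have "idx (P \<inter> Q) S \<le> card (coset P ` S \<times> coset Q ` S)"
    using assms by (intro surj_card_le) simp_all
  then show ?thesis by (simp add: card_cartesian_product)
qed

text \<open>Reduction from the quotient by \<open>P \<inter> Q\<close> to the quotient by
  \<open>P\<close> is not injective. Later this shows that a subring with at most as many classes
  modulo \<open>P \<inter> Q\<close> as \<open>R/P\<close> has elements is proper.\<close>

lemma idx_Int_gt:
  assumes "residue_field P" "residue_field Q" "\<not> P \<subseteq> Q"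
  shows "idx P UNIV < idx (P \<inter> Q) UNIV"
proof (rule ccontr)
  interpret P: residue_field P by fact
  interpret Q: residue_field Q by fact
  assume "\<not> idx P UNIV < idx (P \<inter> Q) UNIV"
  define h where "h B = coset P (SOME x. x \<in> B)" for B
  have aL: "asub (P \<inter> Q)" using P.asub Q.asub by (rule asub_Int)
  have h: "h (coset (P \<inter> Q) x) = coset P x" for x
  proof -
    have "(SOME y. y \<in> coset (P \<inter> Q) x) \<in> coset (P \<inter> Q) x"
      using coset_self[OF aL] by (rule someI)
    then show ?thesis unfolding h_def by (subst coset_eq[OF P.asub]) (simp add: coset_def)
  qed
  let ?A = "range (coset (P \<inter> Q))"
  have fin: "finite ?A" using fin_ix_Int[OF P.fin Q.fin] by (simp add: fin_ix_def)
  have "h ` ?A = range (coset P)" using h by (simp add: image_image)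
  then have "card (h ` ?A) = card ?A"
    using \<open>\<not> idx P UNIV < idx (P \<inter> Q) UNIV\<close> card_image_le[OF fin, of h] by simp
  then have inj: "inj_on h ?A" using fin by (simp add: eq_card_imp_inj_on)
  obtain z where z: "z \<in> P" "z \<notin> Q" using assms(3) by blast
  have "h (coset (P \<inter> Q) z) = h (coset (P \<inter> Q) 0)" unfolding h using z by (simp add: P.coset_eq_0)
  then have "coset (P \<inter> Q) z = coset (P \<inter> Q) 0" using inj by (simp add: inj_on_eq_iff)
  then show False using z coset_eq[OF aL] by simp
qed

section \<open>Subrings generated by 1 and at most one further element\<close>

definition ints_mod :: "'a::ring_1 set \<Rightarrow> 'a set" where
  "ints_mod L = {z. \<exists>c. z - of_int c \<in> L}"

text \<open>Meant for roots of \<open>X ^ 2 + X + 1\<close>, which generate the field with 4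
  elements; \<open>span2\<close> serves roots of \<open>X ^ 3 + X + 1\<close> and the field with 8
  elements. Integer coefficients stand in for the prime field.\<close>

definition span1 :: "'a::ring_1 set \<Rightarrow> 'a \<Rightarrow> 'a set" where
  "span1 L y = {z. \<exists>c d. z - (of_int c + of_int d * y) \<in> L}"

definition span2 :: "'a::ring_1 set \<Rightarrow> 'a \<Rightarrow> 'a set" where
  "span2 L y = {z. \<exists>c d e. z - (of_int c + of_int d * y + of_int e * y ^ 2) \<in> L}"

lemma ints_mod_srng:
  assumes "idl L"
  shows "srng (ints_mod L)"
proof (intro srngI asubI)
  show "0 \<in> ints_mod L" unfolding ints_mod_def
    using asub_0[OF idl_asub[OF assms]] by (intro CollectI exI[of _ 0]) simp
  fix x y assume "x \<in> ints_mod L" "y \<in> ints_mod L"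
  then obtain c d where cd: "x - of_int c \<in> L" "y - of_int d \<in> L" unfolding ints_mod_def by blast
  have "(x - y) - of_int (c - d) \<in> L" using asub_diff[OF idl_asub[OF assms] cd] by (simp add: algebra_simps)
  then show "x - y \<in> ints_mod L" unfolding ints_mod_def by blast
  have "x * y - of_int (c * d) \<in> L" using idl_diff_mult[OF assms cd] by simp
  then show "x * y \<in> ints_mod L" unfolding ints_mod_def by blast
qed

lemma ints_mod_upper: "L \<subseteq> ints_mod L"
  unfolding ints_mod_def by (auto intro!: exI[of _ 0])

lemma ints_mod_one: "asub L \<Longrightarrow> 1 \<in> ints_mod L"
  unfolding ints_mod_def by (auto intro!: exI[of _ 1] simp: asub_0)

text \<open>Closure under left multiplication by \<open>y\<close> suffices, and there
  \<open>y * y\<close> is replaced by \<open>- y - 1\<close>.\<close>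

lemma span1_srng:
  assumes L: "idl L" and y: "y * y + y + 1 \<in> L"
  shows "srng (span1 L y)"
proof -
  have aL: "asub L" using L by (rule idl_asub)
  have LS: "L \<subseteq> span1 L y" unfolding span1_def by (auto intro!: exI[of _ 0])
  have aS: "asub (span1 L y)"
  proof (rule asubI)
    show "0 \<in> span1 L y" using LS asub_0[OF aL] by blast
    fix u v assume "u \<in> span1 L y" "v \<in> span1 L y"
    then obtain c d c' d' where "u - (of_int c + of_int d * y) \<in> L" "v - (of_int c' + of_int d' * y) \<in> L"
      unfolding span1_def by blast
    from asub_diff[OF aL this] have "(u - v) - (of_int (c - c') + of_int (d - d') * y) \<in> L"
      by (simp add: algebra_simps)
    then show "u - v \<in> span1 L y" unfolding span1_def by blast
  qed
  have com: "y * (of_int c * z) = of_int c * (y * z)" for c z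
    by (metis mult.assoc mult_of_int_commute)
  have yS: "y * v \<in> span1 L y" if "v \<in> span1 L y" for v
  proof -
    obtain c d where v: "v - (of_int c + of_int d * y) \<in> L" using \<open>v \<in> span1 L y\<close> unfolding span1_def by blast
    have "y * (v - (of_int c + of_int d * y)) + of_int d * (y * y + y + 1) \<in> L"
      using idl_left[OF L v] idl_left[OF L y] by (rule asub_add[OF aL])
    moreover have "y * (v - (of_int c + of_int d * y)) + of_int d * (y * y + y + 1)
      = y * v - (of_int (- d) + of_int (c - d) * y)"
      by (simp add: algebra_simps com mult_of_int_commute[symmetric])
    ultimately show ?thesis unfolding span1_def by (metis (mono_tags, lifting) mem_Collect_eq)
  qed
  show ?thesis
  proof (rule srngI[OF aS])
    fix u v assume u: "u \<in> span1 L y" and v: "v \<in> span1 L y"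
    obtain c d where cd: "u - (of_int c + of_int d * y) \<in> L" using u unfolding span1_def by blast
    have "(u - (of_int c + of_int d * y)) * v + of_int c * v + of_int d * (y * v) \<in> span1 L y"
      using idl_right[OF L cd] LS asub_of_int_mult[OF aS] v yS[OF v] by (intro asub_add[OF aS]) blast+
    then show "u * v \<in> span1 L y" by (simp add: algebra_simps)
  qed
qed

lemma span2_srng:
  assumes L: "idl L" and y: "y ^ 3 + y + 1 \<in> L"
  shows "srng (span2 L y)"
proof -
  have aL: "asub L" using L by (rule idl_asub)
  have LS: "L \<subseteq> span2 L y" unfolding span2_def by (auto intro!: exI[of _ 0])
  have aS: "asub (span2 L y)"
  proof (rule asubI)
    show "0 \<in> span2 L y" using LS asub_0[OF aL] by blast
    fix u v assume "u \<in> span2 L y" "v \<in> span2 L y"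
    then obtain c d e c' d' e' where "u - (of_int c + of_int d * y + of_int e * y ^ 2) \<in> L"
      "v - (of_int c' + of_int d' * y + of_int e' * y ^ 2) \<in> L"
      unfolding span2_def by blast
    from asub_diff[OF aL this]
    have "(u - v) - (of_int (c - c') + of_int (d - d') * y + of_int (e - e') * y ^ 2) \<in> L"
      by (simp add: algebra_simps)
    then show "u - v \<in> span2 L y" unfolding span2_def by blast
  qed
  have com: "y * (of_int c * z) = of_int c * (y * z)" for c z
    by (metis mult.assoc mult_of_int_commute)
  have yS: "y * v \<in> span2 L y" if "v \<in> span2 L y" for v
  proof -
    obtain c d e where v: "v - (of_int c + of_int d * y + of_int e * y ^ 2) \<in> L"
      using \<open>v \<in> span2 L y\<close> unfolding span2_def by blast
    have "y * (v - (of_int c + of_int d * y + of_int e * y ^ 2)) + of_int e * (y ^ 3 + y + 1) \<in> L"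
      using idl_left[OF L v] idl_left[OF L y] by (rule asub_add[OF aL])
    moreover have "y * (v - (of_int c + of_int d * y + of_int e * y ^ 2)) + of_int e * (y ^ 3 + y + 1)
      = y * v - (of_int (- e) + of_int (c - e) * y + of_int d * y ^ 2)"
      by (simp add: algebra_simps com mult_of_int_commute[symmetric] power2_eq_square power3_eq_cube)
    ultimately show ?thesis unfolding span2_def by (metis (mono_tags, lifting) mem_Collect_eq)
  qed
  show ?thesis
  proof (rule srngI[OF aS])
    fix u v assume u: "u \<in> span2 L y" and v: "v \<in> span2 L y"
    obtain c d e where cd: "u - (of_int c + of_int d * y + of_int e * y ^ 2) \<in> L"
      using u unfolding span2_def by blast
    have "(u - (of_int c + of_int d * y + of_int e * y ^ 2)) * v + of_int c * v + of_int d * (y * v)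
        + of_int e * (y * (y * v)) \<in> span2 L y"
      using idl_right[OF L cd] LS asub_of_int_mult[OF aS] v yS[OF v] yS[OF yS[OF v]]
      by (intro asub_add[OF aS]) blast+
    then show "u * v \<in> span2 L y" by (simp add: algebra_simps power2_eq_square)
  qed
qed

lemma span1_cong:
  assumes L: "idl L" and y: "y - y' \<in> L"
  shows "span1 L y = span1 L y'"
proof -
  have "z - (of_int c + of_int d * y) \<in> L \<longleftrightarrow> z - (of_int c + of_int d * y') \<in> L" for z c d
  proof (rule asub_diff_mem[OF idl_asub[OF L]])
    have "of_int d * (y' - y) \<in> L"
      by (rule idl_left[OF L asub_diff_commute[OF idl_asub[OF L] y]])
    then show "z - (of_int c + of_int d * y) - (z - (of_int c + of_int d * y')) \<in> L"
      by (simp add: algebra_simps)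
  qed
  then show ?thesis by (simp add: span1_def)
qed

lemma span2_cong:
  assumes L: "idl L" and y: "y - y' \<in> L"
  shows "span2 L y = span2 L y'"
proof -
  have aL: "asub L" using L by (rule idl_asub)
  have "z - (of_int c + of_int d * y + of_int e * y ^ 2) \<in> L \<longleftrightarrow>
    z - (of_int c + of_int d * y' + of_int e * y' ^ 2) \<in> L" for z c d e
  proof (rule asub_diff_mem[OF aL])
    have "of_int d * (y' - y) + of_int e * (y' ^ 2 - y ^ 2) \<in> L"
      using asub_diff_commute[OF aL y] idl_diff_power[OF L asub_diff_commute[OF aL y], of 2] L
      by (intro asub_add[OF aL] idl_left)
    then show "z - (of_int c + of_int d * y + of_int e * y ^ 2) - (z - (of_int c + of_int d * y' + of_int e * y' ^ 2)) \<in> L"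
      by (simp add: algebra_simps)
  qed
  then show ?thesis by (simp add: span2_def)
qed

lemma of_int_mod_mem:
  assumes L: "idl L" and p: "of_nat p \<in> L"
  shows "of_int c - of_int (c mod int p) \<in> L"
proof -
  have "c - c mod int p = (c div int p) * int p" by (simp add: minus_mod_eq_div_mult)
  then have "of_int (c - c mod int p) = of_int (c div int p) * (of_nat p :: 'a)" by simp
  then show ?thesis using idl_left[OF L p, of "of_int (c div int p)"] by simp
qed

lemma idx_ints_mod:
  assumes L: "idl L" and p: "of_nat p \<in> L" "0 < p"
  shows "idx L (ints_mod L) \<le> p"
proof -
  have aL: "asub L" using L by (rule idl_asub)
  have "idx L (ints_mod L) \<le> card ((of_int :: int \<Rightarrow> 'a) ` {0..<int p})"
  proof (rule idx_le_card_reps[OF aL])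
    fix z assume "z \<in> ints_mod L"
    then obtain c where "z - of_int c \<in> L" unfolding ints_mod_def by blast
    then have "z - of_int (c mod int p) \<in> L" using of_int_mod_mem[OF L p(1)] by (rule asub_diff_trans[OF aL])
    moreover have "c mod int p \<in> {0..<int p}" using p(2) by simp
    ultimately show "\<exists>v\<in>of_int ` {0..<int p}. z - v \<in> L" by blast
  qed simp
  also have "\<dots> \<le> card {0..<int p}" by (rule card_image_le) simp
  finally show ?thesis by simp
qed

lemma idx_span1:
  assumes L: "idl L" and p: "of_nat p \<in> L" "0 < p"
  shows "idx L (span1 L y) \<le> p * p"
proof -
  have aL: "asub L" using L by (rule idl_asub)
  let ?I = "{0..<int p}" and ?f = "\<lambda>(c, d). of_int c + of_int d * y"
  have "idx L (span1 L y) \<le> card (?f ` (?I \<times> ?I))"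
  proof (rule idx_le_card_reps[OF aL])
    fix z assume "z \<in> span1 L y"
    then obtain c d where z: "z - (of_int c + of_int d * y) \<in> L" unfolding span1_def by blast
    have "of_int d * y - of_int (d mod int p) * y \<in> L"
      using idl_right[OF L of_int_mod_mem[OF L p(1)], of d y] by (simp add: left_diff_distrib)
    then have "z - (of_int (c mod int p) + of_int (d mod int p) * y) \<in> L"
      using z of_int_mod_mem[OF L p(1)] by (intro asub_diff_trans[OF aL z] idl_diff_add[OF aL])
    moreover have "c mod int p \<in> ?I" "d mod int p \<in> ?I" using p(2) by simp_all
    ultimately show "\<exists>v\<in>?f ` (?I \<times> ?I). z - v \<in> L"
      by (intro bexI[of _ "?f (c mod int p, d mod int p)"] imageI) simp_all
  qed simp
  also have "\<dots> \<le> card (?I \<times> ?I)" by (rule card_image_le) simp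
  finally show ?thesis by (simp add: card_cartesian_product)
qed

lemma idx_span2:
  assumes L: "idl L" and p: "of_nat p \<in> L" "0 < p"
  shows "idx L (span2 L y) \<le> p * p * p"
proof -
  have aL: "asub L" using L by (rule idl_asub)
  let ?I = "{0..<int p}" and ?f = "\<lambda>((c, d), e). of_int c + of_int d * y + of_int e * y ^ 2"
  have "idx L (span2 L y) \<le> card (?f ` ((?I \<times> ?I) \<times> ?I))"
  proof (rule idx_le_card_reps[OF aL])
    fix z assume "z \<in> span2 L y"
    then obtain c d e where z: "z - (of_int c + of_int d * y + of_int e * y ^ 2) \<in> L" unfolding span2_def by blast
    have m: "of_int d * w - of_int (d mod int p) * w \<in> L" for d w
      using idl_right[OF L of_int_mod_mem[OF L p(1)], of d w] by (simp add: left_diff_distrib)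
    then have "z - (of_int (c mod int p) + of_int (d mod int p) * y + of_int (e mod int p) * y ^ 2) \<in> L"
      using of_int_mod_mem[OF L p(1)] by (intro asub_diff_trans[OF aL z] idl_diff_add[OF aL])
    moreover have "c mod int p \<in> ?I" "d mod int p \<in> ?I" "e mod int p \<in> ?I" using p(2) by simp_all
    ultimately show "\<exists>v\<in>?f ` ((?I \<times> ?I) \<times> ?I). z - v \<in> L"
      by (intro bexI[of _ "?f ((c mod int p, d mod int p), e mod int p)"] imageI) simp_all
  qed simp
  also have "\<dots> \<le> card ((?I \<times> ?I) \<times> ?I)" by (rule card_image_le) simp
  finally show ?thesis by (simp add: card_cartesian_product)
qed

lemma span1_mem: "asub L \<Longrightarrow> y \<in> span1 L y"
  unfolding span1_def by (intro CollectI exI[of _ 0] exI[of _ 1]) (simp add: asub_0)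

lemma span1_upper: "L \<subseteq> span1 L y"
  unfolding span1_def by (auto intro!: exI[of _ 0])

lemma span2_upper: "L \<subseteq> span2 L y"
  unfolding span2_def by (auto intro!: exI[of _ 0])

lemma card_image_le_kernel:
  assumes "finite (f ` S)" "\<And>x y. x \<in> S \<Longrightarrow> y \<in> S \<Longrightarrow> f x = f y \<Longrightarrow> g x = g y"
  shows "card (g ` S) \<le> card (f ` S)"
proof (rule surj_card_le[OF assms(1)])
  show "g ` S \<subseteq> (\<lambda>b. g (inv_into S f b)) ` f ` S"
  proof (rule image_subsetI)
    fix x assume x: "x \<in> S"
    then have "inv_into S f (f x) \<in> S" "f (inv_into S f (f x)) = f x"
      by (auto simp: inv_into_into f_inv_into_f)
    then have "g (inv_into S f (f x)) = g x" using assms(2) x by blast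
    then show "g x \<in> (\<lambda>b. g (inv_into S f b)) ` f ` S" using x by (metis imageI)
  qed
qed

context residue_field
begin

text \<open>Below, generators of the residue field are recognised by this: an element that violates
  the conclusion for all admissible \<open>m\<close> lies in no proper subring above
  \<open>P\<close>.\<close>

lemma proper_srng_power:
  assumes p: "prime p" "\<And>S. asub S \<Longrightarrow> P \<subseteq> S \<Longrightarrow> \<exists>m. idx P S = p ^ m" "idx P UNIV = p ^ n"
    and S: "srng S" "P \<subseteq> S" "S \<noteq> UNIV" and u: "u \<in> S" "u \<notin> P"
  shows "\<exists>m\<ge>1. 2 * m \<le> n \<and> u ^ (p ^ m - 1) - 1 \<in> P"
proof -
  obtain m where m: "idx P S = p ^ m" using p(2) S srng_asub by blast
  have "m \<noteq> 0"
  proof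
    assume "m = 0"
    then have "card (coset P ` S) \<le> Suc 0" using m by simp
    then have "coset P u = coset P 0"
      using u(1) asub_0[OF srng_asub[OF S(1)]] card_le_Suc0_iff_eq[OF fin_image] by blast
    then show False using u(2) coset_eq_0 by blast
  qed
  moreover have "(p ^ m) ^ 2 \<le> p ^ n" using idx_proper_srng[OF S] m p(3) by simp
  then have "p ^ (2 * m) \<le> p ^ n" by (simp add: power_mult[symmetric] mult.commute)
  then have "2 * m \<le> n" using prime_gt_1_nat[OF p(1)] power_le_imp_le_exp by blast
  ultimately show ?thesis using pow_idx_srng[OF S(1,2) u] m by (intro exI[of _ m]) simp
qed

lemma ints_mod_UNIV:
  assumes p: "prime p" "\<And>S. asub S \<Longrightarrow> P \<subseteq> S \<Longrightarrow> \<exists>m. idx P S = p ^ m" "idx P UNIV = p"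
  shows "ints_mod P = UNIV"
proof (rule ccontr)
  assume "ints_mod P \<noteq> UNIV"
  then have "\<exists>m\<ge>1. 2 * m \<le> 1 \<and> 1 ^ (p ^ m - 1) - 1 \<in> P"
    using p ints_mod_srng[OF idl] ints_mod_upper ints_mod_one[OF asub] one_notin
    by (intro proper_srng_power[of p 1 "ints_mod P"]) simp_all
  then show False by auto
qed

lemma power_idx: "x ^ idx P UNIV - x \<in> P"
proof (cases "x \<in> P")
  case True
  then have "x ^ idx P UNIV \<in> P" using one_less_idx by (intro srng_pow[OF idl_srng[OF idl]]) simp_all
  then show ?thesis using True asub asub_diff by blast
next
  case False
  have "x * (x ^ (idx P UNIV - 1) - 1) \<in> P" by (rule idl_left[OF idl pow_idx_UNIV[OF False]])
  moreover have "idx P UNIV = Suc (idx P UNIV - 1)" using one_less_idx by simp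
  ultimately show ?thesis by (metis mult.right_neutral power_Suc right_diff_distrib)
qed

end

text \<open>The trace of the field with 8 elements over its prime field.\<close>

definition T8 :: "'a::ring_1 \<Rightarrow> 'a" where
  "T8 x = x + x ^ 2 + x ^ 4"

lemma T8_cong: "idl L \<Longrightarrow> x - y \<in> L \<Longrightarrow> T8 x - T8 y \<in> L"
  unfolding T8_def by (intro idl_diff_add idl_diff_power idl_asub)

lemma T8_add_1:
  assumes "idl L" "2 \<in> L"
  shows "T8 (x + 1) - (T8 x + 1) \<in> L"
proof -
  let ?w = "1 + x + x + x + x * x + x * x + x * x + x * x * x + x * x * x"
  have "T8 (x + 1) - (T8 x + 1) = ?w + ?w"
    by (simp add: T8_def eval_nat_numeral algebra_simps)
  also have "\<dots> = ?w * 2" by (simp only: mult_2_right)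
  finally have e: "T8 (x + 1) - (T8 x + 1) = ?w * 2" .
  show ?thesis unfolding e by (rule idl_left[OF assms])
qed

lemma T8_square:
  assumes "idl L" "2 \<in> L" "x ^ 8 - x \<in> L"
  shows "T8 x * (T8 x - 1) \<in> L"
proof -
  \<comment> \<open>The cross terms: the square of \<open>T8 x\<close> is
    \<open>x ^ 2 + x ^ 4 + x ^ 8\<close> plus twice \<open>?w\<close>. So a trace is 0 or 1 in the
    residue field.\<close>
  let ?w = "x ^ 3 + x ^ 5 + x ^ 6"
  have "T8 x * (T8 x - 1) = (?w + ?w) + (x ^ 8 - x)"
    by (simp add: T8_def eval_nat_numeral algebra_simps)
  also have "?w + ?w = ?w * 2" by (simp only: mult_2_right)
  finally show ?thesis using idl_left[OF assms(1,2)] assms by (simp add: asub_add idl_asub)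
qed

lemma T8_power2: "T8 (x ^ 2) = T8 x + (x ^ 8 - x)"
  by (simp add: T8_def algebra_simps flip: power_mult)

section \<open>Covers with at most 12 members for fields of size 2, 3 and 4\<close>

context critical_cover
begin

lemma V_char:
  assumes "P \<in> V (p ^ n)" "prime p" "0 < n"
  shows "of_nat p \<in> P" "\<And>S. asub S \<Longrightarrow> P \<subseteq> S \<Longrightarrow> \<exists>m. idx P S = p ^ m"
proof -
  interpret residue_field P using assms(1) PP_rf by (simp add: V_def)
  obtain r where r: "prime r" "of_nat r \<in> P" "\<And>S. asub S \<Longrightarrow> P \<subseteq> S \<Longrightarrow> \<exists>m. idx P S = r ^ m"
    using char_exists by blast
  obtain m where "p ^ n = r ^ m" using r(3)[OF asub_UNIV] assms(1) by (auto simp: V_def)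
  then have "p dvd r ^ m" using assms(3) by (metis dvd_power)
  then have "p dvd r" using assms(2) prime_dvd_power by blast
  then have "p = r" using assms(2) r(1) primes_dvd_imp_eq by blast
  then show "of_nat p \<in> P" "\<And>S. asub S \<Longrightarrow> P \<subseteq> S \<Longrightarrow> \<exists>m. idx P S = p ^ m" using r by auto
qed

lemma not_small_cover:
  assumes "finite D" "card D \<le> 12" "\<And>S. S \<in> D \<Longrightarrow> srng S \<and> S \<noteq> UNIV \<and> K \<subseteq> S"
    "\<And>x. \<exists>S\<in>D. x \<in> S"
  shows False
proof -
  have "\<Union>D = UNIV" using assms(4) by blast
  then have "cov K 12" unfolding cov_def using assms by blast
  then show False using not_cov_12 by blast
qed

lemma V_D: "P \<in> V q \<Longrightarrow> P \<in> PP" "P \<in> V q \<Longrightarrow> idx P UNIV = q"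
  by (simp_all add: V_def)

lemma PP_proper: "P \<in> PP \<Longrightarrow> srng P \<and> P \<noteq> UNIV \<and> K \<subseteq> P"
  using residue_field.one_notin[OF PP_rf, of P] by (auto simp: PP_idl idl_srng PP_K[THEN subsetD])

lemma Int_idx_gt: "P \<in> V q \<Longrightarrow> Q \<in> V q \<Longrightarrow> P \<noteq> Q \<Longrightarrow> q < idx (P \<inter> Q) UNIV"
  using idx_Int_gt[of P Q] PP_subset_eq[of P Q] V_D PP_rf by blast

lemma Int_K: "P \<in> PP \<Longrightarrow> Q \<in> PP \<Longrightarrow> K \<subseteq> P \<inter> Q"
  using PP_K by simp

lemma ints_mod_Int:
  assumes "P \<in> V (p ^ n)" "Q \<in> V (p ^ n)" "P \<noteq> Q" "prime p" "0 < n"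
  shows "srng (ints_mod (P \<inter> Q))" "ints_mod (P \<inter> Q) \<noteq> UNIV" "K \<subseteq> ints_mod (P \<inter> Q)"
proof -
  have PP: "P \<in> PP" "Q \<in> PP" using assms by (simp_all add: V_def)
  have L: "idl (P \<inter> Q)" using PP by (simp add: idl_Int PP_idl)
  show "srng (ints_mod (P \<inter> Q))" by (rule ints_mod_srng[OF L])
  show "K \<subseteq> ints_mod (P \<inter> Q)" using Int_K[OF PP] ints_mod_upper by blast
  have "of_nat p \<in> P \<inter> Q" using V_char(1) assms by blast
  then have "idx (P \<inter> Q) (ints_mod (P \<inter> Q)) \<le> p"
    using idx_ints_mod[OF L] prime_gt_0_nat[OF assms(4)] by blast
  also have "p \<le> p ^ n" using self_le_power[of p n] prime_ge_1_nat[OF assms(4)] assms(5) by simp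
  also have "\<dots> < idx (P \<inter> Q) UNIV" by (rule Int_idx_gt[OF assms(1-3)])
  finally show "ints_mod (P \<inter> Q) \<noteq> UNIV" by auto
qed

lemma prime_residue:
  assumes "P \<in> V p" "prime p"
  shows "\<exists>c\<in>{0..<int p}. x - of_int c \<in> P"
proof -
  have P: "P \<in> V (p ^ 1)" using assms by simp
  interpret residue_field P using assms(1) PP_rf V_D by blast
  have "x \<in> ints_mod P"
    using ints_mod_UNIV[OF assms(2) V_char(2)[OF P assms(2)]] V_D(2)[OF assms(1)] by simp
  then obtain c where "x - of_int c \<in> P" unfolding ints_mod_def by blast
  then have "x - of_int (c mod int p) \<in> P"
    using of_int_mod_mem[OF idl V_char(1)[OF P assms(2)]] asub_diff_trans[OF asub] by simp
  then show ?thesis using prime_gt_0_nat[OF assms(2)] by (intro bexI[of _ "c mod int p"]) simp_all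
qed

text \<open>An element that is nonzero in both coordinates is 1 in both, so it lies on the
  diagonal.\<close>

lemma not_cov_V2:
  assumes "P \<in> V 2" "Q \<in> V 2" "P \<noteq> Q"
  shows False
proof -
  have PP: "P \<in> PP" "Q \<in> PP" using assms V_D by blast+
  let ?D = "set [P, Q, ints_mod (P \<inter> Q)]"
  have I: "srng (ints_mod (P \<inter> Q))" "ints_mod (P \<inter> Q) \<noteq> UNIV" "K \<subseteq> ints_mod (P \<inter> Q)"
    using ints_mod_Int[of P 2 1 Q] assms by simp_all
  show False
  proof (rule not_small_cover[of ?D])
    show "card ?D \<le> 12" by (rule le_trans[OF card_length]) simp
    fix x
    have c: "x \<in> R \<or> x - of_int 1 \<in> R" if R: "R \<in> V 2" for R
    proof -
      have "prime (2::nat)" by simp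
      then obtain c where "c \<in> {0..<int 2}" "x - of_int c \<in> R" using prime_residue[OF R, of x] by blast
      moreover from this have "c = 0 \<or> c = 1" by auto
      ultimately show ?thesis by auto
    qed
    have "x \<in> P \<or> x \<in> Q \<or> x - of_int 1 \<in> P \<inter> Q" using c[OF assms(1)] c[OF assms(2)] by auto
    then show "\<exists>S\<in>?D. x \<in> S" by (auto simp: ints_mod_def simp del: of_int_1)
    fix S assume "S \<in> ?D"
    then have "S = P \<or> S = Q \<or> S = ints_mod (P \<inter> Q)" by simp
    then show "srng S \<and> S \<noteq> UNIV \<and> K \<subseteq> S"
      using I PP_proper[OF PP(1)] PP_proper[OF PP(2)] by (elim disjE) simp_all
  qed simp
qed

text \<open>Of three nonzero residues, each 1 or 2, two agree, which puts the element on one of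
  three diagonals.\<close>

lemma not_cov_V3:
  assumes "P \<in> V 3" "Q \<in> V 3" "R \<in> V 3" "P \<noteq> Q" "P \<noteq> R" "Q \<noteq> R"
  shows False
proof -
  have PP: "P \<in> PP" "Q \<in> PP" "R \<in> PP" using assms V_D by blast+
  let ?D = "set [P, Q, R, ints_mod (P \<inter> Q), ints_mod (P \<inter> R), ints_mod (Q \<inter> R)]"
  have I: "srng (ints_mod (A \<inter> B))" "ints_mod (A \<inter> B) \<noteq> UNIV" "K \<subseteq> ints_mod (A \<inter> B)"
    if "A \<in> V 3" "B \<in> V 3" "A \<noteq> B" for A B
    using ints_mod_Int[of A 3 1 B] that by simp_all
  show False
  proof (rule not_small_cover[of ?D])
    show "card ?D \<le> 12" by (rule le_trans[OF card_length]) simp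
    fix x
    have c: "x \<in> A \<or> x - of_int 1 \<in> A \<or> x - of_int 2 \<in> A" if A: "A \<in> V 3" for A
    proof -
      have "prime (3::nat)" by simp
      then obtain c where "c \<in> {0..<int 3}" "x - of_int c \<in> A" using prime_residue[OF A, of x] by blast
      moreover from this have "c = 0 \<or> c = 1 \<or> c = 2" by auto
      ultimately show ?thesis by auto
    qed
    have m: "x \<in> ints_mod (A \<inter> B)" if "x - of_int c \<in> A" "x - of_int c \<in> B" for A B c
      using that by (auto simp: ints_mod_def)
    have "x \<in> P \<or> x \<in> Q \<or> x \<in> R \<or> x \<in> ints_mod (P \<inter> Q) \<or> x \<in> ints_mod (P \<inter> R) \<or> x \<in> ints_mod (Q \<inter> R)"
      using c[OF assms(1)] c[OF assms(2)] c[OF assms(3)] m by blast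
    then show "\<exists>S\<in>?D. x \<in> S" by simp
    fix S assume "S \<in> ?D"
    then have "S = P \<or> S = Q \<or> S = R \<or> S = ints_mod (P \<inter> Q) \<or> S = ints_mod (P \<inter> R) \<or> S = ints_mod (Q \<inter> R)"
      by simp
    then show "srng S \<and> S \<noteq> UNIV \<and> K \<subseteq> S"
      using I[OF assms(1,2,4)] I[OF assms(1,3,5)] I[OF assms(2,3,6)] PP_proper[OF PP(1)] PP_proper[OF PP(2)]
        PP_proper[OF PP(3)] by (elim disjE) simp_all
  qed simp
qed

lemma ints_mod_proper:
  assumes "P \<in> V (p ^ n)" "prime p" "2 \<le> n"
  shows "srng (ints_mod P)" "ints_mod P \<noteq> UNIV" "K \<subseteq> ints_mod P"
proof -
  have PP: "P \<in> PP" using assms V_D by blast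
  show "srng (ints_mod P)" by (rule ints_mod_srng[OF PP_idl[OF PP]])
  show "K \<subseteq> ints_mod P" using PP_K[OF PP] ints_mod_upper by blast
  have "idx P (ints_mod P) \<le> p"
    using idx_ints_mod[OF PP_idl[OF PP] V_char(1)[OF assms(1,2)]] assms prime_gt_0_nat by simp
  also have "p = p ^ 1" by simp
  also have "\<dots> < p ^ n" using assms prime_gt_1_nat by (intro power_strict_increasing) simp_all
  finally show "ints_mod P \<noteq> UNIV" using V_D(2)[OF assms(1)] by auto
qed

text \<open>An element outside the prime field in both coordinates is a root of
  \<open>X ^ 2 + X + 1\<close> in both, so together with 1 it spans a subring with at most 4 classes
  modulo \<open>L\<close>.\<close>

lemma not_cov_V4:
  assumes "P \<in> V 4" "Q \<in> V 4" "P \<noteq> Q"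
  shows False
proof -
  have PP: "P \<in> PP" "Q \<in> PP" using assms V_D by blast+
  have V: "P \<in> V (2 ^ 2)" "Q \<in> V (2 ^ 2)" using assms by simp_all
  have two: "of_nat 2 \<in> P" "of_nat 2 \<in> Q" using V_char(1)[OF V(1)] V_char(1)[OF V(2)] by simp_all
  define L where "L = P \<inter> Q"
  have L: "idl L" using PP by (simp add: idl_Int PP_idl L_def)
  have aL: "asub L" using L by (rule idl_asub)
  have KL: "K \<subseteq> L" using Int_K[OF PP] by (simp add: L_def)
  let ?Y = "{y. y * y + y + 1 \<in> L}"
  let ?D = "{ints_mod P, ints_mod Q} \<union> span1 L ` ?Y"
  have root: "{y. y * y + y + 1 \<in> L} \<subseteq> {y. y ^ 3 - 1 \<in> R}" if "R \<in> PP" "L \<subseteq> R" for R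
  proof (clarify)
    fix y assume "y * y + y + 1 \<in> L"
    then have "(y - 1) * (y * y + y + 1) \<in> R" using that PP_idl by (auto intro: idl_left)
    moreover have "(y - 1) * (y * y + y + 1) = y ^ 3 - 1" by (simp add: algebra_simps power3_eq_cube)
    ultimately show "y ^ 3 - 1 \<in> R" by simp
  qed
  \<comment> \<open>Roots of \<open>X ^ 2 + X + 1\<close> are cube roots of unity. The crude bound
    of 3 per coordinate gives \<open>2 + 3 * 3 = 11\<close> members, which is small enough.\<close>
  have i3: "idx R ?Y \<le> 3" if R: "R \<in> PP" "L \<subseteq> R" for R
  proof -
    interpret residue_field R using R(1) by (rule PP_rf)
    have "idx R ?Y \<le> idx R {y. y ^ 3 - 1 \<in> R}"
      by (intro card_mono fin_image image_mono root R)
    also have "\<dots> \<le> 3" by (rule card_roots_of_unity) simp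
    finally show ?thesis .
  qed
  have finY: "finite (coset R ` ?Y)" if "R \<in> PP" for R
    using residue_field.fin_image[OF PP_rf[OF that]] .
  have finL: "finite (coset L ` ?Y)"
    using fin_ix_image[OF fin_ix_Int] PP PP_rf residue_field.fin unfolding L_def by blast
  have "idx L ?Y \<le> idx P ?Y * idx Q ?Y"
    unfolding L_def by (rule idx_Int_le) (use finY PP in \<open>simp_all add: L_def\<close>)
  also have "\<dots> \<le> 3 * 3" using i3[OF PP(1)] i3[OF PP(2)] by (intro mult_le_mono) (auto simp: L_def)
  finally have i9: "idx L ?Y \<le> 9" by simp
  have s9: "card (span1 L ` ?Y) \<le> 9"
    using card_image_le_kernel[OF finL, of "span1 L"] span1_cong[OF L] i9 by (simp add: coset_eq[OF aL])
  have finD: "finite (span1 L ` ?Y)"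
  proof -
    have "span1 L ` ?Y \<subseteq> {S. asub S \<and> K \<subseteq> S}"
      using span1_srng[OF L] span1_upper[of L] KL by (auto simp: srng_asub)
    then show ?thesis using finite_supergroups[OF K(2) asubK] finite_subset by blast
  qed
  show False
  proof (rule not_small_cover[of ?D])
    show "finite ?D" using finD by simp
    have "card {ints_mod P, ints_mod Q} \<le> 2" by (simp add: card_insert_le_m1)
    then show "card ?D \<le> 12" using card_Un_le[of "{ints_mod P, ints_mod Q}" "span1 L ` ?Y"] s9 by linarith
    fix S assume S: "S \<in> ?D"
    have sp: "S \<noteq> UNIV" if "S = span1 L y" for y
    proof -
      have "idx L (span1 L y) \<le> 2 * 2" using two by (intro idx_span1[OF L]) (simp_all add: L_def)
      also have "\<dots> < idx L UNIV" using Int_idx_gt[OF assms] by (simp add: L_def)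
      finally show ?thesis using that by auto
    qed
    consider "S = ints_mod P" | "S = ints_mod Q" | y where "S = span1 L y" "y * y + y + 1 \<in> L" using S by blast
    then show "srng S \<and> S \<noteq> UNIV \<and> K \<subseteq> S"
    proof cases
      case 3
      then show ?thesis using span1_srng[OF L] sp[of y] subset_trans[OF KL span1_upper] by simp
    qed (use ints_mod_proper[OF V(1)] ints_mod_proper[OF V(2)] in simp_all)
  next
    fix x
    have q: "x * x + x + 1 \<in> R" if R: "R \<in> V 4" "x \<notin> ints_mod R" for R
    proof -
      interpret residue_field R using R(1) PP_rf V_D by blast
      have n: "x \<notin> R" "x - 1 \<notin> R"
        using R(2) unfolding ints_mod_def by (auto dest: spec[of _ 0] spec[of _ 1])
      have "x ^ (4 - 1) - 1 \<in> R" using pow_idx_UNIV[OF n(1)] V_D(2)[OF R(1)] by simp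
      then have "(x - 1) * (x * x + x + 1) \<in> R" by (simp add: algebra_simps eval_nat_numeral)
      then show ?thesis using prime n by blast
    qed
    show "\<exists>S\<in>?D. x \<in> S"
    proof (cases "x \<in> ints_mod P \<or> x \<in> ints_mod Q")
      case False
      then have "x * x + x + 1 \<in> L" using q assms by (simp add: L_def)
      then show ?thesis using span1_mem[OF aL, of x] by blast
    qed blast
  qed
qed

end

section \<open>A cover with at most 12 members for fields of size 8\<close>

context critical_cover
begin

lemma V8:
  assumes "R \<in> V 8"
  shows "2 \<in> R" "x ^ 8 - x \<in> R" "T8 x \<in> R \<or> T8 x - 1 \<in> R"
proof -
  interpret residue_field R using assms PP_rf V_D by blast
  have "R \<in> V (2 ^ 3)" using assms by simp
  then have "of_nat 2 \<in> R" using V_char(1)[of R 2 3] by simp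
  then show 2: "2 \<in> R" by simp
  show 8: "x ^ 8 - x \<in> R" using power_idx[of x] V_D(2)[OF assms] by simp
  show "T8 x \<in> R \<or> T8 x - 1 \<in> R" using prime T8_square[OF idl 2 8] by blast
qed

text \<open>Adding 1 turns trace 0 into trace 1, so trace 0 occurs for at most half of the 8
  residues.\<close>

lemma idx_T8:
  assumes "R \<in> V 8"
  shows "idx R {x. T8 x \<in> R} \<le> 4" "idx R {x. T8 x \<in> R \<and> x \<notin> R} \<le> 3"
proof -
  interpret residue_field R using assms PP_rf V_D by blast
  let ?A = "{x. T8 x \<in> R}" and ?B = "{x. T8 x - 1 \<in> R}"
  have "idx R ?A = card ((\<lambda>x. coset R (x + 1)) ` ?A)"
    by (rule card_image_cong_kernel) (simp add: coset_eq[OF asub])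
  also have "\<dots> \<le> idx R ?B"
  proof (intro card_mono fin_image subsetI)
    fix X assume "X \<in> (\<lambda>x. coset R (x + 1)) ` ?A"
    then obtain x where x: "T8 x \<in> R" "X = coset R (x + 1)" by blast
    have "T8 (x + 1) - (T8 x + 1) + T8 x \<in> R"
      using T8_add_1[OF idl V8(1)[OF assms], of x] x(1) by (rule asub_add[OF asub])
    then have "x + 1 \<in> ?B" by (simp add: algebra_simps)
    then show "X \<in> coset R ` ?B" using x(2) by blast
  qed
  finally have AB: "idx R ?A \<le> idx R ?B" .
  have "coset R ` ?A \<inter> coset R ` ?B = {}"
  proof (rule ccontr)
    assume "coset R ` ?A \<inter> coset R ` ?B \<noteq> {}"
    then obtain x y where xy: "T8 x \<in> R" "T8 y - 1 \<in> R" "coset R x = coset R y" by auto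
    then have "T8 x - T8 y \<in> R" by (intro T8_cong[OF idl]) (simp add: coset_eq[OF asub])
    then have "T8 y \<in> R" using xy(1) asub_diff_mem[OF asub] by blast
    then show False using xy(2) asub_diff_mem[OF asub, of "T8 y" 1] one_notin by blast
  qed
  then have "idx R ?A + idx R ?B = card (coset R ` ?A \<union> coset R ` ?B)"
    by (simp add: card_Un_disjoint fin_image)
  also have "\<dots> \<le> idx R UNIV" by (intro card_mono fin_image) blast
  finally show A: "idx R ?A \<le> 4" using AB V_D(2)[OF assms] by simp
  have "{x. T8 x \<in> R \<and> x \<notin> R} = ?A - R" by blast
  then have "coset R ` {x. T8 x \<in> R \<and> x \<notin> R} = coset R ` ?A - {coset R 0}" by (simp add: image_minus)
  moreover have "0 \<in> ?A" using asub_0[OF asub] by (simp add: T8_def)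
  then have "coset R 0 \<in> coset R ` ?A" by blast
  ultimately show "idx R {x. T8 x \<in> R \<and> x \<notin> R} \<le> 3" using A by (simp add: card_Diff_singleton)
qed

text \<open>One of \<open>x\<close> and \<open>x + 1\<close> has trace 0; starting outside the prime
  field avoids the residues 0 and 1.\<close>

lemma exists_T8_root:
  assumes "R \<in> V 8"
  obtains a where "T8 a \<in> R" "a \<notin> R" "a - 1 \<notin> R"
proof -
  interpret residue_field R using assms PP_rf V_D by blast
  have "ints_mod R \<noteq> UNIV" using ints_mod_proper(2)[of R 2 3] assms by simp
  then obtain x where x: "x \<notin> ints_mod R" by blast
  have nx: "x - of_int c \<notin> R" for c using x unfolding ints_mod_def by blast
  consider "T8 x \<in> R" | "T8 x - 1 \<in> R" using V8(3)[OF assms] by blast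
  then show ?thesis
  proof cases
    case 1
    then show ?thesis using that[of x] nx[of 0] nx[of 1] by simp
  next
    case 2
    have "T8 (x + 1) - (T8 x + 1) + (T8 x - 1) + 2 \<in> R"
      using T8_add_1[OF idl V8(1)[OF assms], of x] 2 V8(1)[OF assms] by (intro asub_add[OF asub])
    then have "T8 (x + 1) \<in> R" by (simp add: algebra_simps)
    then show ?thesis using that[of "x + 1"] nx[of "-1"] nx[of 0] by simp
  qed
qed

lemma T8_cube:
  assumes "R \<in> V 8" "T8 w \<in> R" "w \<notin> R"
  shows "w ^ 3 + w + 1 \<in> R"
proof -
  interpret residue_field R using assms PP_rf V_D by blast
  have "w * (w ^ 3 + w + 1) = T8 w" by (simp add: T8_def algebra_simps eval_nat_numeral)
  then show ?thesis using prime assms by metis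
qed

text \<open>Squaring preserves trace 0, and the conjugates of \<open>w\<close> have three distinct
  nonzero residues. As at most three nonzero residues have trace 0, \<open>a\<close> is among
  them.\<close>

lemma T8_conjugates:
  assumes R: "R \<in> V 8" and w: "T8 w \<in> R" "w \<notin> R" and a: "T8 a \<in> R" "a \<notin> R"
  shows "\<exists>y\<in>{w, w ^ 2, w ^ 4}. y - a \<in> R"
proof -
  interpret residue_field R using assms PP_rf V_D by blast
  let ?W = "{x. T8 x \<in> R \<and> x \<notin> R}"
  have T2: "T8 (x ^ 2) \<in> R" if "T8 x \<in> R" for x
    unfolding T8_power2 using that V8(2)[OF R] by (rule asub_add[OF asub])
  have w4: "w ^ 4 = (w ^ 2) ^ 2" by (simp flip: power_mult)
  have W: "{w, w ^ 2, w ^ 4} \<subseteq> ?W"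
    unfolding w4 using w T2[OF w(1)] T2[OF T2[OF w(1)]] power_mem by blast
  have w1: "w - 1 \<notin> R"
  proof
    assume "w - 1 \<in> R"
    then have "T8 w - T8 1 \<in> R" by (rule T8_cong[OF idl])
    then have "T8 1 \<in> R" using w(1) asub_diff_mem[OF asub] by blast
    then have "3 - 2 \<in> R" using V8(1)[OF R] by (intro asub_diff[OF asub]) (simp_all add: T8_def)
    then show False using one_notin by simp
  qed
  have d1: "w ^ 2 - w \<notin> R"
  proof
    assume "w ^ 2 - w \<in> R"
    then have "w * (w - 1) \<in> R" by (simp add: algebra_simps power2_eq_square)
    then show False using prime w w1 by blast
  qed
  have d2: "w ^ 4 - w ^ 2 \<notin> R"
  proof
    assume "w ^ 4 - w ^ 2 \<in> R"
    then have "w * (w * ((w - 1) * (w + 1))) \<in> R" by (simp add: algebra_simps eval_nat_numeral)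
    then have "w + 1 \<in> R" using prime w w1 by blast
    then have "w + 1 - 2 \<in> R" using V8(1)[OF R] by (rule asub_diff[OF asub])
    then have "w - (2 - 1) \<in> R" by (simp only: diff_diff_eq2)
    then show False using w1 by simp
  qed
  have d3: "w ^ 4 - w \<notin> R"
  proof
    assume "w ^ 4 - w \<in> R"
    then have "w * (w ^ 3 - 1) \<in> R" by (simp add: algebra_simps eval_nat_numeral)
    then have "w ^ 3 - 1 \<in> R" using prime w by blast
    from asub_diff[OF asub asub_diff[OF asub T8_cube[OF R w] this] V8(1)[OF R]]
    have "w ^ 3 + w + 1 - (w ^ 3 - 1) - (1 + 1) \<in> R" by simp
    then show False using w(2) by (simp add: algebra_simps del: one_add_one)
  qed
  have "card (coset R ` {w, w ^ 2, w ^ 4}) = 3"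
    using d1 d2 d3 asub_diff_commute[OF asub] by (simp add: coset_eq[OF asub] card_insert_if) blast
  moreover have "coset R ` {w, w ^ 2, w ^ 4} \<subseteq> coset R ` ?W" by (rule image_mono[OF W])
  ultimately have "coset R ` {w, w ^ 2, w ^ 4} = coset R ` ?W"
    using idx_T8(2)[OF R] by (intro card_seteq fin_image) simp_all
  moreover have "coset R a \<in> coset R ` ?W" using a by blast
  ultimately have "coset R a \<in> coset R ` {w, w ^ 2, w ^ 4}" by simp
  then obtain y where "y \<in> {w, w ^ 2, w ^ 4}" "coset R y = coset R a" by (metis imageE)
  then show ?thesis using coset_eq[OF asub] by blast
qed

text \<open>A root \<open>a\<close> of \<open>X\<^sup>3 + X + 1\<close> modulo \<open>P\<close> generates the residue field, so an isomorphism to the residue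
  field of \<open>Q\<close> is determined by the image of \<open>a\<close>, for which there are three choices.\<close>

definition G8 :: "'a set \<Rightarrow> 'a set \<Rightarrow> 'a \<Rightarrow> 'a set set" where
  "G8 P Q a = span2 (P \<inter> Q) ` {y. y - a \<in> P \<and> T8 y \<in> P \<inter> Q \<and> y \<notin> P \<and> y \<notin> Q}"

lemma G8:
  assumes P: "P \<in> V 8" and Q: "Q \<in> V 8" and PQ: "P \<noteq> Q"
  shows "finite (G8 P Q a)" "card (G8 P Q a) \<le> 3" "S \<in> G8 P Q a \<Longrightarrow> srng S \<and> S \<noteq> UNIV \<and> K \<subseteq> S"
proof -
  have PP: "P \<in> PP" "Q \<in> PP" using P Q V_D by blast+
  define L where "L = P \<inter> Q"
  have L: "idl L" using PP by (simp add: idl_Int PP_idl L_def)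
  have KL: "K \<subseteq> L" using Int_K[OF PP] by (simp add: L_def)
  let ?Y = "{y. y - a \<in> P \<and> T8 y \<in> L \<and> y \<notin> P \<and> y \<notin> Q}"
  have G: "G8 P Q a = span2 L ` ?Y" by (simp add: G8_def L_def)
  show mem: "srng S \<and> S \<noteq> UNIV \<and> K \<subseteq> S" if S: "S \<in> G8 P Q a" for S
  proof -
    obtain y where y: "S = span2 L y" "y \<in> ?Y" using S unfolding G by blast
    have "y ^ 3 + y + 1 \<in> L" using T8_cube[OF P, of y] T8_cube[OF Q, of y] y(2) by (simp add: L_def)
    then have "srng S" unfolding y(1) by (rule span2_srng[OF L])
    moreover have "K \<subseteq> S" unfolding y(1) using KL span2_upper by blast
    moreover have "S \<noteq> UNIV"
    proof -
      have "idx L (span2 L y) \<le> 2 * 2 * 2" using V8(1)[OF P] V8(1)[OF Q] by (intro idx_span2[OF L]) (simp_all add: L_def)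
      also have "\<dots> < idx L UNIV" using Int_idx_gt[OF P Q PQ] by (simp add: L_def)
      finally show ?thesis unfolding y(1) by auto
    qed
    ultimately show ?thesis by blast
  qed
  have "G8 P Q a \<subseteq> {S. asub S \<and> K \<subseteq> S}" using mem by (blast intro: srng_asub)
  then show "finite (G8 P Q a)" using finite_supergroups[OF K(2) asubK] finite_subset by blast
  have fin: "finite (coset Q ` X)" for X by (rule residue_field.fin_image[OF PP_rf[OF PP(2)]])
  have "card (G8 P Q a) \<le> idx Q ?Y" unfolding G
  proof (rule card_image_le_kernel[OF fin])
    fix x y assume x: "x \<in> ?Y" and y: "y \<in> ?Y" and "coset Q x = coset Q y"
    then have "x - y \<in> Q" using PP_asub[OF PP(2)] by (simp add: coset_eq)
    moreover have "x - y \<in> P" using x y asub_diff[OF PP_asub[OF PP(1)], of "x - a" "y - a"] by simp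
    ultimately show "span2 L x = span2 L y" by (intro span2_cong[OF L]) (simp add: L_def)
  qed
  also have "\<dots> \<le> idx Q {x. T8 x \<in> Q \<and> x \<notin> Q}" by (intro card_mono fin image_mono) (auto simp: L_def)
  also have "\<dots> \<le> 3" by (rule idx_T8(2)[OF Q])
  finally show "card (G8 P Q a) \<le> 3" .
qed

text \<open>Some conjugate \<open>y\<close> of \<open>w\<close> agrees with \<open>a\<close> modulo
  \<open>P\<close>. In turn \<open>w\<close> is a conjugate of \<open>y\<close>, hence a combination
  of \<open>y\<close> and \<open>y ^ 2\<close> modulo \<open>P \<inter> Q\<close>. The integer
  translates serve elements of trace 1.\<close>

lemma G8_covers:
  assumes P: "P \<in> V 8" and Q: "Q \<in> V 8" and PQ: "P \<noteq> Q" and a: "T8 a \<in> P" "a \<notin> P"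
    and w: "T8 w \<in> P" "w \<notin> P" "T8 w \<in> Q" "w \<notin> Q"
  shows "\<exists>S\<in>G8 P Q a. \<forall>c. w + of_int c \<in> S"
proof -
  have PP: "P \<in> PP" "Q \<in> PP" using P Q V_D by blast+
  define L where "L = P \<inter> Q"
  have L: "idl L" using PP by (simp add: idl_Int PP_idl L_def)
  have aL: "asub L" using L by (rule idl_asub)
  obtain y where y: "y \<in> {w, w ^ 2, w ^ 4}" "y - a \<in> P" using T8_conjugates[OF P w(1,2) a] by blast
  have w8: "w ^ 8 - w \<in> L" using V8(2)[OF P] V8(2)[OF Q] by (simp add: L_def)
  have T2: "T8 (x ^ 2) \<in> L" if "T8 x \<in> L" for x
    unfolding T8_power2 using that V8(2)[OF P, of x] V8(2)[OF Q, of x] by (intro asub_add[OF aL]) (simp_all add: L_def)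
  have w4: "w ^ 4 = (w ^ 2) ^ 2" by (simp flip: power_mult)
  have Tw: "T8 w \<in> L" using w by (simp add: L_def)
  have Ty: "T8 y \<in> L" using y(1) Tw T2[OF Tw] T2[OF T2[OF Tw]] unfolding w4 by auto
  have ny: "y \<notin> P" "y \<notin> Q"
    using y(1) w residue_field.power_mem[OF PP_rf[OF PP(1)]] residue_field.power_mem[OF PP_rf[OF PP(2)]] by auto
  have cube: "y ^ 3 + y + 1 \<in> L" using T8_cube[OF P, of y] T8_cube[OF Q, of y] Ty ny by (simp add: L_def)
  have "\<exists>d e. w - (of_int d * y + of_int e * y ^ 2) \<in> L"
  proof -
    consider "y = w" | "y = w ^ 2" | "y = w ^ 4" using y(1) by blast
    then show ?thesis
    proof cases
      case 1
      then show ?thesis by (intro exI[of _ 1] exI[of _ 0]) (simp add: asub_0 aL)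
    next
      case 2
      \<comment> \<open>Here \<open>w\<close> agrees with \<open>y ^ 4\<close>, which the cubic
        relation reduces to \<open>- y - y ^ 2\<close>.\<close>
      then have "y ^ 4 = w ^ 8" by (simp flip: power_mult)
      then have "y ^ 4 - w \<in> L" using w8 by simp
      then have "y * (y ^ 3 + y + 1) - (y ^ 4 - w) \<in> L" by (rule asub_diff[OF aL idl_left[OF L cube]])
      then have "w - (of_int (- 1) * y + of_int (- 1) * y ^ 2) \<in> L"
        by (simp add: algebra_simps eval_nat_numeral)
      then show ?thesis by blast
    next
      case 3
      then have "y ^ 2 = w ^ 8" by (simp flip: power_mult)
      then have "w - (of_int 0 * y + of_int 1 * y ^ 2) \<in> L" using asub_diff_commute[OF aL w8] by simp
      then show ?thesis by blast
    qed
  qed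
  then obtain d e where de: "w - (of_int d * y + of_int e * y ^ 2) \<in> L" by blast
  have "w + of_int c \<in> span2 L y" for c
    unfolding span2_def using de by (intro CollectI exI[of _ c] exI[of _ d] exI[of _ e]) (simp add: algebra_simps)
  moreover have "span2 L y \<in> G8 P Q a" using y(2) Ty ny by (auto simp: G8_def L_def)
  ultimately show ?thesis by blast
qed

text \<open>Two of the three coordinates give \<open>x\<close> the same trace; if it is 1, then
  \<open>x + 1\<close> has trace 0 in both. Three members per pair, and one per coordinate for
  elements of its prime field, make \<open>3 * 3 + 3 = 12\<close>.\<close>

lemma not_cov_V8:
  assumes V: "P \<in> V 8" "Q \<in> V 8" "R \<in> V 8" and ne: "P \<noteq> Q" "P \<noteq> R" "Q \<noteq> R"
  shows False
proof -
  obtain a where a: "T8 a \<in> P" "a \<notin> P" "a - 1 \<notin> P" using exists_T8_root[OF V(1)] by blast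
  obtain b where b: "T8 b \<in> Q" "b \<notin> Q" "b - 1 \<notin> Q" using exists_T8_root[OF V(2)] by blast
  let ?D = "set [ints_mod P, ints_mod Q, ints_mod R] \<union> (G8 P Q a \<union> (G8 P R a \<union> G8 Q R b))"
  have I: "srng (ints_mod A) \<and> ints_mod A \<noteq> UNIV \<and> K \<subseteq> ints_mod A" if "A \<in> V 8" for A
    using ints_mod_proper[of A 2 3] that by simp
  show False
  proof (rule not_small_cover[of ?D])
    show "finite ?D" using G8(1) V ne by simp
    have "card (set [ints_mod P, ints_mod Q, ints_mod R]) \<le> 3" by (rule le_trans[OF card_length]) simp
    moreover have "card (G8 P Q a) \<le> 3" "card (G8 P R a) \<le> 3" "card (G8 Q R b) \<le> 3" using G8(2) V ne by blast+
    ultimately show "card ?D \<le> 12"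
      using card_Un_le[of "set [ints_mod P, ints_mod Q, ints_mod R]" "G8 P Q a \<union> (G8 P R a \<union> G8 Q R b)"]
        card_Un_le[of "G8 P Q a" "G8 P R a \<union> G8 Q R b"] card_Un_le[of "G8 P R a" "G8 Q R b"] by linarith
    fix S assume "S \<in> ?D"
    then consider "S = ints_mod P" | "S = ints_mod Q" | "S = ints_mod R" | "S \<in> G8 P Q a" | "S \<in> G8 P R a" | "S \<in> G8 Q R b"
      by auto
    then show "srng S \<and> S \<noteq> UNIV \<and> K \<subseteq> S"
      using I V G8(3)[OF V(1,2) ne(1)] G8(3)[OF V(1,3) ne(2)] G8(3)[OF V(2,3) ne(3)] by cases simp_all
  next
    fix x
    have key: "\<exists>S\<in>G8 A B c. x \<in> S"
      if AB: "A \<in> V 8" "B \<in> V 8" "A \<noteq> B" and c: "T8 c \<in> A" "c \<notin> A"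
        and x: "x \<notin> ints_mod A" "x \<notin> ints_mod B" and e: "T8 x \<in> A \<longleftrightarrow> T8 x \<in> B" for A B c
    proof -
      have n: "x - of_int k \<notin> A" "x - of_int k \<notin> B" for k using x unfolding ints_mod_def by blast+
      have PP: "A \<in> PP" "B \<in> PP" using AB V_D by blast+
      show ?thesis
      proof (cases "T8 x \<in> A")
        case True
        then obtain S where "S \<in> G8 A B c" "\<And>k. x + of_int k \<in> S"
          using G8_covers[OF AB c, of x] e n[of 0] by auto
        moreover from this(2)[of 0] have "x \<in> S" by simp
        ultimately show ?thesis by blast
      next
        case False
        have s: "T8 (x + 1) \<in> C" if C: "C \<in> V 8" "T8 x \<notin> C" for C
        proof -
          have aC: "asub C" and iC: "idl C" using C V_D PP_asub PP_idl by blast+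
          have "T8 x - 1 \<in> C" using V8(3)[OF C(1)] C(2) by blast
          then have "T8 (x + 1) - (T8 x + 1) + (T8 x - 1) + 2 \<in> C"
            using T8_add_1[OF iC V8(1)[OF C(1)], of x] V8(1)[OF C(1)] by (intro asub_add[OF aC])
          then show ?thesis by (simp add: algebra_simps)
        qed
        have "\<exists>S\<in>G8 A B c. \<forall>k. x + 1 + of_int k \<in> S"
          using s[OF AB(1)] s[OF AB(2)] False e n[of "-1"] by (intro G8_covers[OF AB c]) simp_all
        then obtain S where S: "S \<in> G8 A B c" "\<And>k. x + 1 + of_int k \<in> S" by blast
        from S(2)[of "-1"] have "x \<in> S" by simp
        then show ?thesis using S(1) by blast
      qed
    qed
    show "\<exists>S\<in>?D. x \<in> S"
    proof (cases "x \<in> ints_mod P \<or> x \<in> ints_mod Q \<or> x \<in> ints_mod R")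
      case False
      then have "(\<exists>S\<in>G8 P Q a. x \<in> S) \<or> (\<exists>S\<in>G8 P R a. x \<in> S) \<or> (\<exists>S\<in>G8 Q R b. x \<in> S)"
        using key[OF V(1,2) ne(1) a(1,2)] key[OF V(1,3) ne(2) a(1,2)] key[OF V(2,3) ne(3) b(1,2)] by argo
      then show ?thesis by blast
    qed auto
  qed
qed

end

section \<open>The numerical contradiction\<close>

context residue_field
begin

lemma exists_not_root_of_unity:
  assumes "0 < d" "d + 1 < idx P UNIV"
  obtains x where "x \<notin> P" "x ^ d - 1 \<notin> P"
proof -
  have "\<exists>x. x \<notin> P \<and> x ^ d - 1 \<notin> P"
  proof (rule ccontr)
    assume "\<not> (\<exists>x. x \<notin> P \<and> x ^ d - 1 \<notin> P)"
    then have "range (coset P) \<subseteq> insert (coset P 0) (coset P ` {x. x ^ d - 1 \<in> P})"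
      using coset_eq_0 by blast
    then have "idx P UNIV \<le> card (insert (coset P 0) (coset P ` {x. x ^ d - 1 \<in> P}))"
      by (intro card_mono) (simp_all add: fin_image)
    also have "\<dots> \<le> Suc (idx P {x. x ^ d - 1 \<in> P})" by (simp add: card_insert_if fin_image)
    also have "\<dots> \<le> Suc d" using card_roots_of_unity[OF assms(1)] by simp
    finally show False using assms(2) by simp
  qed
  then show ?thesis using that by blast
qed

end

lemma two_distinct:
  assumes "2 \<le> card X"
  obtains P Q where "P \<in> X" "Q \<in> X" "P \<noteq> Q"
  using assms by (auto simp: numeral_eq_Suc card_le_Suc_iff)

lemma three_distinct:
  assumes "3 \<le> card X"
  obtains P Q R where "P \<in> X" "Q \<in> X" "R \<in> X" "P \<noteq> Q" "P \<noteq> R" "Q \<noteq> R"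
  using assms by (auto simp: numeral_eq_Suc card_le_Suc_iff)

text \<open>With \<open>h = n div 2\<close> this bounds the residues in proper subrings by about
  twice the square root of the field size.\<close>

lemma sum_prime_powers_le:
  fixes p :: nat
  assumes "2 \<le> p"
  shows "2 + (\<Sum>m\<le>h. p ^ m - 1) \<le> 2 * p ^ h"
proof (induction h)
  case (Suc h)
  have "2 * p ^ h \<le> p * p ^ h" using assms by simp
  then show ?case using Suc unfolding sum.atMost_Suc power_Suc by linarith
qed simp

section \<open>Bounds on the number of graphs between two coordinates\<close>

context critical_cover
begin

text \<open>Since 1 is not known to lie in \<open>M\<close>, an expression such as
  \<open>y ^ 5 - 1\<close> is not known to lie there either, but \<open>y\<close> times it does. The
  factor \<open>y\<close> is removed again because \<open>Q\<close> is prime and does not contain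
  it.\<close>

lemma graph_type_transfer:
  assumes "M \<in> C" "P \<in> PP" "Q \<in> PP" "graph_type M P Q" "y \<in> M" "y \<notin> P" "y * z \<in> M" "z \<in> P"
  shows "z \<in> Q"
proof -
  have "y * z \<in> P" using idl_left[OF PP_idl[OF assms(2)] assms(8)] .
  then have "y * z \<in> Q" "y \<notin> Q" using assms(4-7) by (auto simp: graph_type_def)
  then show ?thesis using residue_field.prime[OF PP_rf[OF assms(3)]] by blast
qed

text \<open>The element 1 generates a prime field and can only be sent to 1.\<close>

lemma card_graphs_prime:
  assumes P: "P \<in> V p" and Q: "Q \<in> V p" and p: "prime p"
  shows "card (graphs P Q) \<le> 1"
proof -
  have PP: "P \<in> PP" "Q \<in> PP" using P Q V_D by blast+
  interpret P: residue_field P using PP PP_rf by blast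
  interpret Q: residue_field Q using PP PP_rf by blast
  have P1: "P \<in> V (p ^ 1)" using P by simp
  have "card (graphs P Q) \<le> idx Q {y. y - 1 \<in> Q}"
  proof (rule card_graphs_le[OF PP, where u = 1])
    fix S assume S: "srng S" "P \<subseteq> S" "1 \<in> S"
    show "S = UNIV"
    proof (rule ccontr)
      assume "S \<noteq> UNIV"
      then have "\<exists>m\<ge>1. 2 * m \<le> 1 \<and> 1 ^ (p ^ m - 1) - 1 \<in> P"
        using P.proper_srng_power[OF p V_char(2)[OF P1 p] _ S(1,2) _ S(3) P.one_notin, of 1] V_D(2)[OF P] by simp
      then show False by auto
    qed
  next
    fix M y assume M: "M \<in> C" "graph_type M P Q" and y: "y \<in> M" "y - 1 \<in> P"
    have "y * y - y \<in> M" using y C_srng[OF M(1)] by (intro asub_diff srng_asub srng_mult)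
    then have "y * (y - 1) \<in> M" by (simp add: right_diff_distrib)
    moreover have "y \<notin> P" using asub_diff_mem[OF P.asub y(2)] P.one_notin by blast
    ultimately have "y - 1 \<in> Q" using graph_type_transfer[OF M(1) PP M(2) y(1)] y(2) by blast
    then show "y \<in> {y. y - 1 \<in> Q}" by simp
  qed
  also have "\<dots> \<le> card {1::'a}" by (rule idx_le_card_reps[OF Q.asub]) auto
  finally show ?thesis by simp
qed

text \<open>A generator of trace 0 goes to one of the at most 4 residues of trace 0. Counting 0
  among them does no harm in the final estimate.\<close>

lemma card_graphs_8:
  assumes P: "P \<in> V 8" and Q: "Q \<in> V 8"
  shows "card (graphs P Q) \<le> 4"
proof -
  have PP: "P \<in> PP" "Q \<in> PP" using P Q V_D by blast+
  interpret P: residue_field P using PP PP_rf by blast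
  have P3: "P \<in> V (2 ^ 3)" using P by simp
  obtain u where u: "T8 u \<in> P" "u \<notin> P" "u - 1 \<notin> P" using exists_T8_root[OF P] by blast
  have "card (graphs P Q) \<le> idx Q {y. T8 y \<in> Q}"
  proof (rule card_graphs_le[OF PP, where u = u])
    fix S assume S: "srng S" "P \<subseteq> S" "u \<in> S"
    show "S = UNIV"
    proof (rule ccontr)
      assume "S \<noteq> UNIV"
      then have "\<exists>m\<ge>1. 2 * m \<le> 3 \<and> u ^ (2 ^ m - 1) - 1 \<in> P"
        using P.proper_srng_power[OF two_is_prime_nat V_char(2)[OF P3 two_is_prime_nat] _ S(1,2) _ S(3) u(2), of 3]
          V_D(2)[OF P] by simp
      then obtain m :: nat where m: "1 \<le> m" "2 * m \<le> 3" "u ^ (2 ^ m - 1) - 1 \<in> P" by blast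
      then have "m = 1" by linarith
      then show False using m(3) u(3) by simp
    qed
  next
    fix M y assume M: "M \<in> C" "graph_type M P Q" and y: "y \<in> M" "y - u \<in> P"
    have "T8 y \<in> P" using T8_cong[OF P.idl y(2)] u(1) asub_diff_mem[OF P.asub] by blast
    moreover have "T8 y \<in> M"
      unfolding T8_def using y(1) C_srng[OF M(1)] by (intro asub_add srng_asub srng_pow) simp_all
    ultimately show "y \<in> {y. T8 y \<in> Q}" using M(2) by (auto simp: graph_type_def)
  qed
  also have "\<dots> \<le> 4" by (rule idx_T8(1)[OF Q])
  finally show ?thesis .
qed

text \<open>A square root \<open>u\<close> of -1 generates the field with 9 elements and has at most
  two images.\<close>

lemma card_graphs_9:
  assumes P: "P \<in> V 9" and Q: "Q \<in> V 9"
  shows "card (graphs P Q) \<le> 2"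
proof -
  have PP: "P \<in> PP" "Q \<in> PP" using P Q V_D by blast+
  interpret P: residue_field P using PP PP_rf by blast
  interpret Q: residue_field Q using PP PP_rf by blast
  have P2: "P \<in> V (3 ^ 2)" using P by simp
  have pr: "prime (3::nat)" by simp
  have three: "3 \<in> P" using V_char(1)[OF P2 pr] by simp
  \<comment> \<open>Four fourth roots of unity and 0 do not exhaust 9 residues. As
    \<open>x ^ 8\<close> is 1 modulo \<open>P\<close>, such an \<open>x\<close> has fourth power
    -1.\<close>
  obtain x where x: "x \<notin> P" "x ^ 4 - 1 \<notin> P"
    using P.exists_not_root_of_unity[of 4] V_D(2)[OF P] by auto
  have "x ^ (9 - 1) - 1 \<in> P" using P.pow_idx_UNIV[OF x(1)] V_D(2)[OF P] by simp
  then have "(x ^ 4 - 1) * (x ^ 4 + 1) \<in> P" by (simp add: algebra_simps flip: power_add)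
  then have "x ^ 4 + 1 \<in> P" using P.prime x(2) by blast
  define u where "u = x ^ 2"
  have u: "u * u + 1 \<in> P" using \<open>x ^ 4 + 1 \<in> P\<close> by (simp add: u_def flip: power_add)
  have uP: "u \<notin> P" using P.power_mem x(1) unfolding u_def by blast
  have "card (graphs P Q) \<le> idx Q {y. y * y + 1 \<in> Q}"
  proof (rule card_graphs_le[OF PP, where u = u])
    fix S assume S: "srng S" "P \<subseteq> S" "u \<in> S"
    show "S = UNIV"
    proof (rule ccontr)
      assume "S \<noteq> UNIV"
      then have "\<exists>m\<ge>1. 2 * m \<le> 2 \<and> u ^ (3 ^ m - 1) - 1 \<in> P"
        using P.proper_srng_power[OF pr V_char(2)[OF P2 pr] _ S(1,2) _ S(3) uP, of 2] V_D(2)[OF P] by simp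
      then obtain m :: nat where m: "1 \<le> m" "2 * m \<le> 2" "u ^ (3 ^ m - 1) - 1 \<in> P" by blast
      then have "m = 1" by linarith
      then have "u * u - 1 \<in> P" using m(3) by (simp add: power2_eq_square)
      from asub_diff[OF P.asub three asub_diff[OF P.asub u this]] have "1 \<in> P" by simp
      then show False using P.one_notin by blast
    qed
  next
    fix M y assume M: "M \<in> C" "graph_type M P Q" and y: "y \<in> M" "y - u \<in> P"
    have "y * y * y + y \<in> M" using y C_srng[OF M(1)] by (intro asub_add srng_asub srng_mult)
    then have "y * (y * y + 1) \<in> M" by (simp add: distrib_left mult.assoc)
    moreover have "y \<notin> P" using asub_diff_mem[OF P.asub y(2)] uP by blast
    moreover have "y * y + 1 - (u * u + 1) \<in> P" using idl_diff_mult[OF P.idl y(2) y(2)] by simp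
    then have "y * y + 1 \<in> P" using u asub_diff_mem[OF P.asub] by blast
    ultimately have "y * y + 1 \<in> Q" using graph_type_transfer[OF M(1) PP M(2) y(1)] by blast
    then show "y \<in> {y. y * y + 1 \<in> Q}" by simp
  qed
  also have "\<dots> \<le> 2"
  proof (cases "\<exists>z. z * z + 1 \<in> Q")
    case True
    then obtain z where z: "z * z + 1 \<in> Q" by blast
    have "idx Q {y. y * y + 1 \<in> Q} \<le> card {z, - z}"
    proof (rule idx_le_card_reps[OF Q.asub])
      fix y assume "y \<in> {y. y * y + 1 \<in> Q}"
      then have "(y * y + 1) - (z * z + 1) + (y * z - z * y) \<in> Q"
        by (intro asub_add[OF Q.asub asub_diff[OF Q.asub _ z] Q.comm]) simp
      then have "(y - z) * (y - (- z)) \<in> Q" by (simp add: algebra_simps)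
      then show "\<exists>v\<in>{z, - z}. y - v \<in> Q" using Q.prime by blast
    qed simp
    also have "\<dots> \<le> 2" by (simp add: card_insert_le_m1)
    finally show ?thesis .
  qed simp
  finally show ?thesis .
qed

text \<open>The cube of a nonzero element that is no cube root of unity is a nontrivial fifth root
  of unity. It lies in no proper subring, where nonzero elements have order dividing 1 or 3.\<close>

lemma card_graphs_16:
  assumes P: "P \<in> V 16" and Q: "Q \<in> V 16"
  shows "card (graphs P Q) \<le> 5"
proof -
  have PP: "P \<in> PP" "Q \<in> PP" using P Q V_D by blast+
  interpret P: residue_field P using PP PP_rf by blast
  interpret Q: residue_field Q using PP PP_rf by blast
  have P4: "P \<in> V (2 ^ 4)" using P by simp
  obtain x where x: "x \<notin> P" "x ^ 3 - 1 \<notin> P"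
    using P.exists_not_root_of_unity[of 3] V_D(2)[OF P] by auto
  have "x ^ (16 - 1) - 1 \<in> P" using P.pow_idx_UNIV[OF x(1)] V_D(2)[OF P] by simp
  define u where "u = x ^ 3"
  have u5: "u ^ 5 - 1 \<in> P" using \<open>x ^ (16 - 1) - 1 \<in> P\<close> by (simp add: u_def flip: power_mult)
  have uP: "u \<notin> P" using P.power_mem x(1) unfolding u_def by blast
  have u1: "u - 1 \<notin> P" using x(2) by (simp add: u_def)
  have u3: "u ^ 3 - 1 \<notin> P"
  proof
    assume a: "u ^ 3 - 1 \<in> P"
    \<comment> \<open>This combination equals \<open>u - 1\<close>.\<close>
    have "(u ^ 3 + 1) * (u ^ 3 - 1) - u * (u ^ 5 - 1) \<in> P"
      by (rule asub_diff[OF P.asub idl_left[OF P.idl a] idl_left[OF P.idl u5]])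
    then show False using u1 by (simp add: algebra_simps eval_nat_numeral)
  qed
  have "card (graphs P Q) \<le> idx Q {y. y ^ 5 - 1 \<in> Q}"
  proof (rule card_graphs_le[OF PP, where u = u])
    fix S assume S: "srng S" "P \<subseteq> S" "u \<in> S"
    show "S = UNIV"
    proof (rule ccontr)
      assume "S \<noteq> UNIV"
      then have "\<exists>m\<ge>1. 2 * m \<le> 4 \<and> u ^ (2 ^ m - 1) - 1 \<in> P"
        using P.proper_srng_power[OF two_is_prime_nat V_char(2)[OF P4 two_is_prime_nat] _ S(1,2) _ S(3) uP, of 4]
          V_D(2)[OF P] by simp
      then obtain m :: nat where m: "1 \<le> m" "2 * m \<le> 4" "u ^ (2 ^ m - 1) - 1 \<in> P" by blast
      then have "m = 1 \<or> m = 2" by linarith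
      then show False using m(3) u1 u3 by auto
    qed
  next
    fix M y assume M: "M \<in> C" "graph_type M P Q" and y: "y \<in> M" "y - u \<in> P"
    have "y ^ 6 - y \<in> M" using y C_srng[OF M(1)] by (intro asub_diff srng_asub srng_pow) simp_all
    then have "y * (y ^ 5 - 1) \<in> M" by (simp add: right_diff_distrib eval_nat_numeral)
    moreover have "y \<notin> P" using asub_diff_mem[OF P.asub y(2)] uP by blast
    moreover have "y ^ 5 - 1 - (u ^ 5 - 1) \<in> P" using idl_diff_power[OF P.idl y(2), of 5] by simp
    then have "y ^ 5 - 1 \<in> P" using u5 asub_diff_mem[OF P.asub] by blast
    ultimately have "y ^ 5 - 1 \<in> Q" using graph_type_transfer[OF M(1) PP M(2) y(1)] by blast
    then show "y \<in> {y. y ^ 5 - 1 \<in> Q}" by simp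
  qed
  also have "\<dots> \<le> 5" by (rule Q.card_roots_of_unity) simp
  finally show ?thesis .
qed

lemma incidence_bound:
  assumes "\<And>P. P \<in> V q \<Longrightarrow> r \<le> card (GT P) + 2 * card (KT P)"
  shows "card (V q) * r \<le> 26"
proof -
  have "card (V q) * r = (\<Sum>P\<in>V q. r)" by simp
  also have "\<dots> \<le> (\<Sum>P\<in>V q. card (GT P) + 2 * card (KT P))" using assms by (rule sum_mono)
  also have "\<dots> \<le> 26" by (rule incidence_count[OF V_PP])
  finally show ?thesis .
qed

lemma contradiction: False
proof -
  have "1 \<notin> K"
  proof
    assume "1 \<in> K"
    then have "K = UNIV" using K(1) idl_eq_UNIV by blast
    moreover obtain M where "M \<in> C" using cover by blast
    ultimately show False using C_K C_proper by blast
  qed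
  then obtain P0 where P0: "P0 \<in> PP" using exists_PP[OF K(1) subset_refl] by blast
  interpret P0: residue_field P0 using P0 by (rule PP_rf)
  obtain p where p: "prime p" "\<And>S. asub S \<Longrightarrow> P0 \<subseteq> S \<Longrightarrow> \<exists>m. idx P0 S = p ^ m"
    using P0.char_exists by blast
  obtain n where n: "idx P0 UNIV = p ^ n" using p(2)[OF asub_UNIV] by blast
  have n0: "0 < n" using n P0.one_less_idx by (cases n) simp_all
  define q where "q = p ^ n"
  define N where "N = card (V q)"
  have P0V: "P0 \<in> V q" using P0 n by (simp add: V_def q_def)
  have N0: "0 < N" using P0V finite_V by (auto simp: N_def card_gt_0_iff)
  have p2: "2 \<le> p" using p(1) by (rule prime_ge_2_nat)
  let ?U = "1 + (\<Sum>m\<le>n div 2. p ^ m - 1)"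
  have U: "q \<le> ?U + card (GT P)" if "P \<in> V q" for P
  proof -
    have PP: "P \<in> PP" "idx P UNIV = q" using that V_D by blast+
    have "card (coset P ` \<Union>(KT P)) \<le> ?U"
      using KT_residues[OF PP(1) p(1) V_char(2)] that p(1) n0 PP(2) by (simp add: q_def)
    then show ?thesis using residue_count[OF PP(1)] PP(2) by linarith
  qed
  have U0: "q \<le> card (GT P)" if "P \<in> V q" "KT P = {}" for P
  proof -
    have PP: "P \<in> PP" "idx P UNIV = q" using that V_D by blast+
    then show ?thesis using residue_count[OF PP(1)] that(2) by simp
  qed
  have s1: "(\<Sum>m\<le>1. p ^ m - 1) = p - 1" by simp
  have s2: "(\<Sum>m\<le>2. p ^ m - 1) = (p - 1) + (p ^ 2 - 1)" by (simp add: numeral_2_eq_2)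
  have kt: "1 \<le> card (KT P)" if "KT P \<noteq> {}" for P
    using that finite_KT[of P] card_gt_0_iff[of "KT P"] by linarith
  have sq: "p ^ (n div 2) * p ^ (n div 2) \<le> q"
  proof -
    have "p ^ (n div 2 + n div 2) \<le> p ^ n" using p2 by (intro power_increasing) simp_all
    then show ?thesis by (simp add: power_add q_def)
  qed
  \<comment> \<open>With \<open>s = p ^ (n div 2)\<close> the count gives
    \<open>s * s \<le> q \<le> 2 * s + 12\<close>. For \<open>s \<ge> 5\<close> the left side is at
    least \<open>5 * s\<close>, which exceeds the right side; hence
    \<open>s \<le> 4\<close>.\<close>
  have "q \<le> 20"
  proof -
    define s where "s = p ^ (n div 2)"
    have "q \<le> ?U + 13" using U[OF P0V] card_GT_KT[of P0] by linarith
    moreover have "?U + 1 \<le> 2 * s" using sum_prime_powers_le[OF p2, of "n div 2"] by (simp add: s_def)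
    ultimately have qs: "q \<le> 2 * s + 12" by linarith
    have "s \<le> 4"
    proof (rule ccontr)
      assume "\<not> s \<le> 4"
      then have "5 * s \<le> s * s" by simp
      then show False using sq qs \<open>\<not> s \<le> 4\<close> unfolding s_def[symmetric] by linarith
    qed
    then show ?thesis using qs by linarith
  qed
  have GT: "card (GT P) \<le> m * (N - 1)"
    if "P \<in> V q" "\<And>P Q. P \<in> V q \<Longrightarrow> Q \<in> V q \<Longrightarrow> card (graphs P Q) \<le> m" for P m
    unfolding N_def using that by (intro card_GT_le) simp_all
  have "n \<le> 4"
  proof (rule ccontr)
    assume "\<not> n \<le> 4"
    then have "p ^ 5 \<le> p ^ n" using p2 by (intro power_increasing) simp_all
    moreover have "2 ^ 5 \<le> p ^ 5" using p2 by (rule power_mono) simp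
    ultimately show False using \<open>q \<le> 20\<close> by (simp add: q_def)
  qed
  then consider "n = 1" | "n = 2" | "n = 3" | "n = 4" using n0 by linarith
  then show False
  proof cases
    case 1
    then have q: "q = p" by (simp add: q_def)
    \<comment> \<open>For a prime field the members of \<open>KT P\<close> reach only the residue 0,
      which leaves \<open>p - 1\<close> residues to graphs.\<close>
    have g: "p \<le> 1 + card (GT P)" if "P \<in> V q" for P using U[OF that] 1 by (simp add: q)
    have mult: "card (GT P) \<le> N - 1" if "P \<in> V q" for P
      using GT[OF that, of 1] card_graphs_prime[OF _ _ p(1)] q by simp
    have pN: "p \<le> N" using g[OF P0V] mult[OF P0V] N0 by linarith
    \<comment> \<open>If \<open>KT P\<close> is empty, there are at least \<open>p\<close> graphs;
      otherwise at least \<open>p - 1\<close>, plus a member of weight 2.\<close>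
    have bound: "p \<le> card (GT P) + 2 * card (KT P)" if "P \<in> V q" for P
      using g[OF that] U0[OF that] kt[of P] q by (cases "KT P = {}") auto
    have Np: "N * p \<le> 26" unfolding N_def using bound by (rule incidence_bound)
    have "p * p \<le> 26" using Np pN mult_le_mono1[of p N p] by linarith
    have "p \<le> 5"
    proof (rule ccontr)
      assume "\<not> p \<le> 5"
      then have "6 * 6 \<le> p * p" by (intro mult_le_mono) simp_all
      then show False using \<open>p * p \<le> 26\<close> by simp
    qed
    moreover have "p \<noteq> 4" using p(1) by auto
    ultimately consider "p = 2" | "p = 3" | "p = 5" using p2 by linarith
    then show False
    proof cases
      case 1
      then have "2 \<le> card (V 2)" using pN q by (simp add: N_def)
      then show False using two_distinct not_cov_V2 by metis
    next
      case 2
      then have "3 \<le> card (V 3)" using pN q by (simp add: N_def)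
      then show False using three_distinct not_cov_V3 by metis
    next
      case 3
      then have N5: "N = 5" using pN Np by simp
      \<comment> \<open>At most 4 graphs involve \<open>P\<close>, too few for 5 residues, so
        \<open>KT P\<close> is nonempty and the weight is at least \<open>4 + 2\<close>. Five
        coordinates then need 30 > 26.\<close>
      have "6 \<le> card (GT P) + 2 * card (KT P)" if P: "P \<in> V q" for P
      proof -
        have "KT P \<noteq> {}" using U0[OF P] mult[OF P] N5 3 q by auto
        then show ?thesis using g[OF P] kt[of P] 3 by linarith
      qed
      then have "N * 6 \<le> 26" unfolding N_def by (rule incidence_bound)
      then show False using N5 by simp
    qed
  next
    case 2
    have "p \<le> 4"
    proof (rule ccontr)
      assume "\<not> p \<le> 4"
      then have "5 ^ 2 \<le> p ^ 2" by (intro power_mono) simp_all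
      then show False using \<open>q \<le> 20\<close> 2 by (simp add: q_def)
    qed
    moreover have "p \<noteq> 4" using p(1) by auto
    ultimately consider "p = 2" | "p = 3" using p2 by linarith
    then show False
    proof cases
      case 1
      then have q: "q = 4" using 2 by (simp add: q_def)
      have "0 < card (GT P0)" using U[OF P0V] 1 2 q s1 by simp
      \<comment> \<open>The trivial bound 13 on the graphs suffices, as only a second coordinate is
        to be found.\<close>
      moreover have "card (GT P0) \<le> 13 * (N - 1)"
      proof (rule GT[OF P0V])
        fix P Q show "card (graphs P Q) \<le> 13"
          using card_mono[OF finite_C, of "graphs P Q"] card_C by (auto simp: graphs_def)
      qed
      ultimately have "2 \<le> card (V 4)" using q by (simp add: N_def)
      then show False using two_distinct not_cov_V4 by metis
    next
      case 3: 2
      then have q: "q = 9" using 2 by (simp add: q_def)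
      \<comment> \<open>Proper subrings reach at most 3 of the 9 residues. With two graphs per pair
        this needs at least 4 coordinates, each of weight at least 8, and
        \<open>4 * 8 > 26\<close>.\<close>
      have g: "6 \<le> card (GT P)" if "P \<in> V q" for P using U[OF that] 3 2 q s1 by simp
      have "card (GT P0) \<le> 2 * (N - 1)" using GT[OF P0V] card_graphs_9 q by simp
      then have "4 \<le> N" using g[OF P0V] by linarith
      moreover have "8 \<le> card (GT P) + 2 * card (KT P)" if "P \<in> V q" for P
        using g[OF that] U0[OF that] kt[of P] q by (cases "KT P = {}") auto
      then have "N * 8 \<le> 26" unfolding N_def by (rule incidence_bound)
      ultimately show False by linarith
    qed
  next
    case 3
    have "p = 2"
    proof (rule ccontr)
      assume "p \<noteq> 2"
      then have "3 ^ 3 \<le> p ^ 3" using p2 by (intro power_mono) simp_all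
      then show False using \<open>q \<le> 20\<close> 3 by (simp add: q_def)
    qed
    then have q: "q = 8" using 3 by (simp add: q_def)
    \<comment> \<open>Proper subrings reach at most 2 of the 8 residues, and a single partner would
      admit only 4 graphs.\<close>
    have "6 \<le> card (GT P0)" using U[OF P0V] 3 \<open>p = 2\<close> q s1 by simp
    moreover have "card (GT P0) \<le> 4 * (N - 1)" using GT[OF P0V] card_graphs_8 q by simp
    ultimately have "3 \<le> card (V 8)" using q by (simp add: N_def)
    then show False using three_distinct not_cov_V8 by metis
  next
    case 4
    have "p = 2"
    proof (rule ccontr)
      assume "p \<noteq> 2"
      then have "3 ^ 4 \<le> p ^ 4" using p2 by (intro power_mono) simp_all
      then show False using \<open>q \<le> 20\<close> 4 by (simp add: q_def)
    qed
    then have q: "q = 16" using 4 by (simp add: q_def)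
    \<comment> \<open>Proper subrings reach at most \<open>1 + 1 + 3\<close> of the 16 residues. At
      least 4 coordinates with 11 graphs each exceed the total weight 26.\<close>
    have g: "11 \<le> card (GT P)" if "P \<in> V q" for P using U[OF that] 4 \<open>p = 2\<close> q s2 by simp
    have "card (GT P0) \<le> 5 * (N - 1)" using GT[OF P0V] card_graphs_16 q by simp
    then have "4 \<le> N" using g[OF P0V] by linarith
    moreover have "11 \<le> card (GT P) + 2 * card (KT P)" if "P \<in> V q" for P using g[OF that] by simp
    then have "N * 11 \<le> 26" unfolding N_def by (rule incidence_bound)
    ultimately show False by linarith
  qed
qed

end

lemma (in critical) contradiction: False
proof -
  obtain C where C: "finite C" "card C \<le> 13" "\<Union>C = UNIV"
    "\<And>M. M \<in> C \<Longrightarrow> srng M \<and> M \<noteq> UNIV \<and> K \<subseteq> M \<and> (\<forall>T. srng T \<longrightarrow> M \<subseteq> T \<longrightarrow> T = M \<or> T = UNIV)"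
    using cov_maximal[OF cov_13 K] by metis
  interpret critical_cover K J C
  proof
    fix M T assume "M \<in> C" "srng T" "M \<subseteq> T"
    then show "T = M \<or> T = UNIV" using C(4)[of M] by blast
  qed (use C in simp_all)
  show False by (rule contradiction)
qed

text \<open>\<open>nil\<close> is asked only for ideals of finite index, since the radical of an
  infinite ring need not be nil. A largest ideal of finite index whose quotient still has a cover by
  13 is critical, and having no cover by 12 passes to quotients.\<close>

lemma cov_13_imp_cov_12:
  assumes K0: "idl K0" "cov K0 13" and J: "idl J" "\<And>a b. a * b - b * a \<in> J"
    and nil: "\<And>K j. idl K \<Longrightarrow> fin_ix K \<Longrightarrow> K0 \<subseteq> K \<Longrightarrow> j \<in> J \<Longrightarrow> \<exists>n. j ^ n \<in> K"
  shows "cov K0 12"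
proof (rule ccontr)
  assume not12: "\<not> cov K0 12"
  obtain K1 where K1: "idl K1" "K0 \<subseteq> K1" "fin_ix K1" "cov K1 13" using cov_fin_ix[OF K0(2,1)] by blast
  obtain K where K: "idl K" "K1 \<subseteq> K" "cov K 13" "\<And>T. idl T \<Longrightarrow> cov T 13 \<Longrightarrow> K \<subseteq> T \<Longrightarrow> T = K"
    using exists_maximal_idl[OF K1(1,3,1) subset_refl, of "\<lambda>T. cov T 13"] K1(4) by metis
  interpret critical K J
  proof
    show "fin_ix K" using fin_ix_mono K1 K idl_asub by metis
    then show "\<exists>n. j ^ n \<in> K" if "j \<in> J" for j using nil[OF K(1)] that K1(2) K(2) by blast
    show "\<not> cov K 12" using not12 cov_antimono K1(2) K(2) by blast
    show "\<not> cov I 13" if "idl I" "K \<subset> I" for I using K(4)[of I] that by blast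
  qed (use K J in blast)+
  show False by (rule contradiction)
qed

section \<open>Free rings\<close>

datatype 'a rterm = RVar 'a | RZero | ROne | RAdd "'a rterm" "'a rterm" | RNeg "'a rterm"
  | RMul "'a rterm" "'a rterm"

inductive req :: "'a rterm \<Rightarrow> 'a rterm \<Rightarrow> bool" where
  req_refl: "req s s"
| req_sym: "req s t \<Longrightarrow> req t s"
| req_trans: "req s t \<Longrightarrow> req t u \<Longrightarrow> req s u"
| req_add: "req s s' \<Longrightarrow> req t t' \<Longrightarrow> req (RAdd s t) (RAdd s' t')"
| req_neg: "req s s' \<Longrightarrow> req (RNeg s) (RNeg s')"
| req_mul: "req s s' \<Longrightarrow> req t t' \<Longrightarrow> req (RMul s t) (RMul s' t')"
| req_add_assoc: "req (RAdd (RAdd s t) u) (RAdd s (RAdd t u))"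
| req_add_comm: "req (RAdd s t) (RAdd t s)"
| req_add_zero: "req (RAdd RZero s) s"
| req_add_neg: "req (RAdd (RNeg s) s) RZero"
| req_mul_assoc: "req (RMul (RMul s t) u) (RMul s (RMul t u))"
| req_mul_one_left: "req (RMul ROne s) s"
| req_mul_one_right: "req (RMul s ROne) s"
| req_distrib_right: "req (RMul (RAdd s t) u) (RAdd (RMul s u) (RMul t u))"
| req_distrib_left: "req (RMul s (RAdd t u)) (RAdd (RMul s t) (RMul s u))"

quotient_type 'a free_ring = "'a rterm" / req
  by (rule equivpI) (auto intro!: reflpI sympI transpI intro: req_refl req_sym req_trans)

text \<open>Variables range over the whole type; those outside the carrier go to zero, so that
  evaluation is total with values in the carrier.\<close>

primrec reval :: "('a, 'b) ring_scheme \<Rightarrow> 'a rterm \<Rightarrow> 'a" where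
  "reval R (RVar a) = (if a \<in> carrier R then a else \<zero>\<^bsub>R\<^esub>)"
| "reval R RZero = \<zero>\<^bsub>R\<^esub>"
| "reval R ROne = \<one>\<^bsub>R\<^esub>"
| "reval R (RAdd s t) = reval R s \<oplus>\<^bsub>R\<^esub> reval R t"
| "reval R (RNeg s) = \<ominus>\<^bsub>R\<^esub> reval R s"
| "reval R (RMul s t) = reval R s \<otimes>\<^bsub>R\<^esub> reval R t"

lemma reval_closed: "Ring.ring R \<Longrightarrow> reval R s \<in> carrier R"
proof (induction s)
  case (RNeg s)
  then interpret Ring.ring R by simp
  show ?case using RNeg by simp
qed (auto simp: Ring.ring.ring_simprules)

lemma (in Ring.ring) req_reval: "req s t \<Longrightarrow> reval R s = reval R t"
  by (induction rule: req.induct)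
    (simp_all add: reval_closed[OF ring_axioms] a_ac l_neg r_neg m_assoc l_distr r_distr)

text \<open>Evaluating all variables at 0 in the integers separates 0 from 1.\<close>

primrec rdegree :: "'a rterm \<Rightarrow> int" where
  "rdegree (RVar a) = 0"
| "rdegree RZero = 0"
| "rdegree ROne = 1"
| "rdegree (RAdd s t) = rdegree s + rdegree t"
| "rdegree (RNeg s) = - rdegree s"
| "rdegree (RMul s t) = rdegree s * rdegree t"

lemma req_rdegree: "req s t \<Longrightarrow> rdegree s = rdegree t"
  by (induction rule: req.induct) (simp_all add: algebra_simps)

instantiation free_ring :: (type) ring_1
begin

lift_definition zero_free_ring :: "'a free_ring" is RZero .
lift_definition one_free_ring :: "'a free_ring" is ROne .
lift_definition plus_free_ring :: "'a free_ring \<Rightarrow> 'a free_ring \<Rightarrow> 'a free_ring" is RAdd by (rule req_add)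
lift_definition uminus_free_ring :: "'a free_ring \<Rightarrow> 'a free_ring" is RNeg by (rule req_neg)
lift_definition times_free_ring :: "'a free_ring \<Rightarrow> 'a free_ring \<Rightarrow> 'a free_ring" is RMul by (rule req_mul)
lift_definition minus_free_ring :: "'a free_ring \<Rightarrow> 'a free_ring \<Rightarrow> 'a free_ring" is "\<lambda>s t. RAdd s (RNeg t)"
  by (intro req_add req_neg)

instance
proof
  fix a b c :: "'a free_ring"
  show "a * b * c = a * (b * c)" by transfer (rule req_mul_assoc)
  show "1 * a = a" by transfer (rule req_mul_one_left)
  show "a * 1 = a" by transfer (rule req_mul_one_right)
  show "a + b + c = a + (b + c)" by transfer (rule req_add_assoc)
  show "a + b = b + a" by transfer (rule req_add_comm)
  show "0 + a = a" by transfer (rule req_add_zero)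
  show "- a + a = 0" by transfer (rule req_add_neg)
  show "a - b = a + - b" by transfer (rule req_refl)
  show "(a + b) * c = a * c + b * c" by transfer (rule req_distrib_right)
  show "a * (b + c) = a * b + a * c" by transfer (rule req_distrib_left)
  show "(0 :: 'a free_ring) \<noteq> 1" by transfer (auto dest: req_rdegree)
qed

end

definition ev :: "('a, 'b) ring_scheme \<Rightarrow> 'a free_ring \<Rightarrow> 'a" where
  "ev R x = reval R (rep_free_ring x)"

lemma ev_abs: "Ring.ring R \<Longrightarrow> ev R (abs_free_ring s) = reval R s"
  unfolding ev_def
  by (rule ring.req_reval) (simp_all add: rep_abs_rsp_left[OF Quotient3_free_ring] req_refl)

lemma additive_subgroup_iff:
  assumes "Ring.ring R"
  shows "additive_subgroup S R \<longleftrightarrow> S \<subseteq> carrier R \<and> \<zero>\<^bsub>R\<^esub> \<in> S \<and> (\<forall>x\<in>S. \<forall>y\<in>S. x \<ominus>\<^bsub>R\<^esub> y \<in> S)"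
proof -
  interpret R: Ring.ring R by fact
  show ?thesis
  proof (intro iffI conjI ballI)
    assume S: "additive_subgroup S R"
    then show sub: "S \<subseteq> carrier R" by (rule additive_subgroup.a_subset)
    show "\<zero>\<^bsub>R\<^esub> \<in> S" using S by (rule additive_subgroup.zero_closed)
    fix x y assume xy: "x \<in> S" "y \<in> S"
    have "inv\<^bsub>add_monoid R\<^esub> y \<in> S"
      using additive_subgroup.a_subgroup[OF S] xy(2) by (rule subgroup.m_inv_closed)
    then have "\<ominus>\<^bsub>R\<^esub> y \<in> S" by (simp add: a_inv_def)
    then show "x \<ominus>\<^bsub>R\<^esub> y \<in> S" unfolding a_minus_def using S xy(1) by (intro additive_subgroup.a_closed)
  next
    assume S: "S \<subseteq> carrier R \<and> \<zero>\<^bsub>R\<^esub> \<in> S \<and> (\<forall>x\<in>S. \<forall>y\<in>S. x \<ominus>\<^bsub>R\<^esub> y \<in> S)"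
    have neg: "\<ominus>\<^bsub>R\<^esub> y \<in> S" if y: "y \<in> S" for y
    proof -
      have "\<zero>\<^bsub>R\<^esub> \<ominus>\<^bsub>R\<^esub> y \<in> S" "y \<in> carrier R" using S y by auto
      then show ?thesis by (simp add: a_minus_def)
    qed
    have "x \<oplus>\<^bsub>R\<^esub> y \<in> S" if xy: "x \<in> S" "y \<in> S" for x y
    proof -
      have "x \<ominus>\<^bsub>R\<^esub> (\<ominus>\<^bsub>R\<^esub> y) \<in> S" "y \<in> carrier R" using S xy neg by auto
      then show ?thesis by (simp add: a_minus_def)
    qed
    moreover have "inv\<^bsub>add_monoid R\<^esub> y \<in> S" if "y \<in> S" for y using neg[OF that] by (simp add: a_inv_def)
    ultimately have "subgroup S (add_monoid R)" using S by unfold_locales auto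
    then show "additive_subgroup S R" by (rule additive_subgroupI)
  qed
qed

section \<open>Covers of the ring and covers relative to the kernel of evaluation\<close>

context Ring.ring
begin

lemma ev_closed: "ev R x \<in> carrier R"
  unfolding ev_def by (rule reval_closed[OF ring_axioms])

lemma ev_simps:
  "ev R 0 = \<zero>" "ev R 1 = \<one>" "ev R (x + y) = ev R x \<oplus> ev R y" "ev R (- x) = \<ominus> ev R x"
  "ev R (x * y) = ev R x \<otimes> ev R y" "ev R (x - y) = ev R x \<ominus> ev R y"
proof -
  have r: "abs_free_ring (rep_free_ring z) = z" for z :: "'a free_ring"
    by (rule Quotient3_abs_rep[OF Quotient3_free_ring])
  note e = ev_abs[OF ring_axioms]
  show "ev R 0 = \<zero>" "ev R 1 = \<one>" by (simp_all add: zero_free_ring_def one_free_ring_def e)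
  show "ev R (x + y) = ev R x \<oplus> ev R y"
    using e[of "RAdd (rep_free_ring x) (rep_free_ring y)"] by (simp add: r ev_def flip: plus_free_ring.abs_eq)
  show "ev R (- x) = \<ominus> ev R x"
    using e[of "RNeg (rep_free_ring x)"] by (simp add: r ev_def flip: uminus_free_ring.abs_eq)
  show "ev R (x * y) = ev R x \<otimes> ev R y"
    using e[of "RMul (rep_free_ring x) (rep_free_ring y)"] by (simp add: r ev_def flip: times_free_ring.abs_eq)
  show "ev R (x - y) = ev R x \<ominus> ev R y"
    using e[of "RAdd (rep_free_ring x) (RNeg (rep_free_ring y))"]
    by (simp add: r ev_def a_minus_def flip: minus_free_ring.abs_eq)
qed

lemma ev_surj: "a \<in> carrier R \<Longrightarrow> \<exists>x. ev R x = a"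
  by (rule exI[of _ "abs_free_ring (RVar a)"]) (simp add: ev_abs[OF ring_axioms])

lemma range_ev: "range (ev R) = carrier R"
  using ev_closed ev_surj by (metis UNIV_I image_subset_iff subsetI subset_antisym imageI)

abbreviation ker_ev :: "'a free_ring set" where
  "ker_ev \<equiv> {x. ev R x = \<zero>}"

lemma ev_eq_iff: "ev R x = ev R y \<longleftrightarrow> x - y \<in> ker_ev"
  using ev_closed by (simp add: ev_simps)

lemma ker_ev_idl: "idl ker_ev"
  by (intro idlI asubI) (simp_all add: ev_simps ev_closed)

lemma asub_vimage_ev: "additive_subgroup S R \<Longrightarrow> asub (ev R -` S)"
  unfolding additive_subgroup_iff[OF ring_axioms] by (intro asubI) (simp_all add: ev_simps)

lemma additive_subgroup_image_ev: "asub T \<Longrightarrow> additive_subgroup (ev R ` T) R"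
  unfolding additive_subgroup_iff[OF ring_axioms]
proof (intro conjI ballI)
  assume T: "asub T"
  show "ev R ` T \<subseteq> carrier R" using ev_closed by blast
  have "ev R 0 \<in> ev R ` T" using asub_0[OF T] by (rule imageI)
  then show "\<zero> \<in> ev R ` T" by (simp add: ev_simps)
  fix a b assume "a \<in> ev R ` T" "b \<in> ev R ` T"
  then obtain x y where "a = ev R x" "b = ev R y" "x \<in> T" "y \<in> T" by blast
  then have "a \<ominus> b = ev R (x - y)" "x - y \<in> T" using asub_diff[OF T] by (simp_all add: ev_simps)
  then show "a \<ominus> b \<in> ev R ` T" by blast
qed

lemma image_ev_mem: "asub T \<Longrightarrow> ker_ev \<subseteq> T \<Longrightarrow> ev R x \<in> ev R ` T \<longleftrightarrow> x \<in> T"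
proof
  assume T: "asub T" "ker_ev \<subseteq> T" and "ev R x \<in> ev R ` T"
  then obtain y where "y \<in> T" "ev R x = ev R y" by blast
  then show "x \<in> T" using T ev_eq_iff asub_diff_mem by blast
qed blast

lemma cov_of_ring_cover:
  assumes "ring_cover C R" "finite C" "card C \<le> n"
  shows "cov ker_ev n"
  unfolding cov_def
proof (intro exI conjI ballI)
  have C: "nonunital_subring S R" "S \<noteq> carrier R" if "S \<in> C" for S
    using assms(1) that by (simp_all add: ring_cover_def)
  let ?D = "(\<lambda>S. ev R -` S) ` C"
  show "finite ?D" using assms by simp
  show "card ?D \<le> n" using card_image_le[OF assms(2), of "\<lambda>S. ev R -` S"] assms(3) by linarith
  have "\<Union>C = carrier R" using assms(1) by (simp add: ring_cover_def)
  then have "x \<in> \<Union>?D" for x using ev_closed[of x] by blast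
  then show "\<Union>?D = UNIV" by blast
  fix M assume "M \<in> ?D"
  then obtain S where S: "S \<in> C" "M = ev R -` S" by blast
  have s: "additive_subgroup S R" "\<And>a b. a \<in> S \<Longrightarrow> b \<in> S \<Longrightarrow> a \<otimes> b \<in> S"
    using C(1)[OF S(1)] by (simp_all add: nonunital_subring_def)
  show "srng M" unfolding S(2) using s(2) by (intro srngI asub_vimage_ev[OF s(1)]) (simp add: ev_simps)
  show "ker_ev \<subseteq> M" using s(1) by (auto simp: S(2) additive_subgroup_iff[OF ring_axioms])
  show "M \<noteq> UNIV"
  proof
    assume "M = UNIV"
    then have "x \<in> ev R -` S" for x unfolding S(2) by simp
    then have "range (ev R) \<subseteq> S" by blast
    then have "carrier R \<subseteq> S" unfolding range_ev .
    then show False using C(2)[OF S(1)] s(1) additive_subgroup.a_subset by blast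
  qed
qed

lemma ring_cover_of_cov:
  assumes "cov ker_ev n"
  obtains C where "ring_cover C R" "finite C" "card C \<le> n"
proof -
  obtain D where D: "finite D" "card D \<le> n" "\<Union>D = UNIV" "\<And>M. M \<in> D \<Longrightarrow> srng M \<and> M \<noteq> UNIV \<and> ker_ev \<subseteq> M"
    using assms unfolding cov_def by blast
  let ?C = "(\<lambda>M. ev R ` M) ` D"
  have "ring_cover ?C R"
    unfolding ring_cover_def
  proof (intro conjI ballI)
    have "\<Union>?C = ev R ` \<Union>D" by blast
    then show "\<Union>?C = carrier R" using D(3) range_ev by simp
    fix S assume "S \<in> ?C"
    then obtain M where M: "M \<in> D" "S = ev R ` M" by blast
    have m: "srng M" "M \<noteq> UNIV" "ker_ev \<subseteq> M" using D(4)[OF M(1)] by simp_all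
    show "nonunital_subring S R"
      unfolding nonunital_subring_def
    proof (intro conjI ballI)
      show "additive_subgroup S R" unfolding M(2) using srng_asub[OF m(1)] by (rule additive_subgroup_image_ev)
      fix a b assume "a \<in> S" "b \<in> S"
      then obtain x y where "a = ev R x" "b = ev R y" "x \<in> M" "y \<in> M" unfolding M(2) by blast
      then have "a \<otimes> b = ev R (x * y)" "x * y \<in> M" using srng_mult[OF m(1)] by (simp_all add: ev_simps)
      then show "a \<otimes> b \<in> S" unfolding M(2) by blast
    qed
    show "S \<noteq> carrier R"
    proof
      assume "S = carrier R"
      then have "x \<in> M" for x using image_ev_mem[OF srng_asub[OF m(1)] m(3), of x] ev_closed[of x] M(2) by simp
      then show False using m(2) by blast
    qed
  qed
  moreover have "card ?C \<le> n" using card_image_le[OF D(1), of "\<lambda>M. ev R ` M"] D(2) by linarith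
  ultimately show ?thesis using that D(1) by blast
qed

section \<open>Cosets of the Jacobson radical\<close>

lemma jacobson_left_ideal: "left_ideal (jacobson_radical R) R"
proof -
  have l: "additive_subgroup M R" "\<And>r a. r \<in> carrier R \<Longrightarrow> a \<in> M \<Longrightarrow> r \<otimes> a \<in> M"
    if "maximal_left_ideal M R" for M
    using that by (simp_all add: maximal_left_ideal_def left_ideal_def)
  show ?thesis
    unfolding left_ideal_def additive_subgroup_iff[OF ring_axioms]
    using l by (auto simp: jacobson_radical_def additive_subgroup_iff[OF ring_axioms])
qed

lemma mem_a_r_coset: "y \<in> S +> a \<longleftrightarrow> (\<exists>h\<in>S. y = h \<oplus> a)"
  by (auto simp: a_r_coset_def r_coset_def)

lemma jacobson_coset_product_mem:
  assumes "x \<in> jacobson_radical R +> a" "y \<in> jacobson_radical R +> b" "x \<in> carrier R" "y \<in> carrier R"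
  shows "x \<otimes> y \<in> rcoset_mult R (jacobson_radical R) (jacobson_radical R +> a) (jacobson_radical R +> b)"
proof -
  have "\<zero> \<in> jacobson_radical R"
    using jacobson_left_ideal by (auto simp: left_ideal_def additive_subgroup_iff[OF ring_axioms])
  then have "x \<otimes> y \<in> jacobson_radical R +> (x \<otimes> y)"
    unfolding mem_a_r_coset using assms(3,4) by (intro bexI[of _ \<zero>]) simp_all
  then show ?thesis unfolding rcoset_mult_def using assms(1,2) by blast
qed

context
  assumes quot: "Ring.cring (R Quot jacobson_radical R)"
begin

text \<open>From its definition the radical is visibly only a left ideal. The rest is read off from
  the quotient being a ring: its carrier is closed under \<open>rcoset_mult\<close>, so this union
  of cosets is a single coset.\<close>

lemma jacobson_quot_product:
  assumes a: "a \<in> carrier R" and b: "b \<in> carrier R"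
  defines "J \<equiv> jacobson_radical R"
  shows "\<exists>c\<in>carrier R. rcoset_mult R J (J +> a) (J +> b) = J +> c"
proof -
  interpret Q: Ring.cring "R Quot J" unfolding J_def by (rule quot)
  have "J +> a \<in> carrier (R Quot J)" "J +> b \<in> carrier (R Quot J)"
    using a b by (auto simp: FactRing_def A_RCOSETS_defs a_r_coset_def)
  then have "(J +> a) \<otimes>\<^bsub>R Quot J\<^esub> (J +> b) \<in> carrier (R Quot J)" by (rule Q.m_closed)
  then show ?thesis by (auto simp: FactRing_def A_RCOSETS_defs a_r_coset_def)
qed

lemma jacobson_coset_product_diff:
  assumes "a \<in> carrier R" "b \<in> carrier R"
    "x \<in> rcoset_mult R (jacobson_radical R) (jacobson_radical R +> a) (jacobson_radical R +> b)"
    "y \<in> rcoset_mult R (jacobson_radical R) (jacobson_radical R +> a) (jacobson_radical R +> b)"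
  shows "x \<ominus> y \<in> jacobson_radical R"
proof -
  let ?J = "jacobson_radical R"
  have J: "?J \<subseteq> carrier R" "\<And>x y. x \<in> ?J \<Longrightarrow> y \<in> ?J \<Longrightarrow> x \<ominus> y \<in> ?J"
    using jacobson_left_ideal by (auto simp: left_ideal_def additive_subgroup_iff[OF ring_axioms])
  obtain c where c: "c \<in> carrier R" "rcoset_mult R ?J (?J +> a) (?J +> b) = ?J +> c"
    using jacobson_quot_product[OF assms(1,2)] by blast
  obtain h h' where h: "h \<in> ?J" "h' \<in> ?J" "x = h \<oplus> c" "y = h' \<oplus> c"
    using assms(3,4) unfolding c(2) mem_a_r_coset by blast
  have "h \<in> carrier R" "h' \<in> carrier R" using h(1,2) J(1) by auto
  then have "(h \<oplus> c) \<ominus> (h' \<oplus> c) = h \<ominus> h'" using c(1) by algebra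
  then show ?thesis using h J(2) by simp
qed

end

end

section \<open>The Jacobson radical and the main theorem\<close>

context Ring.ring
begin

text \<open>Otherwise \<open>1 - j\<close> and \<open>K\<close> generate a proper left ideal. A
  maximal one above it exists because \<open>K\<close> has finite index; its image is a maximal left
  ideal of the ring and contains the image of \<open>j\<close>, so the ideal contains 1.\<close>

lemma left_ideal_jacobson_quasi_regular:
  assumes K: "idl K" "fin_ix K" "ker_ev \<subseteq> K" and j: "ev R j \<in> jacobson_radical R"
  shows "\<exists>u. u * (1 - j) - 1 \<in> K"
proof (rule ccontr)
  assume no: "\<nexists>u. u * (1 - j) - 1 \<in> K"
  have aK: "asub K" using K(1) by (rule idl_asub)
  let ?X = "{T. asub T \<and> K \<subseteq> T \<and> (\<forall>x\<in>T. \<forall>r. r * x \<in> T) \<and> 1 \<notin> T \<and> 1 - j \<in> T}"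
  define L where "L = {x. \<exists>u. u * (1 - j) - x \<in> K}"
  have "asub L"
  proof (rule asubI)
    show "0 \<in> L" unfolding L_def using asub_0[OF aK] by (intro CollectI exI[of _ 0]) simp
    fix x y assume "x \<in> L" "y \<in> L"
    then obtain u v where "u * (1 - j) - x \<in> K" "v * (1 - j) - y \<in> K" unfolding L_def by blast
    from asub_diff[OF aK this] have "(u - v) * (1 - j) - (x - y) \<in> K" by (simp add: algebra_simps)
    then show "x - y \<in> L" unfolding L_def by blast
  qed
  moreover have "K \<subseteq> L"
  proof
    fix x assume "x \<in> K"
    then have "0 * (1 - j) - x \<in> K" using asub_uminus[OF aK] by simp
    then show "x \<in> L" unfolding L_def by blast
  qed
  moreover have "r * x \<in> L" if x: "x \<in> L" for x r
  proof -
    obtain u where "u * (1 - j) - x \<in> K" using x unfolding L_def by blast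
    from idl_left[OF K(1) this, of r] have "(r * u) * (1 - j) - r * x \<in> K" by (simp add: algebra_simps)
    then show ?thesis unfolding L_def by blast
  qed
  moreover have "1 \<notin> L" using no unfolding L_def by blast
  moreover have "1 - j \<in> L" unfolding L_def using asub_0[OF aK] by (intro CollectI exI[of _ 1]) simp
  ultimately have LX: "L \<in> ?X" by blast
  have "finite ?X" by (rule finite_subset[OF _ finite_supergroups[OF K(2) aK]]) blast
  then have "\<exists>T\<in>?X. L \<subseteq> T \<and> (\<forall>T'\<in>?X. T \<subseteq> T' \<longrightarrow> T = T')" using LX by (rule finite_has_maximal2)
  then obtain T where T: "T \<in> ?X" "\<forall>T'\<in>?X. T \<subseteq> T' \<longrightarrow> T = T'" by (elim bexE conjE) (rule that)
  have aT: "asub T" and KT: "ker_ev \<subseteq> T" and lT: "\<And>r x. x \<in> T \<Longrightarrow> r * x \<in> T" and nT: "1 \<notin> T"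
    and jT: "1 - j \<in> T" using T(1) K(3) by auto
  have "maximal_left_ideal (ev R ` T) R"
    unfolding maximal_left_ideal_def
  proof (intro conjI allI impI)
    show "left_ideal (ev R ` T) R" unfolding left_ideal_def
    proof (intro conjI ballI)
      show "additive_subgroup (ev R ` T) R" using aT by (rule additive_subgroup_image_ev)
      fix r a assume "r \<in> carrier R" "a \<in> ev R ` T"
      then obtain y x where "r = ev R y" "a = ev R x" "x \<in> T" using ev_surj by (metis imageE)
      then have "r \<otimes> a = ev R (y * x)" "y * x \<in> T" using lT by (simp_all add: ev_simps)
      then show "r \<otimes> a \<in> ev R ` T" by blast
    qed
    show "ev R ` T \<noteq> carrier R"
      using image_ev_mem[OF aT KT, of 1] nT ev_closed[of 1] by blast
    fix I assume I: "left_ideal I R \<and> ev R ` T \<subseteq> I"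
    have Ia: "additive_subgroup I R" and Il: "\<And>r a. r \<in> carrier R \<Longrightarrow> a \<in> I \<Longrightarrow> r \<otimes> a \<in> I"
      using I by (simp_all add: left_ideal_def)
    have Isub: "I \<subseteq> carrier R" using Ia by (rule additive_subgroup.a_subset)
    have TI: "T \<subseteq> ev R -` I" using I by blast
    have img: "ev R ` (ev R -` I) = I" using Isub by (simp add: image_vimage_eq range_ev inf_absorb1)
    show "I = ev R ` T \<or> I = carrier R"
    proof (cases "1 \<in> ev R -` I")
      case True
      then have "\<one> \<in> I" by (simp add: ev_simps)
      then have "r \<in> I" if "r \<in> carrier R" for r using Il[OF that] that by force
      then show ?thesis using Isub by blast
    next
      case False
      have "asub (ev R -` I)" using Ia by (rule asub_vimage_ev)
      moreover have "K \<subseteq> ev R -` I" "1 - j \<in> ev R -` I" using TI T(1) by blast+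
      moreover have "r * x \<in> ev R -` I" if "x \<in> ev R -` I" for x r
        using that Il[OF ev_closed[of r]] by (simp add: ev_simps)
      ultimately have "ev R -` I \<in> ?X" using False by blast
      then have "T = ev R -` I" using T(2) TI by blast
      then show ?thesis using img by simp
    qed
  qed
  then have "ev R j \<in> ev R ` T" using j unfolding jacobson_radical_def by blast
  then have "j \<in> T" using image_ev_mem[OF aT KT] by blast
  then have "1 - j + j \<in> T" using asub_add[OF aT jT] by blast
  then show False using nT by simp
qed

context
  assumes quot: "Ring.cring (R Quot jacobson_radical R)"
begin

text \<open>For right multiples: if \<open>x\<close> is in the radical, the products of
  \<open>x\<close> and of 0 with \<open>r\<close> lie in the same product of cosets, so their
  difference is in the radical.\<close>

lemma jacobson_vimage_idl: "idl (ev R -` jacobson_radical R)"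
proof -
  let ?J = "jacobson_radical R"
  have aJ: "additive_subgroup ?J R" and lJ: "\<And>r a. r \<in> carrier R \<Longrightarrow> a \<in> ?J \<Longrightarrow> r \<otimes> a \<in> ?J"
    using jacobson_left_ideal by (simp_all add: left_ideal_def)
  have J0: "\<zero> \<in> ?J" using aJ by (rule additive_subgroup.zero_closed)
  have Jsub: "?J \<subseteq> carrier R" using aJ by (rule additive_subgroup.a_subset)
  show ?thesis
  proof (rule idlI)
    show "asub (ev R -` ?J)" using aJ by (rule asub_vimage_ev)
    fix x r assume "x \<in> ev R -` ?J"
    then have x: "ev R x \<in> ?J" by simp
    show "r * x \<in> ev R -` ?J" using lJ[OF ev_closed x] by (simp add: ev_simps)
    have c: "ev R x \<in> ?J +> \<zero>" "\<zero> \<in> ?J +> \<zero>" "ev R r \<in> ?J +> ev R r"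
      unfolding mem_a_r_coset using bexI[OF _ x, of "\<lambda>h. ev R x = h \<oplus> \<zero>"]
        bexI[OF _ J0, of "\<lambda>h. \<zero> = h \<oplus> \<zero>"] bexI[OF _ J0, of "\<lambda>h. ev R r = h \<oplus> ev R r"] ev_closed
      by simp_all
    have "ev R x \<otimes> ev R r \<ominus> \<zero> \<otimes> ev R r \<in> ?J"
      by (rule jacobson_coset_product_diff[OF quot zero_closed ev_closed
            jacobson_coset_product_mem[OF c(1,3) ev_closed ev_closed]
            jacobson_coset_product_mem[OF c(2,3) zero_closed ev_closed]])
    then show "x * r \<in> ev R -` ?J" using ev_closed by (simp add: ev_simps a_minus_def)
  qed
qed

lemma jacobson_vimage_commutator: "a * b - b * a \<in> ev R -` jacobson_radical R"
proof -
  let ?J = "jacobson_radical R"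
  have "additive_subgroup ?J R" using jacobson_left_ideal by (simp add: left_ideal_def)
  then have J0: "\<zero> \<in> ?J" by (rule additive_subgroup.zero_closed)
  interpret Q: Ring.cring "R Quot ?J" by (rule quot)
  have self: "x \<in> ?J +> x" if "x \<in> carrier R" for x
    using J0 that by (auto simp: mem_a_r_coset intro!: bexI[of _ \<zero>])
  note prod = jacobson_coset_product_mem[OF self[OF ev_closed] self[OF ev_closed] ev_closed ev_closed]
  have car: "?J +> x \<in> carrier (R Quot ?J)" if "x \<in> carrier R" for x
    using that by (auto simp: FactRing_def A_RCOSETS_defs a_r_coset_def)
  let ?a = "ev R a" and ?b = "ev R b"
  have "rcoset_mult R ?J (?J +> ?a) (?J +> ?b) = rcoset_mult R ?J (?J +> ?b) (?J +> ?a)"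
    using Q.m_comm[OF car[OF ev_closed[of a]] car[OF ev_closed[of b]]] by (simp add: FactRing_def)
  then have "?b \<otimes> ?a \<in> rcoset_mult R ?J (?J +> ?a) (?J +> ?b)"
    using prod[of b a] by simp
  moreover have "?a \<otimes> ?b \<in> rcoset_mult R ?J (?J +> ?a) (?J +> ?b)"
    by (rule prod)
  ultimately have "?a \<otimes> ?b \<ominus> ?b \<otimes> ?a \<in> ?J"
    using jacobson_coset_product_diff[OF quot ev_closed ev_closed] by blast
  then show ?thesis by (simp add: ev_simps)
qed

text \<open>Powers recur modulo \<open>K\<close>, so \<open>(1 - j ^ d) * j ^ m\<close> lies in
  \<open>K\<close> for some \<open>d > 0\<close>, and \<open>1 - j ^ d\<close> has a left inverse
  modulo \<open>K\<close> because \<open>j ^ d\<close> is in the radical.\<close>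

lemma jacobson_vimage_nil:
  assumes K: "idl K" "fin_ix K" "ker_ev \<subseteq> K" and j: "j \<in> ev R -` jacobson_radical R"
  shows "\<exists>n. j ^ n \<in> K"
proof -
  have aK: "asub K" using K(1) by (rule idl_asub)
  obtain m d :: nat where md: "0 < d" "j ^ (m + d) - j ^ m \<in> K"
    using fin_ix_recurrent[OF K(2) aK, of "\<lambda>n. j ^ n"] by blast
  have "j ^ d \<in> ev R -` jacobson_radical R"
    using srng_pow[OF idl_srng[OF jacobson_vimage_idl] j md(1)] .
  then obtain u where u: "u * (1 - j ^ d) - 1 \<in> K"
    using left_ideal_jacobson_quasi_regular[OF K, of "j ^ d"] by auto
  have "u * (j ^ m - j ^ (m + d)) - (u * (1 - j ^ d) - 1) * j ^ m \<in> K"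
    by (rule asub_diff[OF aK idl_left[OF K(1) asub_diff_commute[OF aK md(2)]] idl_right[OF K(1) u]])
  moreover have "j ^ (m + d) = j ^ d * j ^ m" by (simp add: add.commute flip: power_add)
  ultimately have "j ^ m \<in> K" by (simp add: algebra_simps)
  then show ?thesis by blast
qed

lemma ring_cover_12_of_13:
  assumes "ring_cover C R" "finite C" "card C \<le> 13"
  obtains D where "ring_cover D R" "finite D" "card D \<le> 12"
proof -
  have "cov ker_ev 12"
  proof (rule cov_13_imp_cov_12[OF ker_ev_idl cov_of_ring_cover[OF assms] jacobson_vimage_idl])
    show "a * b - b * a \<in> ev R -` jacobson_radical R" for a b by (rule jacobson_vimage_commutator)
  qed (rule jacobson_vimage_nil)
  then show ?thesis using ring_cover_of_cov that by blast
qed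

end

end

theorem corollary1p5:
  fixes R :: "('a, 'b) ring_scheme"
  assumes "ring R"
    and "cring (R Quot (jacobson_radical R))"
  shows "covering_number R \<noteq> 13"
proof
  assume 13: "covering_number R = 13"
  interpret Ring.ring R by (rule assms(1))
  have "coverable R"
  proof (rule ccontr)
    assume "\<not> coverable R"
    then have "covering_number R = \<infinity>" by (simp add: covering_number_def)
    then show False using 13 by simp
  qed
  then have cn: "covering_number R = Inf (ecard ` {C. ring_cover C R})" and ne: "{C. ring_cover C R} \<noteq> {}"
    by (simp_all add: covering_number_def coverable_def)
  have "covering_number R \<in> ecard ` {C. ring_cover C R}"
  proof -
    obtain e where "e \<in> ecard ` {C. ring_cover C R}" using ne by blast
    \<comment> \<open>On \<open>enat\<close> the infimum of a nonempty set is its least element, so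
      some cover attains the size 13.\<close>
    then have "(LEAST e. e \<in> ecard ` {C. ring_cover C R}) \<in> ecard ` {C. ring_cover C R}" by (rule LeastI)
    moreover have "ecard ` {C. ring_cover C R} \<noteq> {}" using ne by simp
    ultimately show ?thesis unfolding cn Inf_enat_def by (simp only: if_False)
  qed
  then obtain C where C: "ring_cover C R" "ecard C = 13" using 13 by auto
  then have "finite C" "card C = 13"
    by (auto simp: ecard_def numeral_eq_enat split: if_splits)
  then obtain D where D: "ring_cover D R" "finite D" "card D \<le> 12"
    using ring_cover_12_of_13[OF assms(2) C(1)] by auto
  have "covering_number R \<le> ecard D" unfolding cn using D(1) by (intro INF_lower) simp
  also have "\<dots> \<le> 12" using D by (simp add: ecard_def numeral_eq_enat)
  finally show False using 13 by simp
qed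

end
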